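(* Let $\widehat{\mathbf P}^\star$ be the Schr\"odinger bridge in Scenario ($\star$) with reference measure $\mathbf R$ and target distributions $\rho_0,\rho_T(\cdot,\mathsf d)$, i.e. $$\widehat{\mathbf P}^\star=\arg\min\{\mathrm{KL}(\mathbf P\|\mathbf R):\ \mathbf P_0=\rho_0,\ \mathbf P_T(\cdot,\mathsf d)=\rho_T(\cdot,\mathsf d)\}.$$ Then there exist non-negative measurable functions $\mathfrak f,\mathfrak g$ such that $$\widehat{\mathbf P}^\star=\mathfrak f\big((X_0,\tau_0),\Lambda_0\big)\,\mathfrak g\big((X_T,\tau_T),\Lambda_T\big)\,\mathbf R\qquad\text{and}\qquad \mathfrak g(\cdot,\mathsf a)\equiv1 .$$
   Context: Fix $d\ge1$, $T>0$, and two regimes $\mathsf a$ (active), $\mathsf d$ (dead). Function classes: $C_b$, $C_u$ are the bounded continuous, resp. uniformly continuous, functions on $[0,T]\times\mathbb R^d$; $\mathcal H^\alpha_u$ is the class of $g$ with $|g(t,x)-g(t,y)|\le C|x-y|^\alpha$ for all $t,x,y$. Assumption (C): for some $\alpha>0$: $b:[0,T]\times\mathbb R^d\to\mathbb R^d$ has $b_m,\nabla b_m\in C_b\cap\mathcal H^\alpha_u$; $\sigma:[0,T]\times\mathbb R^d\to\mathbb R^{d\times d}$ is such that $a=(a_{mn}):=\sigma\sigma^\top$ satisfies $a_{mn}\in C_b\cap C_u$, $\nabla a_{mn},\nabla^2a_{mn}\in C_b\cap\mathcal H^\alpha_u$, and is uniformly elliptic; $V:[0,T]\times\mathbb R^d\to[0,\infty)$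 is in $C_b\cap\mathcal H^\alpha_u$ and not identically $0$. Path space $\Omega$: c\`adl\`ag paths $((X_t,\tau_t),\Lambda_t)_{t\in[0,T]}$ in $(\mathbb R^d\times[0,T])\times\{\mathsf a,\mathsf d\}$ such that either $\Lambda\equiv\mathsf a$, $\tau\equiv0$ and $X$ is continuous on $[0,T]$, or there is a killing time $\mathfrak K\in[0,T]$ such that on $[0,\mathfrak K)$ $\Lambda=\mathsf a$, $\tau=0$, $X$ is continuous, and on $[\mathfrak K,T]$ $\Lambda=\mathsf d$ and $(X,\tau)\equiv(X_{\mathfrak K-},\mathfrak K)$. For a path measure $\mathbf P$ (probability measure on $\Omega$), $\mathbf P_t$ is the law at time $t$, $\mathbf P_t(\cdot,i)$ its part in regime $i$, $\mathbf P_{0T}$ the joint law at times $0,T$. The trivial coordinate $\tau=0$ may be omitted in the active regime. Reference measure $\mathbf R$: the strong Markov probability measure on $\Omega$ with $\mathbf R_0=\mu_0\times\delta_{\mathsf a}$ ($\mu_0$ a probability measure on $\mathbb R^d$), under which $dX_t=b(t,X_t)dt+\sigma(t,X_t)dB_t$ for $0\le t<\mathfrak K\wedge T$, killing ($\mathsf a\to\mathsf d$) occurs at rate $V(t,X_t)$, i.e. $\lim_{\varepsilon\downarrow0}\varepsilon^{-1}\mathbf R(\Lambda_{t+\varepsilon}=\mathsf d\mid\Lambda_t=\mathsf a,X_t=x)=V(t,x)$, and the dead regime is absorbing. It has an everywhere positive transition density within the active regime. Targets: as in Scenario (1), $\rho_0$ is a probability measure on $\mathbb R^d$ (in regime $\mathsf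 a$), and $\rho_T=(\rho_T(\cdot,\mathsf a),\rho_T(\cdot,\mathsf d))$ is a probability measure with $\rho_T(\cdot,\mathsf a)$ a measure on $\mathbb R^d$ and $\rho_T(\cdot,\mathsf d)$ a sub-probability measure (total mass less than $1$) with a density on $\mathbb R^d\times[0,T]$, such that Assumption (A) holds: $\mathrm{KL}(\rho_0\otimes\rho_T\|\mathbf R_{0T})<\infty$. In Scenario ($\star$) only $\rho_0$ and $\rho_T(\cdot,\mathsf d)$ are imposed as constraints. Here $\mathrm{KL}(\mathbf Q\|\mathbf P)=\mathbf E_{\mathbf Q}[\log\frac{d\mathbf Q}{d\mathbf P}]$ if $\mathbf Q\ll\mathbf P$ and $+\infty$ otherwise. The unique solution $\widehat{\mathbf P}^\star$ is assumed to exist. *)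

theory Defs
  imports "HOL-Probability.Probability"
begin

datatype regime = Active | Dead

text \<open>A state is \<open>((x, \<tau>), i)\<close> with position \<open>x\<close>, recorded killing time \<open>\<tau>\<close> and regime \<open>i\<close>.\<close>

type_synonym 'n state = "((real^'n) \<times> real) \<times> regime"

abbreviation pos :: "('n::finite) state \<Rightarrow> real^'n" where "pos z \<equiv> fst (fst z)"
abbreviation ktime :: "('n::finite) state \<Rightarrow> real" where "ktime z \<equiv> snd (fst z)"
abbreviation regime :: "('n::finite) state \<Rightarrow> regime" where "regime z \<equiv> snd z"

definition alive :: "real^'n \<Rightarrow> ('n::finite) state" where
  "alive x = ((x, 0), Active)"

definition state_space :: "('n::finite) state measure" where
  "state_space = borel \<Otimes>\<^sub>M count_space UNIV"

text \<open>The conditions below imply the cadlag property. The killed path stays at the left limit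
  \<open>x\<close> of the position at the killing time \<open>K\<close>; if \<open>K = 0\<close> there is no left limit and \<open>x\<close> is
  arbitrary. Paths are undefined outside \<open>[0,T]\<close>.\<close>

definition unkilled_path :: "real \<Rightarrow> (real \<Rightarrow> ('n::finite) state) \<Rightarrow> bool" where
  "unkilled_path T \<omega> \<longleftrightarrow>
     (\<forall>t\<in>{0..T}. regime (\<omega> t) = Active \<and> ktime (\<omega> t) = 0) \<and>
     continuous_on {0..T} (\<lambda>t. pos (\<omega> t))"

definition killed_path :: "real \<Rightarrow> real \<Rightarrow> (real \<Rightarrow> ('n::finite) state) \<Rightarrow> bool" where
  "killed_path T K \<omega> \<longleftrightarrow>
     (\<forall>t\<in>{0..<K}. regime (\<omega> t) = Active \<and> ktime (\<omega> t) = 0) \<and>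
     continuous_on {0..<K} (\<lambda>t. pos (\<omega> t)) \<and>
     (\<exists>x. (0 < K \<longrightarrow> ((\<lambda>t. pos (\<omega> t)) \<longlongrightarrow> x) (at_left K)) \<and>
          (\<forall>t\<in>{K..T}. \<omega> t = ((x, K), Dead)))"

definition paths :: "real \<Rightarrow> (real \<Rightarrow> ('n::finite) state) set" where
  "paths T = {\<omega> \<in> extensional {0..T}.
     unkilled_path T \<omega> \<or> (\<exists>K\<in>{0..T}. killed_path T K \<omega>)}"

text \<open>The \<open>\<sigma>\<close>-algebra on paths is the one generated by the coordinate maps.\<close>

definition path_space :: "real \<Rightarrow> (real \<Rightarrow> ('n::finite) state) measure" where
  "path_space T = restrict_space (\<Pi>\<^sub>M t\<in>{0..T}. state_space) (paths T)"

definition path_measure :: "real \<Rightarrow> (real \<Rightarrow> ('n::finite) state) measure \<Rightarrow> bool" where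
  "path_measure T P \<longleftrightarrow> prob_space P \<and> sets P = sets (path_space T)"

definition law_at :: "real \<Rightarrow> (real \<Rightarrow> ('n::finite) state) measure \<Rightarrow> 'n state measure" where
  "law_at t P = distr P state_space (\<lambda>\<omega>. \<omega> t)"

definition endpoint_law ::
    "real \<Rightarrow> (real \<Rightarrow> ('n::finite) state) measure \<Rightarrow> ('n state \<times> 'n state) measure" where
  "endpoint_law T P = distr P (state_space \<Otimes>\<^sub>M state_space) (\<lambda>\<omega>. (\<omega> 0, \<omega> T))"

definition regime_part ::
    "regime \<Rightarrow> ('n::finite) state measure \<Rightarrow> ((real^'n) \<times> real) measure" where
  "regime_part i M = distr (restrict_space M {z. regime z = i}) borel fst"

text \<open>The law \<open>\<mu> \<times> \<delta>\<close> that puts \<open>\<mu>\<close> in the active regime (with trivial killing-time coordinate).\<close>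

definition alive_law :: "(real^'n) measure \<Rightarrow> ('n::finite) state measure" where
  "alive_law \<mu> = distr \<mu> state_space alive"

definition bounded_cont ::
    "real \<Rightarrow> (real \<Rightarrow> real^'n \<Rightarrow> 'b::real_normed_vector) \<Rightarrow> bool" where
  "bounded_cont T g \<longleftrightarrow>
     continuous_on ({0..T} \<times> UNIV) (\<lambda>(t, x). g t x) \<and>
     bounded ((\<lambda>(t, x). g t x) ` ({0..T} \<times> UNIV))"

definition unif_cont ::
    "real \<Rightarrow> (real \<Rightarrow> real^'n \<Rightarrow> 'b::real_normed_vector) \<Rightarrow> bool" where
  "unif_cont T g \<longleftrightarrow> uniformly_continuous_on ({0..T} \<times> UNIV) (\<lambda>(t, x). g t x)"

definition unif_hoelder ::
    "real \<Rightarrow> real \<Rightarrow> (real \<Rightarrow> real^'n \<Rightarrow> 'b::real_normed_vector) \<Rightarrow> bool" where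
  "unif_hoelder \<alpha> T g \<longleftrightarrow>
     (\<exists>C. \<forall>t\<in>{0..T}. \<forall>x y. norm (g t x - g t y) \<le> C * norm (x - y) powr \<alpha>)"

definition spatial_gradient ::
    "real \<Rightarrow> (real \<Rightarrow> real^'n \<Rightarrow> real) \<Rightarrow> (real \<Rightarrow> real^'n \<Rightarrow> real^'n) \<Rightarrow> bool" where
  "spatial_gradient T g D \<longleftrightarrow>
     (\<forall>t\<in>{0..T}. \<forall>x. (g t has_derivative (\<lambda>h. D t x \<bullet> h)) (at x))"

definition spatial_hessian ::
    "real \<Rightarrow> (real \<Rightarrow> real^'n \<Rightarrow> real) \<Rightarrow> (real \<Rightarrow> real^'n \<Rightarrow> real^'n^'n) \<Rightarrow> bool" where
  "spatial_hessian T g H \<longleftrightarrow>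
     (\<exists>D. spatial_gradient T g D \<and>
        (\<forall>t\<in>{0..T}. \<forall>x. (D t has_derivative (\<lambda>h. H t x *v h)) (at x)))"

definition diffusion_matrix ::
    "(real \<Rightarrow> real^'n \<Rightarrow> real^'n^'n) \<Rightarrow> real \<Rightarrow> real^'n \<Rightarrow> real^'n^'n" where
  "diffusion_matrix \<sigma> t x = \<sigma> t x ** transpose (\<sigma> t x)"

definition uniformly_elliptic ::
    "real \<Rightarrow> (real \<Rightarrow> real^'n \<Rightarrow> real^'n^'n) \<Rightarrow> bool" where
  "uniformly_elliptic T a \<longleftrightarrow>
     (\<exists>c>0. \<forall>t\<in>{0..T}. \<forall>x \<xi>. \<xi> \<bullet> (a t x *v \<xi>) \<ge> c * (norm \<xi>)\<^sup>2)"

definition coefficient_assumption ::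
    "real \<Rightarrow> (real \<Rightarrow> real^'n \<Rightarrow> real^'n) \<Rightarrow> (real \<Rightarrow> real^'n \<Rightarrow> real^'n^'n) \<Rightarrow>
     (real \<Rightarrow> real^'n \<Rightarrow> real) \<Rightarrow> bool" where
  "coefficient_assumption T b \<sigma> V \<longleftrightarrow> (\<exists>\<alpha>>0.
     (\<forall>m. bounded_cont T (\<lambda>t x. b t x $ m) \<and> unif_hoelder \<alpha> T (\<lambda>t x. b t x $ m) \<and>
        (\<exists>D. spatial_gradient T (\<lambda>t x. b t x $ m) D \<and>
             bounded_cont T D \<and> unif_hoelder \<alpha> T D)) \<and>
     (\<forall>m n. let a = (\<lambda>t x. diffusion_matrix \<sigma> t x $ m $ n) in
        bounded_cont T a \<and> unif_cont T a \<and>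
        (\<exists>D. spatial_gradient T a D \<and> bounded_cont T D \<and> unif_hoelder \<alpha> T D) \<and>
        (\<exists>H. spatial_hessian T a H \<and> bounded_cont T H \<and> unif_hoelder \<alpha> T H)) \<and>
     uniformly_elliptic T (diffusion_matrix \<sigma>) \<and>
     bounded_cont T V \<and> unif_hoelder \<alpha> T V \<and>
     (\<forall>t\<in>{0..T}. \<forall>x. V t x \<ge> 0) \<and>
     (\<exists>t\<in>{0..T}. \<exists>x. V t x \<noteq> 0))"

definition brownian_motion ::
    "real \<Rightarrow> 'w measure \<Rightarrow> (real \<Rightarrow> 'w measure) \<Rightarrow> (real \<Rightarrow> 'w \<Rightarrow> real^'n) \<Rightarrow> bool" where
  "brownian_motion T W G B \<longleftrightarrow>
     (\<forall>t\<in>{0..T}. B t \<in> borel_measurable (G t)) \<and>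
     (AE w in W. B 0 w = 0 \<and> continuous_on {0..T} (\<lambda>t. B t w)) \<and>
     (\<forall>s t. 0 \<le> s \<and> s < t \<and> t \<le> T \<longrightarrow>
        prob_space.indep_set W (sets (G s))
          {(\<lambda>w. B t w - B s w) -` A \<inter> space W | A. A \<in> sets borel} \<and>
        prob_space.indep_vars W (\<lambda>_. borel) (\<lambda>i w. (B t w - B s w) $ i) UNIV \<and>
        (\<forall>i. distributed W lborel (\<lambda>w. (B t w - B s w) $ i) (normal_density 0 (sqrt (t - s)))))"

text \<open>Elementary integrands \<open>\<Sum>k<N. \<xi> k 1(u k, u (k+1)]\<close> with matrix values, and their integrals.\<close>

definition elementary_process ::
    "real \<Rightarrow> (real \<Rightarrow> 'w measure) \<Rightarrow> nat \<Rightarrow> (nat \<Rightarrow> real) \<Rightarrow> (nat \<Rightarrow> 'w \<Rightarrow> real^'n^'n) \<Rightarrow> bool" where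
  "elementary_process T G N u \<xi> \<longleftrightarrow>
     (\<forall>k<N. 0 \<le> u k \<and> u k \<le> u (Suc k) \<and> u (Suc k) \<le> T \<and>
        \<xi> k \<in> borel_measurable (G (u k)) \<and> bounded (\<xi> k ` space (G (u k))))"

definition elementary_value ::
    "nat \<Rightarrow> (nat \<Rightarrow> real) \<Rightarrow> (nat \<Rightarrow> 'w \<Rightarrow> real^'n^'n) \<Rightarrow> real \<Rightarrow> 'w \<Rightarrow> real^'n^'n" where
  "elementary_value N u \<xi> s w = (\<Sum>k<N. indicator {u k<..u (Suc k)} s *\<^sub>R \<xi> k w)"

definition elementary_integral ::
    "nat \<Rightarrow> (nat \<Rightarrow> real) \<Rightarrow> (nat \<Rightarrow> 'w \<Rightarrow> real^'n^'n) \<Rightarrow> (real \<Rightarrow> 'w \<Rightarrow> real^'n) \<Rightarrow>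
     real \<Rightarrow> 'w \<Rightarrow> real^'n" where
  "elementary_integral N u \<xi> B t w =
     (\<Sum>k<N. \<xi> k w *v (B (min t (u (Suc k))) w - B (min t (u k)) w))"

text \<open>\<open>I\<close> is the (continuous) process \<open>\<integral>\<^sub>0\<^sup>t H dB\<close>: the integrals of elementary processes that
  converge to \<open>H\<close> in \<open>L\<^sup>2(0,T)\<close> in probability converge to \<open>I t\<close> in probability. This determines
  \<open>I\<close> up to indistinguishability.\<close>

definition has_ito_integral ::
    "real \<Rightarrow> 'w measure \<Rightarrow> (real \<Rightarrow> 'w measure) \<Rightarrow> (real \<Rightarrow> 'w \<Rightarrow> real^'n) \<Rightarrow>
     (real \<Rightarrow> 'w \<Rightarrow> real^'n^'n) \<Rightarrow> (real \<Rightarrow> 'w \<Rightarrow> real^'n) \<Rightarrow> bool" where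
  "has_ito_integral T W G B H I \<longleftrightarrow>
     (\<forall>t\<in>{0..T}. (\<lambda>(s, w). H s w) \<in> borel_measurable (restrict_space borel {0..t} \<Otimes>\<^sub>M G t)) \<and>
     (\<forall>t\<in>{0..T}. I t \<in> borel_measurable W) \<and>
     (AE w in W. continuous_on {0..T} (\<lambda>t. I t w)) \<and>
     (\<exists>N u \<xi>. (\<forall>n::nat. elementary_process T G (N n) (u n) (\<xi> n)) \<and>
        (\<forall>e>0. (\<lambda>n. measure W {w \<in> space W. ennreal e <
            (\<integral>\<^sup>+s\<in>{0..T}. ennreal ((norm (elementary_value (N n) (u n) (\<xi> n) s w - H s w))\<^sup>2) \<partial>lborel)})
          \<longlonglongrightarrow> 0) \<and>
        (\<forall>t\<in>{0..T}. \<forall>e>0. (\<lambda>n. measure W {w \<in> space W. e <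
            norm (elementary_integral (N n) (u n) (\<xi> n) B t w - I t w)}) \<longlonglongrightarrow> 0))"

text \<open>A weak solution of \<open>dX = b dt + \<sigma> dB\<close> up to the killing time: a probability space \<open>W\<close>
  with filtration \<open>G\<close>, Brownian motion \<open>B\<close> and an adapted random path \<open>Z\<close>. It lives on its own
  probability space because a killed path carries no Brownian motion after its killing time.
  The regime at time \<open>t\<close> is active exactly when \<open>t\<close> lies before the killing time.\<close>

definition killed_weak_solution ::
    "real \<Rightarrow> (real \<Rightarrow> real^'n \<Rightarrow> real^'n) \<Rightarrow> (real \<Rightarrow> real^'n \<Rightarrow> real^'n^'n) \<Rightarrow>
     'w measure \<Rightarrow> (real \<Rightarrow> 'w measure) \<Rightarrow> (real \<Rightarrow> 'w \<Rightarrow> real^'n) \<Rightarrow>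
     ('w \<Rightarrow> real \<Rightarrow> ('n::finite) state) \<Rightarrow> bool" where
  "killed_weak_solution T b \<sigma> W G B Z \<longleftrightarrow>
     prob_space W \<and> filtration (space W) G \<and> (\<forall>t. sets (G t) \<subseteq> sets W) \<and>
     brownian_motion T W G B \<and>
     Z \<in> W \<rightarrow>\<^sub>M path_space T \<and>
     (\<forall>t\<in>{0..T}. (\<lambda>w. Z w t) \<in> G t \<rightarrow>\<^sub>M state_space) \<and>
     (\<exists>I. has_ito_integral T W G B
            (\<lambda>s w. if regime (Z w s) = Active then \<sigma> s (pos (Z w s)) else 0) I \<and>
          (AE w in W. \<forall>t\<in>{0..T}. regime (Z w t) = Active \<longrightarrow>
             pos (Z w t) =
               pos (Z w 0) + integral {0..t} (\<lambda>s. b s (pos (Z w s))) + I t w))"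

definition path_filtration :: "real \<Rightarrow> real \<Rightarrow> (real \<Rightarrow> ('n::finite) state) measure" where
  "path_filtration T t = sigma (paths T)
     {(\<lambda>\<omega>. \<omega> s) -` A \<inter> paths T | s A. s \<in> {0..T} \<and> s \<le> t \<and> A \<in> sets state_space}"

definition transition_function ::
    "real \<Rightarrow> (real \<Rightarrow> real \<Rightarrow> ('n::finite) state \<Rightarrow> 'n state measure) \<Rightarrow> bool" where
  "transition_function T \<kappa> \<longleftrightarrow>
     (\<lambda>((s, t), z). \<kappa> s t z) \<in>
       restrict_space borel {(s, t). 0 \<le> s \<and> s \<le> t \<and> t \<le> T} \<Otimes>\<^sub>M state_space
         \<rightarrow>\<^sub>M prob_algebra state_space \<and>
     (\<forall>s\<in>{0..T}. \<forall>z. \<kappa> s s z = return state_space z) \<and>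
     (\<forall>s t u z. 0 \<le> s \<and> s \<le> t \<and> t \<le> u \<and> u \<le> T \<longrightarrow> \<kappa> s u z = \<kappa> s t z \<bind> \<kappa> t u)"

definition strong_markov ::
    "real \<Rightarrow> (real \<Rightarrow> real \<Rightarrow> ('n::finite) state \<Rightarrow> 'n state measure) \<Rightarrow>
     (real \<Rightarrow> 'n state) measure \<Rightarrow> bool" where
  "strong_markov T \<kappa> R \<longleftrightarrow>
     (\<forall>\<theta> r A. stopping_time (path_filtration T) \<theta> \<and> (\<forall>\<omega>\<in>paths T. \<theta> \<omega> \<in> {0..T}) \<and>
        0 \<le> r \<and> A \<in> sets state_space \<longrightarrow>
        (AE \<omega> in R.
           real_cond_exp R (filtration.pre_sigma (paths T) (path_filtration T) \<theta>)
             (\<lambda>\<omega>. indicator A (\<omega> (min (\<theta> \<omega> + r) T))) \<omega>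
           = measure (\<kappa> (\<theta> \<omega>) (min (\<theta> \<omega> + r) T) (\<omega> (\<theta> \<omega>))) A))"

text \<open>The conditional probability \<open>R(\<Lambda>\<^sub>t\<^sub>+\<^sub>\<epsilon> = Dead | \<Lambda>\<^sub>t = Active, X\<^sub>t = x)\<close> is the one given by the
  transition function.\<close>

definition killing_rate ::
    "real \<Rightarrow> (real \<Rightarrow> real \<Rightarrow> ('n::finite) state \<Rightarrow> 'n state measure) \<Rightarrow>
     (real \<Rightarrow> real^'n \<Rightarrow> real) \<Rightarrow> bool" where
  "killing_rate T \<kappa> V \<longleftrightarrow>
     (\<forall>t\<in>{0..<T}. \<forall>x.
        ((\<lambda>\<epsilon>. measure (\<kappa> t (t + \<epsilon>) (alive x)) {z. regime z = Dead} / \<epsilon>) \<longlongrightarrow> V t x) (at_right 0))"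

definition dead_absorbing ::
    "real \<Rightarrow> (real \<Rightarrow> real \<Rightarrow> ('n::finite) state \<Rightarrow> 'n state measure) \<Rightarrow> bool" where
  "dead_absorbing T \<kappa> \<longleftrightarrow>
     (\<forall>s t z. 0 \<le> s \<and> s \<le> t \<and> t \<le> T \<and> regime z = Dead \<longrightarrow> \<kappa> s t z = return state_space z)"

definition positive_active_density ::
    "real \<Rightarrow> (real \<Rightarrow> real \<Rightarrow> ('n::finite) state \<Rightarrow> 'n state measure) \<Rightarrow> bool" where
  "positive_active_density T \<kappa> \<longleftrightarrow>
     (\<exists>p :: real \<Rightarrow> real^'n \<Rightarrow> real \<Rightarrow> real^'n \<Rightarrow> real.
        \<forall>s t x. 0 \<le> s \<and> s < t \<and> t \<le> T \<longrightarrow>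
          p s x t \<in> borel_measurable borel \<and> (\<forall>y. p s x t y > 0) \<and>
          (\<forall>A\<in>sets borel. emeasure (\<kappa> s t (alive x)) (alive ` A) =
             (\<integral>\<^sup>+y\<in>A. ennreal (p s x t y) \<partial>lborel)))"

definition reference_measure ::
    "real \<Rightarrow> (real \<Rightarrow> real^'n \<Rightarrow> real^'n) \<Rightarrow> (real \<Rightarrow> real^'n \<Rightarrow> real^'n^'n) \<Rightarrow>
     (real \<Rightarrow> real^'n \<Rightarrow> real) \<Rightarrow> (real^'n) measure \<Rightarrow>
     'w measure \<Rightarrow> (real \<Rightarrow> 'w measure) \<Rightarrow> (real \<Rightarrow> 'w \<Rightarrow> real^'n) \<Rightarrow>
     ('w \<Rightarrow> real \<Rightarrow> ('n::finite) state) \<Rightarrow> (real \<Rightarrow> 'n state) measure \<Rightarrow> bool" where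
  "reference_measure T b \<sigma> V \<mu>0 W G B Z R \<longleftrightarrow>
     path_measure T R \<and>
     law_at 0 R = alive_law \<mu>0 \<and>
     killed_weak_solution T b \<sigma> W G B Z \<and> distr W (path_space T) Z = R \<and>
     (\<exists>\<kappa>. transition_function T \<kappa> \<and> strong_markov T \<kappa> R \<and>
        killing_rate T \<kappa> V \<and> dead_absorbing T \<kappa> \<and> positive_active_density T \<kappa>)"

text \<open>\<open>KL Q P\<close> is the divergence of \<open>Q\<close> from \<open>P\<close>; the library's \<open>KL_divergence\<close> takes the
  reference first. For probability measures the negative part of the log-density is always
  \<open>Q\<close>-integrable, so a non-integrable log-density means that the expectation is \<open>\<infinity>\<close>.\<close>

definition KL :: "'a measure \<Rightarrow> 'a measure \<Rightarrow> ereal" where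
  "KL Q P =
     (if absolutely_continuous P Q \<and> integrable Q (entropy_density (exp 1) P Q)
      then ereal (KL_divergence (exp 1) P Q) else \<infinity>)"

definition terminal_target :: "real \<Rightarrow> ('n::finite) state measure \<Rightarrow> bool" where
  "terminal_target T \<rho>T \<longleftrightarrow>
     prob_space \<rho>T \<and> sets \<rho>T = sets state_space \<and>
     (AE z in \<rho>T. regime z = Active \<longrightarrow> ktime z = 0) \<and>
     emeasure (regime_part Dead \<rho>T) UNIV < 1 \<and>
     (\<exists>q\<in>borel_measurable borel.
        regime_part Dead \<rho>T = density lborel (\<lambda>z. q z * indicator (UNIV \<times> {0..T}) z))"

definition star_admissible ::
    "real \<Rightarrow> (real^'n) measure \<Rightarrow> ((real^'n) \<times> real) measure \<Rightarrow>
     (real \<Rightarrow> ('n::finite) state) measure \<Rightarrow> bool" where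
  "star_admissible T \<rho>0 \<rho>Td P \<longleftrightarrow>
     path_measure T P \<and> law_at 0 P = alive_law \<rho>0 \<and> regime_part Dead (law_at T P) = \<rho>Td"

definition star_bridge ::
    "real \<Rightarrow> (real \<Rightarrow> ('n::finite) state) measure \<Rightarrow> (real^'n) measure \<Rightarrow>
     ((real^'n) \<times> real) measure \<Rightarrow> (real \<Rightarrow> 'n state) measure \<Rightarrow> bool" where
  "star_bridge T R \<rho>0 \<rho>Td P \<longleftrightarrow>
     is_arg_min (\<lambda>Q. KL Q R) (star_admissible T \<rho>0 \<rho>Td) P \<and>
     (\<forall>Q. is_arg_min (\<lambda>Q. KL Q R) (star_admissible T \<rho>0 \<rho>Td) Q \<longrightarrow> Q = P)"

end

theory Submission
  imports Defs
begin

text \<open>The density of the bridge minimises a strictly convex entropy under constraints that do not see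
  where the surviving paths end. Averaging over the surviving endpoints is therefore free, and all of
  them may be collapsed to a single point, which is an atom of the terminal law. For the collapsed
  problem the minimiser \<open>\<phi>(x, z)\<close> satisfies a first-order condition against perturbations with
  vanishing marginals. The atom lets one compensate any perturbation on the dead part, and this
  forces \<open>ln \<phi>(x, z) - ln \<phi>(x, star)\<close> to depend on \<open>z\<close> only; hence \<open>f(x) = \<phi>(x, star)\<close> and
  \<open>g(star) = 1\<close>. The argument takes place on a product set because the endpoint law of \<open>R\<close> is
  absolutely continuous with respect to the product of its marginals (a consequence of the positive
  transition density), while the product target, which has finite entropy, shows that the minimiser
  is positive wherever it has to be.\<close>

section \<open>Additive functions on a product space with an atom\<close>

text \<open>The classical difficulty is that a limit of sums \<open>f x + g z\<close> need not
  visibly be such a sum again. Reading both summands off the single section at \<open>star\<close>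
  avoids approximation; the section is meaningful because an atom of positive mass lies in no null
  set, and the mass is positive because the dead target has total mass below 1. Perturbations have
  to be bounded to leave the density nonnegative, whereas the log-density is only integrable. It is
  therefore replaced by a bounded strictly increasing transform; two strictly increasing functions
  of one variable have zero covariance only if that variable is almost surely constant. Null sets
  are compared with the product of the collapsed marginals of the bridge itself. The collapsed
  endpoint law of the bridge and this product are mutually absolutely continuous, but
  \<open>R\<close> can charge a larger set. There \<open>h\<close> vanishes, and this zero is built
  into the factors by cutting them off where a marginal density vanishes.\<close>

lemma AE_atom:
  assumes "AE x in M. Q x" "{a} \<in> sets M" "emeasure M {a} \<noteq> 0"
  shows "Q a"
proof (rule ccontr)
  assume "\<not> Q a"
  obtain N where N: "{x \<in> space M. \<not> Q x} \<subseteq> N" "emeasure M N = 0" "N \<in> sets M"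
    using assms(1) by (rule AE_E)
  have "{a} \<subseteq> N" using N \<open>\<not> Q a\<close> sets.sets_into_space[OF assms(2)] by auto
  then have "emeasure M {a} \<le> emeasure M N" using N by (intro emeasure_mono)
  with N assms(3) show False by simp
qed

lemma integral_indicator_singleton:
  fixes f :: "'a \<Rightarrow> real"
  assumes "{a} \<in> sets M" "emeasure M {a} < \<infinity>"
  shows "integrable M (\<lambda>x. indicator {a} x * f x)"
    and "(\<integral>x. indicator {a} x * f x \<partial>M) = f a * measure M {a}"
proof -
  have eq: "(\<lambda>x. indicator {a} x * f x) = (\<lambda>x. indicator {a} x * f a)"
    by (auto simp: indicator_def fun_eq_iff)
  have i: "integrable M (indicator {a} :: 'a \<Rightarrow> real)"
    using assms by (intro integrable_real_indicator) auto
  show "integrable M (\<lambda>x. indicator {a} x * f x)"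
    unfolding eq using i by (intro integrable_mult_left)
  show "(\<integral>x. indicator {a} x * f x \<partial>M) = f a * measure M {a}"
    unfolding eq using i sets.sets_into_space[OF assms(1)]
    by (simp add: Int_absorb2 mult.commute)
qed

lemma integrable_mult_AE_bounded:
  fixes f g :: "'a \<Rightarrow> real"
  assumes "integrable M f" "g \<in> borel_measurable M" "AE x in M. \<bar>g x\<bar> \<le> C"
  shows "integrable M (\<lambda>x. g x * f x)"
proof (rule Bochner_Integration.integrable_bound[of _ "\<lambda>x. C * f x"])
  show "integrable M (\<lambda>x. C * f x)" using assms(1) by simp
  show "(\<lambda>x. g x * f x) \<in> borel_measurable M" using assms(1,2) by measurable
  show "AE x in M. norm (g x * f x) \<le> norm (C * f x)"
    using assms(3) by eventually_elim (auto simp: abs_mult intro!: mult_right_mono)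
qed

text \<open>Since \<open>m = arctan (tan m)\<close> on this range, both factors have the sign of
  \<open>L - tan m\<close>. The product is the integrand of a covariance, and the equality case
  turns a vanishing integral into constancy.\<close>

lemma arctan_tan_sgn:
  fixes m L :: real
  assumes "- (pi/2) < m" "m < pi/2"
  shows "0 \<le> (arctan L - m) * (L - tan m)"
    and "(arctan L - m) * (L - tan m) = 0 \<Longrightarrow> L = tan m"
proof -
  have m: "m = arctan (tan m)" using assms by (simp add: arctan_tan)
  have "(arctan L - arctan (tan m)) * (L - tan m) \<ge> 0"
  proof (cases "L \<le> tan m")
    case True
    then show ?thesis by (intro mult_nonpos_nonpos) (auto simp: arctan_le_iff)
  next
    case False
    then show ?thesis by (intro mult_nonneg_nonneg) (auto simp: arctan_le_iff)
  qed
  then show "0 \<le> (arctan L - m) * (L - tan m)" using m by simp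
  assume "(arctan L - m) * (L - tan m) = 0"
  then show "L = tan m" using assms tan_arctan by auto
qed

text \<open>Perturb by \<open>u = q (l - m)\<close>, where \<open>l = arctan (H(x,z) - H(x,star))\<close>, \<open>q x = n(x,star)\<close> and
  \<open>m z\<close> is the mean of \<open>l(_,z)\<close> weighted by \<open>q n\<close>; the value of \<open>u\<close> at the atom restores the
  first marginal. The first-order condition then says that the covariance of \<open>l\<close> and \<open>tan l\<close>
  vanishes for almost every \<open>z\<close>. The factor \<open>q\<close> makes \<open>u\<close> bounded at the atom.\<close>

lemma additive_decomposition:
  fixes M1 :: "'a measure" and M2 :: "'b measure" and n H :: "'a \<times> 'b \<Rightarrow> real"
  assumes M1: "prob_space M1" and M2: "prob_space M2"
    and star: "{star} \<in> sets M2" "measure M2 {star} > 0"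
    and n_meas[measurable]: "n \<in> borel_measurable (M1 \<Otimes>\<^sub>M M2)"
    and n_pos: "\<And>p. n p > 0" and n_int: "integrable (M1 \<Otimes>\<^sub>M M2) n"
    and marg1: "AE x in M1. (\<integral>z. n (x, z) \<partial>M2) = 1"
    and marg2: "AE z in M2. (\<integral>x. n (x, z) \<partial>M1) = 1"
    and H_meas[measurable]: "H \<in> borel_measurable (M1 \<Otimes>\<^sub>M M2)"
    and nH_int: "integrable (M1 \<Otimes>\<^sub>M M2) (\<lambda>p. n p * H p)"
    and foc: "\<And>u C. u \<in> borel_measurable (M1 \<Otimes>\<^sub>M M2) \<Longrightarrow> (\<And>p. \<bar>u p\<bar> \<le> C) \<Longrightarrow>
        (AE x in M1. (\<integral>z. u (x, z) * n (x, z) \<partial>M2) = 0) \<Longrightarrow>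
        (AE z in M2. (\<integral>x. u (x, z) * n (x, z) \<partial>M1) = 0) \<Longrightarrow>
        (\<integral>p. u p * (n p * H p) \<partial>(M1 \<Otimes>\<^sub>M M2)) = 0"
  shows "\<exists>c \<in> borel_measurable M2. AE p in M1 \<Otimes>\<^sub>M M2. H p - H (fst p, star) = c (snd p)"
proof -
  interpret M1: prob_space M1 by fact
  interpret M2: prob_space M2 by fact
  interpret P: pair_prob_space M1 M2 ..
  let ?N = "M1 \<Otimes>\<^sub>M M2"
  have star_sp[measurable]: "star \<in> space M2" using star(1) sets.sets_into_space by fastforce
  have [measurable]: "{star} \<in> sets M2" by fact
  define \<nu> where "\<nu> = measure M2 {star}"
  have \<nu>: "\<nu> > 0" using star \<nu>_def by simp
  have e\<nu>: "emeasure M2 {star} \<noteq> 0" "emeasure M2 {star} < \<infinity>"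
    using \<nu> unfolding \<nu>_def by (auto simp: measure_def M2.emeasure_finite less_top[symmetric])

  \<comment> \<open>Section at the atom, bounded transform and column means\<close>
  define q where "q x = n (x, star)" for x
  have q_meas[measurable]: "q \<in> borel_measurable M1" unfolding q_def by measurable
  have q_pos: "q x > 0" for x unfolding q_def by (rule n_pos)
  define L where "L p = H p - H (fst p, star)" for p
  have L_meas[measurable]: "L \<in> borel_measurable ?N" unfolding L_def by measurable
  define l where "l p = arctan (L p)" for p
  have l_meas[measurable]: "l \<in> borel_measurable ?N" unfolding l_def by measurable
  have l_bd: "- (pi/2) < l p" "l p < pi/2" for p unfolding l_def using arctan_bounded[of "L p"] by auto
  have l_abs: "\<bar>l p\<bar> \<le> pi/2" for p using l_bd[of p] by (auto simp: abs_le_iff)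
  have L_star: "L (x, star) = 0" "l (x, star) = 0" for x unfolding l_def L_def by auto

  have n_int1: "AE x in M1. integrable M2 (\<lambda>z. n (x, z))" using P.AE_integrable_fst'[OF n_int] .
  \<comment> \<open>Going through the swapped product measure gives this for arbitrary
    \<open>Q\<close>; exchanging the two quantifiers directly would ask for a measurable
    set.\<close>
  have AE_swap: "AE z in M2. AE x in M1. Q (x, z)" if "AE p in ?N. Q p" for Q
  proof -
    have "AE p in M2 \<Otimes>\<^sub>M M1. Q (snd p, fst p)"
    proof -
      have "AE p in distr (M2 \<Otimes>\<^sub>M M1) ?N (\<lambda>(x, y). (y, x)). Q p"
        by (subst P.distr_pair_swap[symmetric]) (rule that)
      from AE_distrD[OF _ this] show ?thesis by (simp add: case_prod_beta)
    qed
    then show ?thesis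
      using pair_sigma_finite.AE_pair[of M2 M1 "\<lambda>p. Q (snd p, fst p)"] by (simp add: pair_sigma_finite_def M1.sigma_finite_measure_axioms M2.sigma_finite_measure_axioms)
  qed
  have int_swap: "AE z in M2. integrable M1 (\<lambda>x. f (x, z))"
    "(\<integral>z. (\<integral>x. f (x, z) \<partial>M1) \<partial>M2) = integral\<^sup>L ?N f" "integrable M2 (\<lambda>z. \<integral>x. f (x, z) \<partial>M1)"
    if "integrable ?N f" for f :: "_ \<Rightarrow> real"
    using P.AE_integrable_snd[of "\<lambda>x y. f (x, y)"] P.integral_snd[of "\<lambda>x y. f (x, y)"] P.integrable_snd[of "\<lambda>x y. f (x, y)"] that
    by auto

  \<comment> \<open>The atom alone contributes \<open>q x * \<nu>\<close> to the fibre integral of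
    the positive function \<open>n\<close>, and that integral is 1.\<close>
  have q_bd: "AE x in M1. q x \<le> 1 / \<nu>"
    using n_int1 marg1
  proof eventually_elim
    case (elim x)
    have "q x * \<nu> = (\<integral>z. indicator {star} z * n (x, z) \<partial>M2)"
      using integral_indicator_singleton(2)[OF star(1) e\<nu>(2), of "\<lambda>z. n (x,z)"] by (simp add: q_def \<nu>_def)
    also have "\<dots> \<le> (\<integral>z. n (x, z) \<partial>M2)"
      using integral_indicator_singleton(1)[OF star(1) e\<nu>(2), of "\<lambda>z. n (x,z)"] elim(1) n_pos
      by (intro integral_mono) (auto simp: indicator_def less_imp_le)
    finally show ?case using elim \<nu> by (simp add: field_simps)
  qed
  have AE_fst: "AE p in ?N. Q (fst p)" if "AE x in M1. Q x" "Measurable.pred M1 Q" for Q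
    using that by (intro P.AE_pair_measure) (auto simp: pred_def)
  have AE_snd: "AE p in ?N. Q (snd p)" if "AE x in M2. Q x" "Measurable.pred M2 Q" for Q
    using that by (intro P.AE_pair_measure) (auto simp: pred_def)
  have q_bdN: "AE p in ?N. \<bar>q (fst p)\<bar> \<le> 1 / \<nu>"
    using AE_fst[OF q_bd] q_pos by (auto simp: abs_of_pos)

  have qn_int: "integrable ?N (\<lambda>p. q (fst p) * n p)"
    by (rule integrable_mult_AE_bounded[OF n_int _ q_bdN]) auto
  have qnl_int: "integrable ?N (\<lambda>p. l p * (q (fst p) * n p))"
    by (rule integrable_mult_AE_bounded[OF qn_int _, where C="pi/2"]) (use l_abs in auto)

  define den where "den z = (\<integral>x. q x * n (x, z) \<partial>M1)" for z
  define num where "num z = (\<integral>x. l (x, z) * (q x * n (x, z)) \<partial>M1)" for z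
  define m where "m z = num z / den z" for z
  have [measurable]: "den \<in> borel_measurable M2" "num \<in> borel_measurable M2"
    unfolding den_def num_def by measurable
  then have m_meas[measurable]: "m \<in> borel_measurable M2" unfolding m_def by measurable
  \<comment> \<open>On the section at \<open>star\<close> the function \<open>l\<close> is 0, hence
    so is its mean; \<open>w\<close> will vanish there and the atom stays free for the
    correction.\<close>
  have m_star: "m star = 0" unfolding m_def num_def by (simp add: L_star)
  \<comment> \<open>A mean of values strictly inside \<open>(-pi/2, pi/2)\<close> with positive
    weights stays strictly inside, so \<open>tan (m z)\<close> inverts the transform.\<close>
  have m_bd: "AE z in M2. den z > 0 \<and> - (pi/2) < m z \<and> m z < pi/2"
    using int_swap(1)[OF qn_int] int_swap(1)[OF qnl_int] AE_space
  proof eventually_elim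
    case (elim z)
    note [measurable] = elim(3)
    have i: "integrable M1 (\<lambda>x. q x * n (x, z))" "integrable M1 (\<lambda>x. l (x, z) * (q x * n (x, z)))"
      using elim by auto
    have pos: "q x * n (x, z) > 0" for x using q_pos n_pos by simp
    have "(\<integral>x. 0 \<partial>M1) < den z" unfolding den_def
      using i pos by (intro M1.integral_less_AE_space) (auto simp: M1.emeasure_space_1)
    moreover have "num z < (\<integral>x. (pi/2) * (q x * n (x, z)) \<partial>M1)" unfolding num_def
      using i pos l_bd
      by (intro M1.integral_less_AE_space AE_I2 mult_strict_right_mono) (simp_all add: M1.emeasure_space_1 del: less_divide_eq_numeral1)
    moreover have "(\<integral>x. (- (pi/2)) * (q x * n (x, z)) \<partial>M1) < num z" unfolding num_def
      using i pos l_bd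
      by (intro M1.integral_less_AE_space AE_I2 mult_strict_right_mono) (simp_all add: M1.emeasure_space_1 del: less_divide_eq_numeral1)
    ultimately have "den z > 0" "num z < (pi/2) * den z" "- (pi/2) * den z < num z"
      unfolding den_def integral_mult_right_zero by simp_all
    then show ?case unfolding m_def by (auto simp: field_simps)
  qed
  have m_bdN: "AE p in ?N. - (pi/2) < m (snd p) \<and> m (snd p) < pi/2"
    by (rule AE_snd) (use m_bd in auto)
  have lm_bd: "AE p in ?N. \<bar>l p - m (snd p)\<bar> \<le> pi"
    using m_bdN
  proof eventually_elim
    case (elim p) then show ?case using l_bd[of p] by (auto simp: abs_le_iff)
  qed

  \<comment> \<open>A bounded perturbation with vanishing marginals\<close>
  have tan_m_meas[measurable]: "(\<lambda>z. tan (m z)) \<in> borel_measurable M2" unfolding tan_def by measurable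
  define w where "w p = q (fst p) * (l p - m (snd p))" for p
  have [measurable]: "w \<in> borel_measurable ?N" unfolding w_def by measurable
  have w_star: "w (x, star) = 0" for x unfolding w_def by (simp add: L_star m_star)
  have w_bd: "AE p in ?N. \<bar>w p\<bar> \<le> pi / \<nu>"
    using lm_bd q_bdN
  proof eventually_elim
    case (elim p)
    have "\<bar>w p\<bar> \<le> (1/\<nu>) * pi" unfolding w_def abs_mult using elim \<nu> by (intro mult_mono) auto
    then show ?case by simp
  qed
  have lmn_int: "integrable ?N (\<lambda>p. (l p - m (snd p)) * n p)"
    by (rule integrable_mult_AE_bounded[OF n_int _ lm_bd]) auto
  define v where "v x = (\<integral>z. (l (x, z) - m z) * n (x, z) \<partial>M2)" for x
  have v_meas[measurable]: "v \<in> borel_measurable M1" unfolding v_def by measurable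
  have v_bd: "AE x in M1. \<bar>v x\<bar> \<le> pi"
    using n_int1 marg1 P.AE_integrable_fst'[OF lmn_int] P.AE_pair[OF lm_bd]
  proof eventually_elim
    case (elim x)
    have "\<bar>v x\<bar> \<le> (\<integral>z. \<bar>(l (x, z) - m z) * n (x, z)\<bar> \<partial>M2)" unfolding v_def by (rule integral_abs_bound)
    also have "\<dots> \<le> (\<integral>z. pi * n (x, z) \<partial>M2)"
    proof (rule integral_mono_AE)
      have "integrable M2 (\<lambda>z. (l (x, z) - m z) * n (x, z))" using elim(3) by simp
      then show "integrable M2 (\<lambda>z. \<bar>(l (x, z) - m z) * n (x, z)\<bar>)" by (rule integrable_abs)
      show "integrable M2 (\<lambda>z. pi * n (x, z))" using elim by simp
      show "AE z in M2. \<bar>(l (x, z) - m z) * n (x, z)\<bar> \<le> pi * n (x, z)"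
        using elim(4) by eventually_elim (use n_pos in \<open>auto simp: abs_mult abs_of_pos\<close>)
    qed
    also have "\<dots> = pi" using elim by simp
    finally show ?case .
  qed
  \<comment> \<open>\<open>w\<close> has zero column integrals but leaves \<open>q x * v x\<close>
    in the row of \<open>x\<close>. At the atom \<open>n (x, star)\<close> equals
    \<open>q x\<close>, so the amount \<open>v x / \<nu>\<close> cancels it without a division by
    \<open>q x\<close>.\<close>
  define u where "u p = w p - indicator {star} (snd p) * (v (fst p) / \<nu>)" for p
  have u_meas[measurable]: "u \<in> borel_measurable ?N" unfolding u_def by measurable
  have v_bdN: "AE p in ?N. \<bar>v (fst p)\<bar> \<le> pi" using AE_fst[OF v_bd] by auto
  define C where "C = pi/\<nu> + pi/\<nu>"
  have C0: "C \<ge> 0" using \<nu> by (simp add: C_def)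
  have u_bd: "AE p in ?N. \<bar>u p\<bar> \<le> C"
    using w_bd v_bdN
  proof eventually_elim
    case (elim p)
    have "\<bar>indicator {star} (snd p) * (v (fst p) / \<nu>)\<bar> \<le> pi/\<nu>"
      using elim \<nu> by (auto simp: indicator_def divide_right_mono)
    then show ?case using elim unfolding u_def C_def by linarith
  qed

  have wn_int: "integrable ?N (\<lambda>p. w p * n p)"
    by (rule integrable_mult_AE_bounded[OF n_int _ w_bd]) auto
  have wn2: "AE z in M2. (\<integral>x. w (x, z) * n (x, z) \<partial>M1) = 0"
    using int_swap(1)[OF qn_int] int_swap(1)[OF qnl_int] m_bd
  proof eventually_elim
    case (elim z)
    have "(\<integral>x. w (x, z) * n (x, z) \<partial>M1) = (\<integral>x. l (x, z) * (q x * n (x, z)) - m z * (q x * n (x, z)) \<partial>M1)"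
      unfolding w_def by (intro Bochner_Integration.integral_cong) (auto simp: algebra_simps)
    also have "\<dots> = num z - m z * den z" unfolding num_def den_def using elim by simp
    finally show ?case using elim unfolding m_def by simp
  qed
  have wn_tot: "(\<integral>p. w p * n p \<partial>?N) = 0"
    using int_swap(2)[OF wn_int] wn2 integral_cong_AE[of _ M2 "\<lambda>_. 0"] by (simp add: integral_eq_zero_AE)
  have wn1: "AE x in M1. (\<integral>z. w (x, z) * n (x, z) \<partial>M2) = q x * v x"
    using P.AE_integrable_fst'[OF lmn_int]
  proof eventually_elim
    case (elim x)
    have "(\<integral>z. w (x, z) * n (x, z) \<partial>M2) = (\<integral>z. q x * ((l (x, z) - m z) * n (x, z)) \<partial>M2)"
      unfolding w_def by (intro Bochner_Integration.integral_cong) (auto simp: algebra_simps)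
    then show ?case unfolding v_def using elim by simp
  qed
  have u1: "AE x in M1. (\<integral>z. u (x, z) * n (x, z) \<partial>M2) = 0"
    using wn1 P.AE_integrable_fst'[OF wn_int]
  proof eventually_elim
    case (elim x)
    note s = integral_indicator_singleton[OF star(1) e\<nu>(2), of "\<lambda>z. v x / \<nu> * n (x, z)"]
    have "(\<integral>z. u (x, z) * n (x, z) \<partial>M2) =
      (\<integral>z. w (x, z) * n (x, z) - indicator {star} z * (v x / \<nu> * n (x, z)) \<partial>M2)"
      unfolding u_def by (intro Bochner_Integration.integral_cong) (auto simp: algebra_simps)
    also have "\<dots> = q x * v x - v x / \<nu> * n (x, star) * \<nu>"
      using elim s by (simp add: \<nu>_def)
    finally show ?case using \<nu> by (simp add: q_def)
  qed
  have u2: "AE z in M2. (\<integral>x. u (x, z) * n (x, z) \<partial>M1) = 0"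
    using wn2
  proof eventually_elim
    case (elim z)
    show ?case
    proof (cases "z = star")
      case False
      then show ?thesis using elim by (simp add: u_def)
    next
      \<comment> \<open>At the atom only the correction is left. Its integral is
        \<open>- 1/\<nu>\<close> times the total integral of \<open>w * n\<close>, which vanishes
        because almost every column does.\<close>
      case True
      have "(\<integral>x. u (x, z) * n (x, z) \<partial>M1) = (\<integral>x. (- 1/\<nu>) * (q x * v x) \<partial>M1)"
        unfolding u_def True by (intro Bochner_Integration.integral_cong) (auto simp: w_star q_def)
      also have "\<dots> = (- 1/\<nu>) * (\<integral>x. q x * v x \<partial>M1)" by (rule integral_mult_right_zero)
      also have "(\<integral>x. q x * v x \<partial>M1) = (\<integral>x. (\<integral>z. w (x, z) * n (x, z) \<partial>M2) \<partial>M1)"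
        using wn1 by (intro integral_cong_AE) auto
      also have "\<dots> = 0" using P.integral_fst'[OF wn_int] wn_tot by simp
      finally show ?thesis by simp
    qed
  qed

  \<comment> \<open>The first-order condition asks for a bound at every point, while
    \<open>u\<close> obeys it almost everywhere.\<close>
  define u' where "u' p = max (- C) (min C (u p))" for p
  have u'_eq: "AE p in ?N. u' p = u p"
    using u_bd by eventually_elim (auto simp: u'_def)
  have u'_meas[measurable]: "u' \<in> borel_measurable ?N" unfolding u'_def by measurable
  have "(\<integral>p. u' p * (n p * H p) \<partial>?N) = 0"
  proof (rule foc)
    show "\<bar>u' p\<bar> \<le> C" for p using C0 by (auto simp: u'_def)
    show "AE x in M1. (\<integral>z. u' (x, z) * n (x, z) \<partial>M2) = 0"
      using u1 P.AE_pair[OF u'_eq] AE_space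
    proof eventually_elim
      case (elim x)
      note [measurable] = elim(3)
      have "(\<integral>z. u' (x, z) * n (x, z) \<partial>M2) = (\<integral>z. u (x, z) * n (x, z) \<partial>M2)"
        using elim by (intro integral_cong_AE) auto
      then show ?case using elim by simp
    qed
    show "AE z in M2. (\<integral>x. u' (x, z) * n (x, z) \<partial>M1) = 0"
      using u2 AE_swap[OF u'_eq] AE_space
    proof eventually_elim
      case (elim z)
      note [measurable] = elim(3)
      have "(\<integral>x. u' (x, z) * n (x, z) \<partial>M1) = (\<integral>x. u (x, z) * n (x, z) \<partial>M1)"
        using elim by (intro integral_cong_AE) auto
      then show ?case using elim by simp
    qed
  qed fact
  moreover have "(\<integral>p. u' p * (n p * H p) \<partial>?N) = (\<integral>p. u p * (n p * H p) \<partial>?N)"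
    using u'_eq by (intro integral_cong_AE) auto
  ultimately have uH: "(\<integral>p. u p * (n p * H p) \<partial>?N) = 0" by simp

  \<comment> \<open>The vanishing covariance\<close>
  define Hs where "Hs x = H (x, star)" for x
  have [measurable]: "Hs \<in> borel_measurable M1" unfolding Hs_def by measurable
  have wH_int: "integrable ?N (\<lambda>p. w p * (n p * H p))"
    by (rule integrable_mult_AE_bounded[OF nH_int _ w_bd]) auto
  have sH_int: "integrable ?N (\<lambda>p. indicator {star} (snd p) * (n p * H p))"
    by (rule integrable_mult_AE_bounded[OF nH_int _, where C=1]) (auto simp: indicator_def)
  have qHs_int: "integrable M1 (\<lambda>x. q x * Hs x)"
  proof -
    have "integrable M1 (\<lambda>x. \<integral>z. indicator {star} z * (n (x, z) * H (x, z)) \<partial>M2)"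
      using P.integrable_fst'[OF sH_int] by simp
    moreover have "(\<integral>z. indicator {star} z * (n (x, z) * H (x, z)) \<partial>M2) = q x * Hs x * \<nu>" for x
      using integral_indicator_singleton(2)[OF star(1) e\<nu>(2), of "\<lambda>z. n (x, z) * H (x, z)"] by (simp add: q_def Hs_def \<nu>_def)
    ultimately have "integrable M1 (\<lambda>x. q x * Hs x * \<nu>)" by simp
    then show ?thesis using \<nu> by simp
  qed
  \<comment> \<open>The row integral of \<open>n\<close> is 1, so the iterated integral reduces to
    that of \<open>\<bar>q x * Hs x\<bar>\<close>, whose finiteness comes from the atom.\<close>
  have nqHs_int: "integrable ?N (\<lambda>p. q (fst p) * Hs (fst p) * n p)"
  proof (rule P.Fubini_integrable)
    have "AE x in M1. (\<integral>z. norm (q x * Hs x * n (x, z)) \<partial>M2) = \<bar>q x * Hs x\<bar>"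
      using marg1 n_int1
    proof eventually_elim
      case (elim x)
      have "(\<integral>z. norm (q x * Hs x * n (x, z)) \<partial>M2) = (\<integral>z. \<bar>q x * Hs x\<bar> * n (x, z) \<partial>M2)"
        using n_pos by (intro Bochner_Integration.integral_cong) (auto simp: abs_mult less_imp_le abs_of_pos)
      then show ?case using elim by simp
    qed
    then have "integrable M1 (\<lambda>x. \<integral>z. norm (q x * Hs x * n (x, z)) \<partial>M2) = integrable M1 (\<lambda>x. \<bar>q x * Hs x\<bar>)"
      by (intro integrable_cong_AE) auto
    then show "integrable M1 (\<lambda>x. \<integral>z. norm (q (fst (x,z)) * Hs (fst (x,z)) * n (x, z)) \<partial>M2)" using qHs_int by simp
    show "AE x in M1. integrable M2 (\<lambda>z. q (fst (x,z)) * Hs (fst (x,z)) * n (x, z))"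
      using n_int1 by eventually_elim simp
  qed auto
  have wHs_int: "integrable ?N (\<lambda>p. (l p - m (snd p)) * (q (fst p) * Hs (fst p) * n p))"
    by (rule integrable_mult_AE_bounded[OF nqHs_int _ lm_bd]) auto
  have wHs: "(\<integral>p. (l p - m (snd p)) * (q (fst p) * Hs (fst p) * n p) \<partial>?N) = (\<integral>x. v x * q x * Hs x \<partial>M1)"
  proof -
    have "(\<integral>p. (l p - m (snd p)) * (q (fst p) * Hs (fst p) * n p) \<partial>?N) =
      (\<integral>x. (\<integral>z. (l (x, z) - m z) * (q x * Hs x * n (x, z)) \<partial>M2) \<partial>M1)"
      using P.integral_fst'[OF wHs_int] by simp
    also have "\<dots> = (\<integral>x. v x * q x * Hs x \<partial>M1)"
    proof (rule Bochner_Integration.integral_cong[OF refl])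
      fix x assume "x \<in> space M1"
      have "(\<integral>z. (l (x, z) - m z) * (q x * Hs x * n (x, z)) \<partial>M2) = (\<integral>z. (q x * Hs x) * ((l (x, z) - m z) * n (x, z)) \<partial>M2)"
        by (intro Bochner_Integration.integral_cong) auto
      also have "\<dots> = (q x * Hs x) * v x" unfolding v_def by (rule integral_mult_right_zero)
      finally show "(\<integral>z. (l (x, z) - m z) * (q x * Hs x * n (x, z)) \<partial>M2) = v x * q x * Hs x" by simp
    qed
    finally show ?thesis .
  qed
  have svH_int: "integrable ?N (\<lambda>p. v (fst p) * (indicator {star} (snd p) * (n p * H p)))"
    by (rule integrable_mult_AE_bounded[OF sH_int _ v_bdN]) auto
  have svH: "(\<integral>p. v (fst p) * (indicator {star} (snd p) * (n p * H p)) \<partial>?N) = \<nu> * (\<integral>x. v x * q x * Hs x \<partial>M1)"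
  proof -
    have "(\<integral>p. v (fst p) * (indicator {star} (snd p) * (n p * H p)) \<partial>?N) =
      (\<integral>x. (\<integral>z. v x * (indicator {star} z * (n (x, z) * H (x, z))) \<partial>M2) \<partial>M1)"
      using P.integral_fst'[OF svH_int] by simp
    also have "\<dots> = (\<integral>x. \<nu> * (v x * q x * Hs x) \<partial>M1)"
      using integral_indicator_singleton(2)[OF star(1) e\<nu>(2)]
      by (intro Bochner_Integration.integral_cong refl) (simp add: q_def Hs_def \<nu>_def)
    finally show ?thesis by (simp)
  qed
  have "(\<integral>p. u p * (n p * H p) \<partial>?N) =
    (\<integral>p. w p * (n p * H p) - (1/\<nu>) * (v (fst p) * (indicator {star} (snd p) * (n p * H p))) \<partial>?N)"
    unfolding u_def by (intro Bochner_Integration.integral_cong) (auto simp: algebra_simps)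
  also have "\<dots> = (\<integral>p. w p * (n p * H p) \<partial>?N) - (\<integral>x. v x * q x * Hs x \<partial>M1)"
    using wH_int svH_int svH \<nu> by simp
  finally have wH: "(\<integral>p. w p * (n p * H p) \<partial>?N) = (\<integral>x. v x * q x * Hs x \<partial>M1)" using uH by simp

  \<comment> \<open>The correction at the atom and the subtraction of \<open>Hs\<close> from
    \<open>H\<close> yield the same integral of \<open>v * q * Hs\<close>, so the first-order
    condition for \<open>H\<close> becomes one for \<open>L\<close>.\<close>
  have eqL: "w p * n p * L p = w p * (n p * H p) - (l p - m (snd p)) * (q (fst p) * Hs (fst p) * n p)" for p
    unfolding L_def w_def Hs_def by (simp add: algebra_simps)
  have wL_int: "integrable ?N (\<lambda>p. w p * n p * L p)"
    unfolding eqL by (intro Bochner_Integration.integrable_diff wH_int wHs_int)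
  have wL0: "(\<integral>p. w p * n p * L p \<partial>?N) = 0"
    unfolding eqL using wH_int wHs_int wH wHs by simp

  \<comment> \<open>Column integrals of \<open>w * n\<close> vanish, so \<open>tan (m z)\<close> can
    be subtracted from \<open>L\<close> for free; the integrand becomes \<open>q * n\<close> times
    the nonnegative product of \<open>arctan_tan_sgn\<close>.\<close>
  have key: "AE z in M2. 0 \<le> (\<integral>x. w (x, z) * n (x, z) * L (x, z) \<partial>M1) \<and>
     ((\<integral>x. w (x, z) * n (x, z) * L (x, z) \<partial>M1) = 0 \<longrightarrow> (AE x in M1. L (x, z) = tan (m z)))"
    using int_swap(1)[OF wL_int] int_swap(1)[OF wn_int] wn2 m_bd
  proof eventually_elim
    case (elim z)
    let ?f = "\<lambda>x. w (x, z) * n (x, z) * (L (x, z) - tan (m z))"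
    have f_eq: "?f = (\<lambda>x. w (x, z) * n (x, z) * L (x, z) - w (x, z) * n (x, z) * tan (m z))"
      by (auto simp: algebra_simps)
    have f_int: "integrable M1 ?f" unfolding f_eq using elim by auto
    have f_I: "(\<integral>x. ?f x \<partial>M1) = (\<integral>x. w (x, z) * n (x, z) * L (x, z) \<partial>M1)"
      unfolding f_eq using elim by simp
    have f_form: "?f x = (q x * n (x, z)) * ((arctan (L (x,z)) - m z) * (L (x, z) - tan (m z)))" for x
      unfolding w_def l_def by simp
    have pos: "q x * n (x, z) > 0" for x using q_pos n_pos by simp
    have f_nn: "?f x \<ge> 0" for x
      unfolding f_form using arctan_tan_sgn(1)[of "m z" "L (x,z)"] elim less_imp_le[OF pos]
      by (intro mult_nonneg_nonneg[of "q x * n (x, z)"]) auto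
    have f_0: "L (x, z) = tan (m z)" if "?f x = 0" for x
      using that unfolding f_form using arctan_tan_sgn(2)[of "m z" "L (x,z)"] elim pos[of x]
      by (metis mult_eq_0_iff less_irrefl)
    have "(\<integral>x. ?f x \<partial>M1) \<ge> 0" using f_nn by (intro integral_nonneg_AE) auto
    moreover have "AE x in M1. L (x, z) = tan (m z)" if "(\<integral>x. ?f x \<partial>M1) = 0"
      using integral_nonneg_eq_0_iff_AE[OF f_int] f_nn that f_0 by auto
    ultimately show ?case unfolding f_I by blast
  qed
  have "AE z in M2. (\<integral>x. w (x, z) * n (x, z) * L (x, z) \<partial>M1) = 0"
    using integral_nonneg_eq_0_iff_AE[OF int_swap(3)[OF wL_int]] key int_swap(2)[OF wL_int] wL0 by auto
  then have "AE z in M2. AE x in M1. L (x, z) = tan (m z)" using key by eventually_elim auto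
  then have "AE x in M1. AE z in M2. L (x, z) = tan (m z)"
    by (subst P.AE_commute) auto
  then have "AE p in ?N. L p = tan (m (snd p))"
    by (intro P.AE_pair_measure) (auto intro!: pred_eq_const1 simp: pred_def[symmetric])
  then show ?thesis unfolding L_def by (intro bexI[of _ "\<lambda>z. tan (m z)"]) auto
qed

section \<open>Entropy minimisation under partial marginal constraints\<close>

text \<open>The tangent of the convex function \<open>x ln x\<close> at \<open>y\<close>, which
  amounts to \<open>ln s \<le> s - 1\<close> at \<open>s = y / x\<close>. It is linear in
  \<open>x\<close>, so it survives averaging, and it covers \<open>x = 0\<close>.\<close>

lemma entropy_tangent:
  fixes x y :: real
  assumes "0 \<le> x" "0 < y"
  shows "x * ln y + x - y \<le> x * ln x"
proof (cases "x = 0")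
  case True then show ?thesis using assms by simp
next
  case False
  then have x: "x > 0" using assms by simp
  have "ln (y / x) \<le> y / x - 1" using x assms by (intro ln_le_minus_one) auto
  then have "x * ln (y / x) \<le> x * (y / x - 1)" using x by (intro mult_left_mono) auto
  also have "\<dots> = y - x" using x by (simp add: right_diff_distrib)
  finally show ?thesis using x assms by (simp add: ln_div right_diff_distrib)
qed

lemma entropy_ge_minus_one: "x - 1 \<le> x * ln x" if "0 \<le> x" for x :: real
  using entropy_tangent[OF that, of 1] by simp

text \<open>Convexity of \<open>x ln x\<close>, sharpened where \<open>a = 0\<close>: there the
  mixture is \<open>t * b\<close>, and \<open>ln (t * b) = ln t + ln b\<close> releases a term with
  factor \<open>t * ln t\<close>, which beats every linear term in \<open>t\<close> near 0.\<close>

lemma entropy_convex_gap: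
  fixes a b t :: real
  assumes "0 \<le> a" "0 \<le> b" "0 < t" "t < 1"
  shows "((1 - t) * a + t * b) * ln ((1 - t) * a + t * b) \<le>
    (1 - t) * (a * ln a) + t * (b * ln b) + t * ln t * (if a = 0 then b else 0)"
proof -
  define y where "y = (1 - t) * a + t * b"
  have "y * ln y \<le> (1 - t) * (a * ln a) + t * (b * ln b) + t * ln t * (if a = 0 then b else 0)"
  proof (cases "a = 0")
    case True
    then have y: "y = t * b" unfolding y_def by simp
    show ?thesis
    proof (cases "b = 0")
      case False
      then have "ln (t * b) = ln t + ln b" using assms by (intro ln_mult_pos) auto
      then show ?thesis using True y by (simp add: algebra_simps)
    qed (use True y in simp)
  next
    case False
    then have "0 < (1 - t) * a" using assms by auto
    then have y: "y > 0" unfolding y_def using assms by (intro add_pos_nonneg) auto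
    have "(1 - t) * (a * ln y + a - y) + t * (b * ln y + b - y) \<le> (1 - t) * (a * ln a) + t * (b * ln b)"
      using entropy_tangent[OF assms(1) y] entropy_tangent[OF assms(2) y] assms
      by (intro add_mono mult_left_mono) auto
    also have "(1 - t) * (a * ln y + a - y) + t * (b * ln y + b - y) = y * ln y"
      unfolding y_def by (simp add: algebra_simps)
    finally show ?thesis using False by simp
  qed
  then show ?thesis unfolding y_def .
qed

text \<open>Clamping raises \<open>x\<close> only where the logarithm of the result is nonpositive
  and lowers it only where that logarithm is nonnegative, so \<open>a * ln a \<le> x * ln a\<close>
  in all cases. Nonnegativity makes Fatou's lemma applicable to truncated entropies.\<close>

lemma entropy_clamp_nonneg:
  fixes x \<epsilon> K :: real
  assumes "0 \<le> x" "0 < \<epsilon>" "\<epsilon> \<le> 1" "1 \<le> K"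
  defines "a \<equiv> max \<epsilon> (min K x)"
  shows "0 \<le> x * ln a - a + 1"
proof -
  have a: "a > 0" using assms(2) unfolding a_def by linarith
  have "a * ln a \<le> x * ln a"
  proof -
    consider "x < \<epsilon>" "a = \<epsilon>" | "a = x" | "K < x" "a = K"
      unfolding a_def using assms(3,4) by (metis max.absorb1 max.absorb2 min.absorb1 min.absorb2 linear not_le order_trans less_imp_le)
    then show ?thesis
    proof cases
      case 1
      then have "ln a \<le> 0" using assms(3) a by (simp add: ln_le_zero_iff)
      then show ?thesis using 1 by (intro mult_right_mono_neg) simp_all
    next
      case 3
      then have "0 \<le> ln a" using assms(4) by (simp add: ln_ge_zero)
      then show ?thesis using 3 by (intro mult_right_mono) simp_all
    qed simp
  qed
  then show ?thesis using entropy_ge_minus_one[of a] a by linarith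
qed

section \<open>Densities with a partially prescribed terminal law\<close>

locale partial_bridge = prob_space R for R :: "'w measure" +
  fixes S :: "'s measure" and S' :: "'t measure"
    and X :: "'w \<Rightarrow> 's" and Y :: "'w \<Rightarrow> 't" and D :: "'t set" and h :: "'w \<Rightarrow> real"
  assumes X[measurable]: "X \<in> R \<rightarrow>\<^sub>M S" and Y[measurable]: "Y \<in> R \<rightarrow>\<^sub>M S'"
    and D[measurable]: "D \<in> sets S'"
    and h_meas[measurable]: "h \<in> borel_measurable R" and h_nn: "\<And>w. 0 \<le> h w"
    and h_int: "integrable R h" and h_prob: "(\<integral>w. h w \<partial>R) = 1"
    and h_ent: "integrable R (\<lambda>w. h w * ln (h w))"
begin

text \<open>The targets enter through \<open>h\<close> itself and as integrals, which makes them
  linear in the density; total mass 1 is contained in the case \<open>A = space S\<close>.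
  Integrability of the entropy is demanded because the Bochner integral of a nonintegrable function
  is 0 by convention and could not be compared.\<close>

definition competitor :: "('w \<Rightarrow> real) \<Rightarrow> bool" where
  "competitor k \<longleftrightarrow> k \<in> borel_measurable R \<and> (\<forall>w. 0 \<le> k w) \<and> integrable R k \<and>
     integrable R (\<lambda>w. k w * ln (k w)) \<and>
     (\<forall>A\<in>sets S. (\<integral>w. indicator A (X w) * k w \<partial>R) = (\<integral>w. indicator A (X w) * h w \<partial>R)) \<and>
     (\<forall>B\<in>sets S'. B \<subseteq> D \<longrightarrow> (\<integral>w. indicator B (Y w) * k w \<partial>R) = (\<integral>w. indicator B (Y w) * h w \<partial>R))"

lemma competitorD:
  assumes "competitor k"
  shows "k \<in> borel_measurable R" "0 \<le> k w" "integrable R k" "integrable R (\<lambda>w. k w * ln (k w))"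
    "A \<in> sets S \<Longrightarrow> (\<integral>w. indicator A (X w) * k w \<partial>R) = (\<integral>w. indicator A (X w) * h w \<partial>R)"
    "B \<in> sets S' \<Longrightarrow> B \<subseteq> D \<Longrightarrow> (\<integral>w. indicator B (Y w) * k w \<partial>R) = (\<integral>w. indicator B (Y w) * h w \<partial>R)"
  using assms by (auto simp: competitor_def)

lemma integrable_bounded_mult:
  fixes f g :: "'w \<Rightarrow> real"
  assumes "integrable R f" "g \<in> borel_measurable R" "\<And>w. \<bar>g w\<bar> \<le> C"
  shows "integrable R (\<lambda>w. g w * f w)"
  by (rule integrable_mult_AE_bounded[OF assms(1,2), where C=C]) (intro AE_I2 assms(3))

lemma integrable_indicator_mult:
  fixes f :: "'w \<Rightarrow> real"
  assumes "integrable R f" "T \<in> R \<rightarrow>\<^sub>M M" "A \<in> sets M"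
  shows "integrable R (\<lambda>w. indicator A (T w) * f w)"
  using assms by (intro integrable_bounded_mult[where C=1]) (auto simp: indicator_def)

lemma emeasure_distr_density:
  assumes [measurable]: "k \<in> borel_measurable R" "T \<in> R \<rightarrow>\<^sub>M M" "A \<in> sets M"
    and "\<And>w. 0 \<le> k w" "integrable R k"
  shows "emeasure (distr (density R (\<lambda>w. ennreal (k w))) M T) A = ennreal (\<integral>w. indicator A (T w) * k w \<partial>R)"
proof -
  have "emeasure (distr (density R (\<lambda>w. ennreal (k w))) M T) A
      = emeasure (density R (\<lambda>w. ennreal (k w))) (T -` A \<inter> space R)"
    by (subst emeasure_distr) auto
  also have "\<dots> = (\<integral>\<^sup>+w. ennreal (k w) * indicator (T -` A \<inter> space R) w \<partial>R)"
    by (rule emeasure_density) auto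
  also have "\<dots> = (\<integral>\<^sup>+w. ennreal (indicator A (T w) * k w) \<partial>R)"
    by (intro nn_integral_cong) (auto simp: indicator_def)
  also have "\<dots> = ennreal (\<integral>w. indicator A (T w) * k w \<partial>R)"
    using assms by (intro nn_integral_eq_integral integrable_indicator_mult[where M=M]) auto
  finally show ?thesis .
qed

lemma integral_indicator_lincomb:
  fixes f g :: "'w \<Rightarrow> real"
  assumes "integrable R f" "integrable R g" "T \<in> R \<rightarrow>\<^sub>M M" "A \<in> sets M"
  shows "(\<integral>w. indicator A (T w) * (a * f w + b * g w) \<partial>R) =
    a * (\<integral>w. indicator A (T w) * f w \<partial>R) + b * (\<integral>w. indicator A (T w) * g w \<partial>R)"
proof -
  have "(\<integral>w. indicator A (T w) * (a * f w + b * g w) \<partial>R) =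
    (\<integral>w. a * (indicator A (T w) * f w) + b * (indicator A (T w) * g w) \<partial>R)"
    by (intro Bochner_Integration.integral_cong) (auto simp: algebra_simps)
  then show ?thesis
    using integrable_indicator_mult[OF assms(1,3,4)] integrable_indicator_mult[OF assms(2,3,4)] by simp
qed

lemma competitor_total:
  assumes "competitor k" shows "(\<integral>w. k w \<partial>R) = 1"
proof -
  have "(\<integral>w. indicator (space S) (X w) * f w \<partial>R) = (\<integral>w. f w \<partial>R)" for f :: "'w \<Rightarrow> real"
    using measurable_space[OF X] by (intro Bochner_Integration.integral_cong) auto
  then show ?thesis using competitorD(5)[OF assms sets.top] h_prob by simp
qed

end

locale minimal_partial_bridge = partial_bridge R S S' X Y D h
  for R :: "'w measure" and S :: "'s measure" and S' :: "'t measure"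
    and X :: "'w \<Rightarrow> 's" and Y :: "'w \<Rightarrow> 't" and D :: "'t set" and h :: "'w \<Rightarrow> real" +
  assumes minimal: "\<And>k. competitor k \<Longrightarrow> (\<integral>w. h w * ln (h w) \<partial>R) \<le> (\<integral>w. k w * ln (k w) \<partial>R)"
    and unique: "\<And>k. competitor k \<Longrightarrow> (\<integral>w. k w * ln (k w) \<partial>R) \<le> (\<integral>w. h w * ln (h w) \<partial>R) \<Longrightarrow>
      AE w in R. k w = h w"
begin

text \<open>The entropy has slope \<open>-\<infinity>\<close> in a direction that charges the set where \<open>h\<close> vanishes.\<close>

lemma competitor_abs_cont:
  assumes k: "competitor k"
  shows "AE w in R. h w = 0 \<longrightarrow> k w = 0"
proof -
  note [measurable] = competitorD(1)[OF k]
  note k_int = competitorD(3)[OF k] and k_ent = competitorD(4)[OF k] and k_nn = competitorD(2)[OF k]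
  define j where "j w = (if h w = 0 then k w else 0)" for w
  have j_meas[measurable]: "j \<in> borel_measurable R" unfolding j_def by measurable
  have j_int: "integrable R j"
    by (rule Bochner_Integration.integrable_bound[OF k_int j_meas]) (auto simp: j_def)
  define c where "c = (\<integral>w. j w \<partial>R)"
  have c_nn: "c \<ge> 0" unfolding c_def using k_nn by (intro integral_nonneg_AE) (auto simp: j_def)
  define Ih where "Ih = (\<integral>w. h w * ln (h w) \<partial>R)"
  define Ik where "Ik = (\<integral>w. k w * ln (k w) \<partial>R)"
  \<comment> \<open>Mixing a fraction \<open>t\<close> of \<open>k\<close> into \<open>h\<close>
    gives a competitor. Minimality and the gap term yield
    \<open>t * (Ih - Ik) \<le> t * ln t * c\<close>; after division by \<open>t\<close> the bound
    tends to minus infinity as \<open>t\<close> tends to 0, unless \<open>c = 0\<close>.\<close>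
  have main: "Ih - Ik \<le> ln t * c" if t: "0 < t" "t < 1" for t
  proof -
    define p where "p w = (1 - t) * h w + t * k w" for w
    have [measurable]: "p \<in> borel_measurable R" unfolding p_def by measurable
    have p_nn: "p w \<ge> 0" for w unfolding p_def using t h_nn k_nn by simp
    have up: "p w * ln (p w) \<le> (1 - t) * (h w * ln (h w)) + t * (k w * ln (k w)) + t * ln t * j w" for w
      using entropy_convex_gap[OF h_nn k_nn t, of w w] unfolding p_def j_def .
    let ?u = "\<lambda>w. (1 - t) * (h w * ln (h w)) + t * (k w * ln (k w)) + t * ln t * j w"
    have u_int: "integrable R ?u" using h_ent k_ent j_int by auto
    have p_ent: "integrable R (\<lambda>w. p w * ln (p w))"
    proof (rule Bochner_Integration.integrable_bound[of _ "\<lambda>w. \<bar>?u w\<bar> + 1"])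
      show "integrable R (\<lambda>w. \<bar>?u w\<bar> + 1)" using integrable_abs[OF u_int] by simp
      show "AE w in R. norm (p w * ln (p w)) \<le> norm (\<bar>?u w\<bar> + 1)"
      proof (rule AE_I2)
        fix w
        have "- 1 \<le> p w * ln (p w)" using entropy_ge_minus_one[OF p_nn[of w]] p_nn[of w] by linarith
        with up[of w] show "norm (p w * ln (p w)) \<le> norm (\<bar>?u w\<bar> + 1)" unfolding real_norm_def by linarith
      qed
    qed simp
    have "competitor p"
      unfolding competitor_def
    proof (intro conjI allI ballI impI)
      show "integrable R p" unfolding p_def using h_int k_int by auto
      show "(\<integral>w. indicator A (X w) * p w \<partial>R) = (\<integral>w. indicator A (X w) * h w \<partial>R)" if "A \<in> sets S" for A
        unfolding p_def integral_indicator_lincomb[OF h_int k_int X that] competitorD(5)[OF k that] by (simp add: algebra_simps)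
      show "(\<integral>w. indicator A (Y w) * p w \<partial>R) = (\<integral>w. indicator A (Y w) * h w \<partial>R)" if "A \<in> sets S'" "A \<subseteq> D" for A
        unfolding p_def integral_indicator_lincomb[OF h_int k_int Y that(1)] competitorD(6)[OF k that] by (simp add: algebra_simps)
    qed (use p_nn p_ent in auto)
    then have "Ih \<le> (\<integral>w. p w * ln (p w) \<partial>R)" unfolding Ih_def by (rule minimal)
    also have "\<dots> \<le> (\<integral>w. ?u w \<partial>R)" using up by (intro integral_mono p_ent u_int) auto
    also have "\<dots> = (1 - t) * Ih + t * Ik + t * ln t * c"
      unfolding Ih_def Ik_def c_def using h_ent k_ent j_int by simp
    finally have "t * (Ih - Ik) \<le> t * (ln t * c)" by (simp add: algebra_simps)
    then show ?thesis using t by simp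
  qed
  have "c = 0"
  proof (rule ccontr)
    assume "c \<noteq> 0"
    then have c: "c > 0" using c_nn by simp
    \<comment> \<open>Chosen so that at \<open>t = exp (- e)\<close> the bound
      \<open>ln t * c\<close> equals \<open>- (\<bar>Ih - Ik\<bar> + 1)\<close>, which is less than
      \<open>Ih - Ik\<close>.\<close>
    define e where "e = (\<bar>Ih - Ik\<bar> + 1) / c"
    have "e > 0" unfolding e_def using c by (intro divide_pos_pos) auto
    then have "Ih - Ik \<le> ln (exp (- e)) * c" by (intro main) auto
    also have "\<dots> = - (\<bar>Ih - Ik\<bar> + 1)" using c by (simp add: e_def)
    finally show False by linarith
  qed
  then have "AE w in R. j w = 0"
    using integral_nonneg_eq_0_iff_AE[OF j_int] k_nn unfolding c_def by (auto simp: j_def)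
  then show ?thesis by eventually_elim (auto simp: j_def split: if_splits)
qed

text \<open>The variation \<open>(1 + t * u) * h\<close> satisfies the constraints for both signs of
  \<open>t\<close>. Since \<open>ln (1 + s) \<le> s\<close>, its entropy exceeds that of
  \<open>h\<close> by at most \<open>t * a + t^2 * B\<close>, so minimality forces
  \<open>a = 0\<close>; no derivative is taken under the integral.\<close>

lemma first_order_condition:
  assumes u[measurable]: "u \<in> borel_measurable R" and u_bd: "\<And>w. \<bar>u w\<bar> \<le> C"
    and uX: "\<And>A. A \<in> sets S \<Longrightarrow> (\<integral>w. indicator A (X w) * (u w * h w) \<partial>R) = 0"
    and uY: "\<And>B. B \<in> sets S' \<Longrightarrow> B \<subseteq> D \<Longrightarrow> (\<integral>w. indicator B (Y w) * (u w * h w) \<partial>R) = 0"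
  shows "(\<integral>w. u w * (h w * ln (h w)) \<partial>R) = 0"
proof -
  have C: "C \<ge> 0" using order_trans[OF abs_ge_zero u_bd] .
  have uh_int: "integrable R (\<lambda>w. u w * h w)" by (rule integrable_bounded_mult[OF h_int u u_bd])
  have uuh_int: "integrable R (\<lambda>w. u w * (u w * h w))" by (rule integrable_bounded_mult[OF uh_int u u_bd])
  have uhl_int: "integrable R (\<lambda>w. u w * (h w * ln (h w)))" by (rule integrable_bounded_mult[OF h_ent u u_bd])
  have uh0: "(\<integral>w. u w * h w \<partial>R) = 0"
  proof -
    have "(\<integral>w. indicator (space S) (X w) * (u w * h w) \<partial>R) = (\<integral>w. u w * h w \<partial>R)"
      using measurable_space[OF X] by (intro Bochner_Integration.integral_cong) auto
    then show ?thesis using uX[OF sets.top] by simp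
  qed
  define a where "a = (\<integral>w. u w * (h w * ln (h w)) \<partial>R)"
  define B where "B = (\<integral>w. u w * (u w * h w) \<partial>R)"
  have B: "B \<ge> 0" unfolding B_def using h_nn
    by (intro integral_nonneg_AE AE_I2) (metis mult.assoc mult_nonneg_nonneg zero_le_square)
  \<comment> \<open>Keeps \<open>\<bar>t * u w\<bar>\<close> at most 1/2 and thus
    \<open>1 + t * u w\<close> positive; the summand 1 covers \<open>C = 0\<close>.\<close>
  define \<delta> where "\<delta> = 1 / (2 * C + 1)"
  have \<delta>: "\<delta> > 0" "\<delta> * C \<le> 1/2" unfolding \<delta>_def using C by (auto simp: field_simps)
  have main: "0 \<le> t * a + t\<^sup>2 * B" if t: "\<bar>t\<bar> \<le> \<delta>" for t
  proof -
    have tu: "\<bar>t * u w\<bar> \<le> 1/2" for w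
    proof -
      have "\<bar>t * u w\<bar> \<le> \<delta> * C" unfolding abs_mult using t u_bd[of w] \<delta> by (intro mult_mono) auto
      then show ?thesis using \<delta> by linarith
    qed
    have pos: "1 + t * u w > 0" for w using tu[of w] unfolding abs_le_iff by linarith
    define p where "p w = (1 + t * u w) * h w" for w
    have [measurable]: "p \<in> borel_measurable R" unfolding p_def by measurable
    have p_eq: "p w = h w + t * (u w * h w)" for w unfolding p_def by (simp add: algebra_simps)
    have p_nn: "p w \<ge> 0" for w unfolding p_def using pos[of w] h_nn[of w] by simp
    define r where "r w = (1 + t * u w) * ln (1 + t * u w)" for w
    have [measurable]: "r \<in> borel_measurable R" unfolding r_def by measurable
    have r_up: "r w \<le> t * u w + t\<^sup>2 * (u w * u w)" for w
    proof -
      have "ln (1 + t * u w) \<le> t * u w" using ln_le_minus_one[OF pos[of w]] by simp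
      then have "r w \<le> (1 + t * u w) * (t * u w)" unfolding r_def using pos[of w] by (intro mult_left_mono) auto
      then show ?thesis by (simp add: algebra_simps power2_eq_square)
    qed
    have r_bd: "\<bar>r w\<bar> \<le> 2" for w
    proof -
      have "t * u w + t\<^sup>2 * (u w * u w) = t * u w + (t * u w) * (t * u w)" by (simp add: power2_eq_square algebra_simps)
      also have "\<dots> \<le> \<bar>t * u w\<bar> + \<bar>t * u w\<bar> * \<bar>t * u w\<bar>" by (auto simp: abs_mult_self_eq)
      also have "\<dots> \<le> 1/2 + (1/2) * (1/2)" using tu[of w] by (intro add_mono mult_mono) auto
      finally have "r w \<le> 2" using r_up[of w] by linarith
      moreover have "r w \<ge> - 1"
        using entropy_ge_minus_one[OF less_imp_le[OF pos[of w]]] pos[of w] unfolding r_def by linarith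
      ultimately show ?thesis by (simp add: abs_le_iff)
    qed
    have p_ent_eq: "p w * ln (p w) = h w * ln (h w) + t * (u w * (h w * ln (h w))) + r w * h w" for w
    proof (cases "h w = 0")
      case False
      then have "h w > 0" using h_nn[of w] by simp
      then have "ln (p w) = ln (1 + t * u w) + ln (h w)" unfolding p_def using pos[of w] by (simp add: ln_mult)
      then show ?thesis unfolding p_def r_def by (simp add: algebra_simps)
    qed (simp add: p_def)
    have rh_int: "integrable R (\<lambda>w. r w * h w)" by (rule integrable_bounded_mult[OF h_int _ r_bd]) simp
    have p_ent: "integrable R (\<lambda>w. p w * ln (p w))"
      unfolding p_ent_eq using h_ent uhl_int rh_int by auto
    have "competitor p"
      unfolding competitor_def
    proof (intro conjI allI ballI impI)
      show "integrable R p" unfolding p_eq using h_int uh_int by auto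
      show "(\<integral>w. indicator A (X w) * p w \<partial>R) = (\<integral>w. indicator A (X w) * h w \<partial>R)" if "A \<in> sets S" for A
        using integral_indicator_lincomb[OF h_int uh_int X that, of 1 t] uX[OF that] by (simp add: p_eq)
      show "(\<integral>w. indicator A (Y w) * p w \<partial>R) = (\<integral>w. indicator A (Y w) * h w \<partial>R)" if "A \<in> sets S'" "A \<subseteq> D" for A
        using integral_indicator_lincomb[OF h_int uh_int Y that(1), of 1 t] uY[OF that] by (simp add: p_eq)
    qed (use p_nn p_ent in auto)
    then have "(\<integral>w. h w * ln (h w) \<partial>R) \<le> (\<integral>w. p w * ln (p w) \<partial>R)" by (rule minimal)
    also have "\<dots> = (\<integral>w. h w * ln (h w) \<partial>R) + t * a + (\<integral>w. r w * h w \<partial>R)"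
      unfolding p_ent_eq a_def using h_ent uhl_int rh_int by simp
    also have "(\<integral>w. r w * h w \<partial>R) \<le> (\<integral>w. t * (u w * h w) + t\<^sup>2 * (u w * (u w * h w)) \<partial>R)"
    proof (intro integral_mono rh_int)
      show "integrable R (\<lambda>w. t * (u w * h w) + t\<^sup>2 * (u w * (u w * h w)))" using uh_int uuh_int by auto
      show "r w * h w \<le> t * (u w * h w) + t\<^sup>2 * (u w * (u w * h w))" for w
        using mult_right_mono[OF r_up[of w] h_nn[of w]] by (simp add: algebra_simps)
    qed
    also have "\<dots> = t\<^sup>2 * B" using uh_int uuh_int uh0 by (simp add: B_def)
    finally show ?thesis by simp
  qed
  have "a = 0"
  proof (rule ccontr)
    assume a: "a \<noteq> 0"
    \<comment> \<open>At \<open>t = - s * a\<close> the inequality reads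
      \<open>0 \<le> s * a^2 * (s * B - 1)\<close>. The first bound keeps \<open>t\<close> in the
      allowed range, the second makes \<open>s * B < 1\<close>.\<close>
    define s where "s = min (\<delta> / \<bar>a\<bar>) (1 / (2 * (B + 1)))"
    have s: "s > 0" "s \<le> \<delta> / \<bar>a\<bar>" "s \<le> 1 / (2 * (B + 1))"
      unfolding s_def using a B \<delta> by auto
    have "\<bar>- s * a\<bar> \<le> \<delta>" using s a by (simp add: abs_mult field_simps)
    from main[OF this] have "0 \<le> (s * a\<^sup>2) * (s * B - 1)" by (simp add: power2_eq_square algebra_simps)
    moreover have "s * a\<^sup>2 > 0" using s a by simp
    ultimately have "s * B \<ge> 1" by (simp add: zero_le_mult_iff)
    moreover have "s * B \<le> 1 / (2 * (B + 1)) * B" using s B by (intro mult_right_mono) auto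
    moreover have "1 / (2 * (B + 1)) * B < 1" using B by (simp add: field_simps)
    ultimately show False by linarith
  qed
  then show ?thesis unfolding a_def .
qed

end

section \<open>Collapsing the surviving endpoints\<close>

lemma distr_pair_marginals:
  assumes "prob_space M" "prob_space N"
  shows "distr (M \<Otimes>\<^sub>M N) M fst = M" "distr (M \<Otimes>\<^sub>M N) N snd = N"
proof -
  interpret M: prob_space M by fact
  interpret N: prob_space N by fact
  show "distr (M \<Otimes>\<^sub>M N) M fst = M" by (rule N.distr_pair_fst)
  show "distr (M \<Otimes>\<^sub>M N) N snd = N"
  proof (rule measure_eqI)
    fix A assume "A \<in> sets (distr (M \<Otimes>\<^sub>M N) N snd)"
    then have A[measurable]: "A \<in> sets N" by simp
    have "snd -` A \<inter> space (M \<Otimes>\<^sub>M N) = space M \<times> A"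
      using sets.sets_into_space[OF A] by (auto simp: space_pair_measure)
    then show "emeasure (distr (M \<Otimes>\<^sub>M N) N snd) A = emeasure N A"
      by (subst emeasure_distr) (auto simp: N.emeasure_pair_measure_Times M.emeasure_space_1)
  qed simp
qed

text \<open>By Fubini the fibre integral of \<open>n\<close> is the density of the marginal with
  respect to the factor. The marginal is the factor itself, and densities are unique almost
  everywhere.\<close>

lemma density_product_marginals:
  assumes "prob_space M1" "prob_space M2"
    and n[measurable]: "n \<in> borel_measurable (M1 \<Otimes>\<^sub>M M2)"
    and "distr (density (M1 \<Otimes>\<^sub>M M2) n) M1 fst = M1" "distr (density (M1 \<Otimes>\<^sub>M M2) n) M2 snd = M2"
  shows "AE x in M1. (\<integral>\<^sup>+z. n (x, z) \<partial>M2) = 1" "AE z in M2. (\<integral>\<^sup>+x. n (x, z) \<partial>M1) = 1"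
proof -
  interpret M1: prob_space M1 by fact
  interpret M2: prob_space M2 by fact
  interpret P: pair_prob_space M1 M2 ..
  let ?N = "M1 \<Otimes>\<^sub>M M2"
  have "density M1 (\<lambda>x. \<integral>\<^sup>+z. n (x, z) \<partial>M2) = density M1 (\<lambda>_. 1)"
  proof (rule measure_eqI)
    fix A assume "A \<in> sets (density M1 (\<lambda>x. \<integral>\<^sup>+z. n (x, z) \<partial>M2))"
    then have A[measurable]: "A \<in> sets M1" by simp
    have "emeasure (density M1 (\<lambda>_. 1)) A = emeasure (distr (density ?N n) M1 fst) A" by (simp add: assms density_1)
    also have "\<dots> = emeasure (density ?N n) (fst -` A \<inter> space ?N)" by (subst emeasure_distr) auto
    also have "\<dots> = (\<integral>\<^sup>+p. n p * indicator (fst -` A \<inter> space ?N) p \<partial>?N)" by (rule emeasure_density) auto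
    also have "\<dots> = (\<integral>\<^sup>+p. n p * indicator A (fst p) \<partial>?N)"
      by (intro nn_integral_cong) (auto simp: indicator_def)
    also have "\<dots> = (\<integral>\<^sup>+x. (\<integral>\<^sup>+z. n (x, z) * indicator A x \<partial>M2) \<partial>M1)"
      by (subst M2.nn_integral_fst[symmetric]) auto
    also have "\<dots> = (\<integral>\<^sup>+x. (\<integral>\<^sup>+z. n (x, z) \<partial>M2) * indicator A x \<partial>M1)"
      by (intro nn_integral_cong nn_integral_multc) auto
    also have "\<dots> = emeasure (density M1 (\<lambda>x. \<integral>\<^sup>+z. n (x, z) \<partial>M2)) A"
      by (subst emeasure_density) auto
    finally show "emeasure (density M1 (\<lambda>x. \<integral>\<^sup>+z. n (x, z) \<partial>M2)) A = emeasure (density M1 (\<lambda>_. 1)) A" ..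
  qed simp
  then show "AE x in M1. (\<integral>\<^sup>+z. n (x, z) \<partial>M2) = 1"
    by (subst (asm) M1.density_unique_iff) auto
  have "density M2 (\<lambda>z. \<integral>\<^sup>+x. n (x, z) \<partial>M1) = density M2 (\<lambda>_. 1)"
  proof (rule measure_eqI)
    fix A assume "A \<in> sets (density M2 (\<lambda>z. \<integral>\<^sup>+x. n (x, z) \<partial>M1))"
    then have A[measurable]: "A \<in> sets M2" by simp
    have "emeasure (density M2 (\<lambda>_. 1)) A = emeasure (distr (density ?N n) M2 snd) A" by (simp add: assms density_1)
    also have "\<dots> = emeasure (density ?N n) (snd -` A \<inter> space ?N)" by (subst emeasure_distr) auto
    also have "\<dots> = (\<integral>\<^sup>+p. n p * indicator (snd -` A \<inter> space ?N) p \<partial>?N)" by (rule emeasure_density) auto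
    also have "\<dots> = (\<integral>\<^sup>+p. n p * indicator A (snd p) \<partial>?N)"
      by (intro nn_integral_cong) (auto simp: indicator_def)
    also have "\<dots> = (\<integral>\<^sup>+z. (\<integral>\<^sup>+x. n (x, z) * indicator A z \<partial>M1) \<partial>M2)"
      by (subst P.nn_integral_snd[symmetric]) auto
    also have "\<dots> = (\<integral>\<^sup>+z. (\<integral>\<^sup>+x. n (x, z) \<partial>M1) * indicator A z \<partial>M2)"
      by (intro nn_integral_cong nn_integral_multc) auto
    also have "\<dots> = emeasure (density M2 (\<lambda>z. \<integral>\<^sup>+x. n (x, z) \<partial>M1)) A"
      by (subst emeasure_density) auto
    finally show "emeasure (density M2 (\<lambda>z. \<integral>\<^sup>+x. n (x, z) \<partial>M1)) A = emeasure (density M2 (\<lambda>_. 1)) A" ..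
  qed simp
  then show "AE z in M2. (\<integral>\<^sup>+x. n (x, z) \<partial>M1) = 1"
    by (subst (asm) M2.density_unique_iff) auto
qed

lemma prob_density_real:
  assumes P: "prob_space P" and M: "sigma_finite_measure M" and ac: "absolutely_continuous M P" "sets P = sets M"
  obtains f :: "'a \<Rightarrow> real" where "f \<in> borel_measurable M" "\<And>x. 0 \<le> f x" "P = density M (\<lambda>x. ennreal (f x))"
    "integrable M f" "(\<integral>x. f x \<partial>M) = 1"
proof -
  interpret P: prob_space P by fact
  interpret M: sigma_finite_measure M by fact
  obtain f where f: "f \<in> borel_measurable M" "AE x in M. RN_deriv M P x = ennreal (f x)" "\<And>x. 0 \<le> f x"
    using M.real_RN_deriv[OF P.finite_measure_axioms ac] by metis
  have P_eq: "P = density M (\<lambda>x. ennreal (f x))"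
    using M.density_RN_deriv[OF ac] density_cong[of "RN_deriv M P" M "\<lambda>x. ennreal (f x)"] f by auto
  have "(\<integral>\<^sup>+x. ennreal (f x) \<partial>M) = emeasure P (space M)"
    unfolding P_eq using f(1) by (subst emeasure_density) (auto intro!: nn_integral_cong)
  also have "\<dots> = 1" using P.emeasure_space_1 sets_eq_imp_space_eq[OF ac(2)] by simp
  finally have n: "(\<integral>\<^sup>+x. ennreal (f x) \<partial>M) = 1" .
  have "integrable M f" using f n by (intro integrableI_nonneg) auto
  moreover have "(\<integral>x. f x \<partial>M) = 1" using f n by (subst integral_eq_nn_integral) auto
  ultimately show ?thesis using that f P_eq by blast
qed

lemma absolutely_continuous_distr:
  assumes ac: "absolutely_continuous M N" and sets: "sets N = sets M" and T: "T \<in> M \<rightarrow>\<^sub>M L"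
  shows "absolutely_continuous (distr M L T) (distr N L T)"
  unfolding absolutely_continuous_def
proof
  fix A assume A: "A \<in> null_sets (distr M L T)"
  have T': "T \<in> N \<rightarrow>\<^sub>M L" using T measurable_cong_sets[OF sets refl] by blast
  have "T -` A \<inter> space M \<in> null_sets M" "A \<in> sets L" using A T by (auto simp: null_sets_distr_iff)
  then show "A \<in> null_sets (distr N L T)"
    using ac T' sets_eq_imp_space_eq[OF sets] by (auto simp: null_sets_distr_iff absolutely_continuous_def)
qed

locale collapsed_bridge = minimal_partial_bridge R S S' X Y D h
  for R :: "'w measure" and S :: "'s measure" and S' :: "'t measure"
    and X :: "'w \<Rightarrow> 's" and Y :: "'w \<Rightarrow> 't" and D :: "'t set" and h :: "'w \<Rightarrow> real" +
  fixes star :: 't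
  assumes star[measurable]: "{star} \<in> sets S'" and star_D: "star \<notin> D"
begin

lemma star_space[measurable]: "star \<in> space S'"
  using sets.sets_into_space[OF star] by simp

text \<open>Events inside \<open>D\<close> are unaffected, so the collapse keeps exactly what the
  terminal constraint sees.\<close>

definition collapse :: "'t \<Rightarrow> 't" where "collapse y = (if y \<in> D then y else star)"

lemma collapse_meas[measurable]: "collapse \<in> S' \<rightarrow>\<^sub>M S'"
  unfolding collapse_def by measurable

definition Z :: "'w \<Rightarrow> 's \<times> 't" where "Z w = (X w, collapse (Y w))"

lemma Z_meas[measurable]: "Z \<in> R \<rightarrow>\<^sub>M S \<Otimes>\<^sub>M S'"
  unfolding Z_def by measurable

abbreviation bridge :: "'w measure" where "bridge \<equiv> density R (\<lambda>w. ennreal (h w))"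

lemma prob_space_density:
  assumes "k \<in> borel_measurable R" "\<And>w. 0 \<le> k w" "integrable R k" "(\<integral>w. k w \<partial>R) = 1"
  shows "prob_space (density R (\<lambda>w. ennreal (k w)))"
proof
  show "emeasure (density R (\<lambda>w. ennreal (k w))) (space (density R (\<lambda>w. ennreal (k w)))) = 1"
    using assms by (simp add: emeasure_density nn_integral_eq_integral cong: nn_integral_cong)
qed

lemma prob_space_bridge: "prob_space bridge"
  using h_nn h_int h_prob by (intro prob_space_density) auto

text \<open>Averaging over the terminal active states keeps the constraints and does not increase the
  entropy, so by uniqueness the density depends on \<open>Z\<close> only. Jensen's inequality is obtained from
  tangents at truncations of \<open>\<phi>\<close>, because \<open>x ln x\<close> has no tangent at \<open>0\<close> and \<open>h ln \<phi>\<close> is not known to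
  be integrable beforehand.\<close>

lemma collapsed_density:
  obtains \<phi> :: "'s \<times> 't \<Rightarrow> real" where "\<phi> \<in> borel_measurable (S \<Otimes>\<^sub>M S')" "\<And>p. 0 \<le> \<phi> p"
    "distr bridge (S \<Otimes>\<^sub>M S') Z = density (distr R (S \<Otimes>\<^sub>M S') Z) (\<lambda>p. ennreal (\<phi> p))"
    "AE w in R. \<phi> (Z w) = h w"
proof -
  let ?m = "distr R (S \<Otimes>\<^sub>M S') Z" and ?P = "distr bridge (S \<Otimes>\<^sub>M S') Z"
  interpret m: prob_space ?m by (rule prob_space_distr) simp
  interpret P: prob_space ?P using prob_space_bridge by (rule prob_space.prob_space_distr) simp
  have ac: "absolutely_continuous ?m ?P"
    by (intro absolutely_continuous_distr absolutely_continuousI_density) auto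
  obtain \<phi> where \<phi>: "\<phi> \<in> borel_measurable ?m" "\<And>p. 0 \<le> \<phi> p" "?P = density ?m (\<lambda>p. ennreal (\<phi> p))"
    "integrable ?m \<phi>" "(\<integral>p. \<phi> p \<partial>?m) = 1"
    using prob_density_real[OF P.prob_space_axioms m.sigma_finite_measure_axioms ac] by auto
  then have [measurable]: "\<phi> \<in> borel_measurable (S \<Otimes>\<^sub>M S')" by simp
  \<comment> \<open>\<open>\<phi>\<close> composed with \<open>Z\<close> is the conditional
    expectation of \<open>h\<close> given \<open>Z\<close>, obtained as the density of one image
    measure with respect to another.\<close>
  have h_phi: "(\<integral>w. v (Z w) * h w \<partial>R) = (\<integral>w. v (Z w) * \<phi> (Z w) \<partial>R)"
    if [measurable]: "v \<in> borel_measurable (S \<Otimes>\<^sub>M S')" for v :: "_ \<Rightarrow> real"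
  proof -
    have "(\<integral>w. v (Z w) * h w \<partial>R) = (\<integral>w. v (Z w) \<partial>bridge)"
      using h_nn by (subst integral_density) (auto simp: mult.commute)
    also have "\<dots> = (\<integral>p. v p \<partial>?P)" by (subst integral_distr) auto
    also have "\<dots> = (\<integral>p. \<phi> p * v p \<partial>?m)"
      unfolding \<phi>(3) using \<phi>(2) by (subst integral_density) auto
    also have "\<dots> = (\<integral>w. v (Z w) * \<phi> (Z w) \<partial>R)" by (subst integral_distr) (auto simp: mult.commute)
    finally show ?thesis .
  qed
  define k where "k w = \<phi> (Z w)" for w
  have k_meas[measurable]: "k \<in> borel_measurable R" unfolding k_def by measurable
  have k_nn: "k w \<ge> 0" for w unfolding k_def by (rule \<phi>)
  have k_int: "integrable R k" using \<phi>(4) unfolding k_def by (subst (asm) integrable_distr_eq) auto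
  have k_1: "(\<integral>w. k w \<partial>R) = 1" using \<phi>(5) unfolding k_def by (subst (asm) integral_distr) auto

  \<comment> \<open>\<open>x ln x\<close> minus its tangent at 1: nonnegative, and on probability
    densities the linear part integrates to 0.\<close>
  define \<xi> where "\<xi> x = x * ln x - x + 1" for x :: real
  have \<xi>_meas[measurable]: "\<xi> \<in> borel_measurable borel" unfolding \<xi>_def by measurable
  have \<xi>_nn: "\<xi> x \<ge> 0" if "x \<ge> 0" for x using entropy_ge_minus_one[OF that] unfolding \<xi>_def by simp
  \<comment> \<open>Truncation to \<open>[1/(i+1), i+1]\<close> makes the logarithm bounded; the
    successor avoids division by 0 and puts 1 in every interval, as
    \<open>entropy_clamp_nonneg\<close> requires.\<close>
  define c where "c i x = max (1 / real (Suc i)) (min (real (Suc i)) x)" for i :: nat and x :: real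
  have c_meas[measurable]: "c i \<in> borel_measurable borel" for i unfolding c_def by measurable
  have c_pos: "c i x > 0" for i x unfolding c_def by (simp add: less_max_iff_disj)
  have c_lo: "1 / real (Suc i) \<le> c i x" for i x unfolding c_def by simp
  have c_up: "c i x \<le> real (Suc i)" for i x
  proof -
    have "1 / real (Suc i) \<le> 1" by simp
    also have "1 \<le> real (Suc i)" by simp
    finally show ?thesis unfolding c_def by simp
  qed
  have lnc_bd: "\<bar>ln (c i x)\<bar> \<le> ln (real (Suc i))" for i x
  proof -
    have "ln (c i x) \<le> ln (real (Suc i))" using c_up[of i x] c_pos[of i x] by simp
    moreover have "ln (1 / real (Suc i)) \<le> ln (c i x)" using c_lo[of i x] c_pos[of i x] by (subst ln_le_cancel_iff) auto
    ultimately show ?thesis by (simp add: ln_div)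
  qed
  \<comment> \<open>The tangent of \<open>\<xi>\<close> at the truncated point \<open>c i x\<close>,
    evaluated at \<open>x\<close>.\<close>
  define F where "F i x = x * ln (c i x) - c i x + 1" for i :: nat and x :: real
  have F_meas[measurable]: "F i \<in> borel_measurable borel" for i unfolding F_def by measurable
  have F_nn: "F i x \<ge> 0" if "x \<ge> 0" for i x
    unfolding F_def c_def using that by (intro entropy_clamp_nonneg) auto
  have F_lim: "(\<lambda>i. F i x) \<longlonglongrightarrow> \<xi> x" if "x \<ge> 0" for x
  proof (cases "x = 0")
    case True
    then have "F i x = 1 - 1 / real (Suc i)" for i unfolding F_def c_def by (simp add: max_def)
    moreover have "(\<lambda>i. 1 - 1 / real (Suc i)) \<longlonglongrightarrow> 1 - 0"
      by (intro tendsto_intros LIMSEQ_Suc lim_1_over_n)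
    ultimately show ?thesis using True by (simp add: \<xi>_def)
  next
    case False
    then have x: "x > 0" using that by simp
    obtain N where N: "real N > max x (1 / x)" using reals_Archimedean2 by blast
    have "F i x = \<xi> x" if "i \<ge> N" for i
    proof -
      have i: "real (Suc i) > x" "real (Suc i) > 1 / x" using N that by auto
      then have "1 / real (Suc i) < x" using x by (simp add: field_simps)
      then have "c i x = x" using i unfolding c_def by simp
      then show ?thesis unfolding F_def \<xi>_def by simp
    qed
    then show ?thesis by (intro tendsto_eventually) (auto simp: eventually_sequentially)
  qed
  have \<xi>h_int: "integrable R (\<lambda>w. \<xi> (h w))" unfolding \<xi>_def using h_ent h_int by auto
  \<comment> \<open>The slope \<open>ln (c i (k w))\<close> is bounded and depends on
    \<open>Z\<close> only, so \<open>k\<close> may be exchanged for \<open>h\<close> in the linear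
    term; the resulting tangent at \<open>h\<close> lies below \<open>\<xi> (h w)\<close>.\<close>
  have F_le: "(\<integral>\<^sup>+w. ennreal (F i (k w)) \<partial>R) \<le> ennreal (\<integral>w. \<xi> (h w) \<partial>R)" for i
  proof -
    have l_int: "integrable R (\<lambda>w. ln (c i (k w)) * f w)" if "integrable R f" for f
      by (rule integrable_bounded_mult[OF that _ lnc_bd]) simp
    have c_int: "integrable R (\<lambda>w. c i (k w))"
      using c_up[of i] c_pos[of i] by (intro integrable_const_bound[of _ "real (Suc i)"]) (auto simp: abs_of_pos)
    have F_int: "integrable R (\<lambda>w. F i (k w))"
      using l_int[OF k_int] c_int unfolding F_def by (auto simp: mult.commute)
    have "(\<integral>w. F i (k w) \<partial>R) = (\<integral>w. ln (c i (k w)) * k w \<partial>R) - (\<integral>w. c i (k w) \<partial>R) + 1"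
      using l_int[OF k_int] c_int unfolding F_def by (simp add: mult.commute prob_space)
    also have "(\<integral>w. ln (c i (k w)) * k w \<partial>R) = (\<integral>w. ln (c i (k w)) * h w \<partial>R)"
      using h_phi[of "\<lambda>p. ln (c i (\<phi> p))"] unfolding k_def by simp
    also have "\<dots> - (\<integral>w. c i (k w) \<partial>R) + 1 = (\<integral>w. ln (c i (k w)) * h w - c i (k w) + 1 \<partial>R)"
      using l_int[OF h_int] c_int by (simp add: prob_space)
    also have "\<dots> \<le> (\<integral>w. \<xi> (h w) \<partial>R)"
    proof (rule integral_mono[OF _ \<xi>h_int])
      show "integrable R (\<lambda>w. ln (c i (k w)) * h w - c i (k w) + 1)" using l_int[OF h_int] c_int by auto
      show "ln (c i (k w)) * h w - c i (k w) + 1 \<le> \<xi> (h w)" for w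
        using entropy_tangent[OF h_nn[of w] c_pos[of i "k w"]] unfolding \<xi>_def by (simp add: mult.commute)
    qed
    finally have "(\<integral>w. F i (k w) \<partial>R) \<le> (\<integral>w. \<xi> (h w) \<partial>R)" .
    then show ?thesis using F_nn[OF k_nn] F_int by (subst nn_integral_eq_integral) (auto intro!: ennreal_leI)
  qed
  \<comment> \<open>Fatou removes the truncation and gives the integrability of
    \<open>k ln k\<close> along with the bound.\<close>
  have "(\<integral>\<^sup>+w. ennreal (\<xi> (k w)) \<partial>R) = (\<integral>\<^sup>+w. liminf (\<lambda>i. ennreal (F i (k w))) \<partial>R)"
    using F_lim[OF k_nn]
    by (intro nn_integral_cong lim_imp_Liminf[symmetric] tendsto_ennrealI) auto
  also have "\<dots> \<le> liminf (\<lambda>i. \<integral>\<^sup>+w. ennreal (F i (k w)) \<partial>R)" by (intro nn_integral_liminf) simp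
  also have "\<dots> \<le> ennreal (\<integral>w. \<xi> (h w) \<partial>R)" using F_le by (intro Liminf_le) (auto intro!: always_eventually)
  finally have le: "(\<integral>\<^sup>+w. ennreal (\<xi> (k w)) \<partial>R) \<le> ennreal (\<integral>w. \<xi> (h w) \<partial>R)" .
  have \<xi>k_int: "integrable R (\<lambda>w. \<xi> (k w))"
    using le \<xi>_nn[OF k_nn] by (intro integrableI_nonneg) (auto intro: le_less_trans)
  have "(\<integral>w. \<xi> (k w) \<partial>R) \<le> (\<integral>w. \<xi> (h w) \<partial>R)"
    using le \<xi>_nn[OF k_nn] \<xi>_nn[OF h_nn] by (subst (asm) nn_integral_eq_integral[OF \<xi>k_int]) auto
  moreover have k_ent: "integrable R (\<lambda>w. k w * ln (k w))"
  proof -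
    have "integrable R (\<lambda>w. \<xi> (k w) + k w - 1)" using \<xi>k_int k_int by auto
    then show ?thesis unfolding \<xi>_def by simp
  qed
  moreover have "(\<integral>w. \<xi> (k w) \<partial>R) = (\<integral>w. k w * ln (k w) \<partial>R)" "(\<integral>w. \<xi> (h w) \<partial>R) = (\<integral>w. h w * ln (h w) \<partial>R)"
    unfolding \<xi>_def using k_ent k_int k_1 h_ent h_int h_prob by (simp_all add: prob_space)
  ultimately have I_le: "(\<integral>w. k w * ln (k w) \<partial>R) \<le> (\<integral>w. h w * ln (h w) \<partial>R)" by simp
  have "competitor k"
    unfolding competitor_def
  proof (intro conjI allI ballI impI)
    fix A assume [measurable]: "A \<in> sets S"
    show "(\<integral>w. indicator A (X w) * k w \<partial>R) = (\<integral>w. indicator A (X w) * h w \<partial>R)"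
      using h_phi[of "\<lambda>p. indicator A (fst p)"] unfolding k_def by (simp add: Z_def)
  next
    fix B assume [measurable]: "B \<in> sets S'" and "B \<subseteq> D"
    then have "indicator B (collapse y) = (indicator B y :: real)" for y
      using star_D by (auto simp: collapse_def indicator_def)
    then show "(\<integral>w. indicator B (Y w) * k w \<partial>R) = (\<integral>w. indicator B (Y w) * h w \<partial>R)"
      using h_phi[of "\<lambda>p. indicator B (snd p)"] unfolding k_def by (simp add: Z_def)
  qed (use k_nn k_int k_ent in auto)
  then have "AE w in R. k w = h w" using I_le by (rule unique)
  then show ?thesis using that[OF _ \<phi>(2,3)] unfolding k_def by simp
qed

end

context collapsed_bridge
begin

text \<open>After the collapse the only mass outside \<open>D\<close> sits at \<open>star\<close>,
  where it is fixed as the complement of the mass in \<open>D\<close>. The partial terminal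
  constraint thus becomes a full marginal constraint.\<close>

lemma competitor_marginals:
  assumes k: "competitor k"
  shows "distr (density R (\<lambda>w. ennreal (k w))) S X = distr bridge S X"
    and "distr (density R (\<lambda>w. ennreal (k w))) S' (\<lambda>w. collapse (Y w)) = distr bridge S' (\<lambda>w. collapse (Y w))"
proof -
  note [measurable] = competitorD(1)[OF k]
  note k' = competitorD(2,3)[OF k]
  show "distr (density R (\<lambda>w. ennreal (k w))) S X = distr bridge S X"
    by (rule measure_eqI) (auto simp: emeasure_distr_density k' h_nn h_int competitorD(5)[OF k])
  show "distr (density R (\<lambda>w. ennreal (k w))) S' (\<lambda>w. collapse (Y w)) = distr bridge S' (\<lambda>w. collapse (Y w))"
  proof (rule measure_eqI)
    fix A assume "A \<in> sets (distr (density R (\<lambda>w. ennreal (k w))) S' (\<lambda>w. collapse (Y w)))"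
    then have A[measurable]: "A \<in> sets S'" by simp
    have dead: "(\<integral>w. indicator (A' \<inter> D) (Y w) * k w \<partial>R) = (\<integral>w. indicator (A' \<inter> D) (Y w) * h w \<partial>R)"
      if "A' \<in> sets S'" for A'
      using that by (intro competitorD(6)[OF k]) auto
    have "(\<integral>w. indicator A (collapse (Y w)) * k w \<partial>R) = (\<integral>w. indicator A (collapse (Y w)) * h w \<partial>R)"
    proof (cases "star \<in> A")
      case False
      then have "indicator A (collapse y) = (indicator (A \<inter> D) y :: real)" for y
        by (auto simp: collapse_def indicator_def)
      then show ?thesis using dead[OF A] by simp
    next
      case True
      define A' where "A' = (space S' - A) \<inter> D"
      have [measurable]: "A' \<in> sets S'" unfolding A'_def by measurable
      have eq: "(\<integral>w. indicator A (collapse (Y w)) * f w \<partial>R) = (\<integral>w. f w \<partial>R) - (\<integral>w. indicator A' (Y w) * f w \<partial>R)"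
        if f: "integrable R f" for f :: "'w \<Rightarrow> real"
      proof -
        have "(\<integral>w. indicator A (collapse (Y w)) * f w \<partial>R) = (\<integral>w. f w - indicator A' (Y w) * f w \<partial>R)"
          using True measurable_space[OF Y]
          by (intro Bochner_Integration.integral_cong) (auto simp: collapse_def indicator_def A'_def)
        then show ?thesis using f integrable_indicator_mult[OF f Y, of A'] by simp
      qed
      show ?thesis
        unfolding eq[OF k'(2)] eq[OF h_int] competitor_total[OF k] h_prob
        using dead[of "space S' - A"] by (simp add: A'_def)
    qed
    then show "emeasure (distr (density R (\<lambda>w. ennreal (k w))) S' (\<lambda>w. collapse (Y w))) A =
        emeasure (distr bridge S' (\<lambda>w. collapse (Y w))) A"
      using k' h_nn h_int by (simp add: emeasure_distr_density)
  qed simp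
qed

lemma emeasure_bridge_alive:
  "emeasure (distr bridge S' (\<lambda>w. collapse (Y w))) {star} = ennreal (1 - (\<integral>w. indicator D (Y w) * h w \<partial>R))"
proof -
  have "(\<integral>w. indicator {star} (collapse (Y w)) * h w \<partial>R) = (\<integral>w. h w - indicator D (Y w) * h w \<partial>R)"
    using star_D by (intro Bochner_Integration.integral_cong) (auto simp: collapse_def indicator_def)
  also have "\<dots> = 1 - (\<integral>w. indicator D (Y w) * h w \<partial>R)"
    using h_int integrable_indicator_mult[OF h_int Y D] h_prob by simp
  finally show ?thesis using h_nn h_int by (simp add: emeasure_distr_density)
qed

text \<open>The competitor \<open>k\<close> with product endpoint law shows that the product of the
  collapsed bridge marginals is dominated by the collapsed bridge law, and \<open>ac\<close> gives
  the converse. On this product the log-density is additive by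
  \<open>additive_decomposition\<close>, and \<open>h\<close> vanishes wherever \<open>R\<close>
  leaves it.\<close>

theorem factorization:
  assumes ac: "absolutely_continuous (distr R S X \<Otimes>\<^sub>M distr R S' Y) (distr R (S \<Otimes>\<^sub>M S') (\<lambda>w. (X w, Y w)))"
    and k: "competitor k" and \<rho>: "prob_space \<rho>0" "prob_space \<rho>2" "sets \<rho>0 = sets S" "sets \<rho>2 = sets S'"
    and k_prod: "distr (density R (\<lambda>w. ennreal (k w))) (S \<Otimes>\<^sub>M S') (\<lambda>w. (X w, Y w)) = \<rho>0 \<Otimes>\<^sub>M \<rho>2"
    and alive: "(\<integral>w. indicator D (Y w) * h w \<partial>R) < 1"
  shows "\<exists>f\<in>borel_measurable S. \<exists>g\<in>borel_measurable S'. (\<forall>x. 0 \<le> f x) \<and> (\<forall>y. 0 \<le> g y) \<and>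
    (\<forall>y. y \<notin> D \<longrightarrow> g y = 1) \<and> (AE w in R. h w = f (X w) * g (Y w))"
proof -
  note [measurable] = competitorD(1)[OF k]

  \<comment> \<open>Collapsed laws and their marginals\<close>
  define Yc where "Yc w = collapse (Y w)" for w
  have Yc_meas[measurable]: "Yc \<in> R \<rightarrow>\<^sub>M S'" unfolding Yc_def by measurable
  have Z_eq: "Z w = (X w, Yc w)" for w unfolding Z_def Yc_def ..
  define \<mu>1 where "\<mu>1 = distr R S X"
  define \<mu>2 where "\<mu>2 = distr R S' Yc"
  define \<nu>1 where "\<nu>1 = distr bridge S X"
  define \<nu>2 where "\<nu>2 = distr bridge S' Yc"
  define \<theta> where "\<theta> = distr bridge (S \<Otimes>\<^sub>M S') Z"
  interpret B: prob_space bridge by (rule prob_space_bridge)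
  interpret \<mu>1: prob_space \<mu>1 unfolding \<mu>1_def by (rule prob_space_distr) simp
  interpret \<mu>2: prob_space \<mu>2 unfolding \<mu>2_def by (rule prob_space_distr) simp
  interpret \<nu>1: prob_space \<nu>1 unfolding \<nu>1_def by (rule B.prob_space_distr) simp
  interpret \<nu>2: prob_space \<nu>2 unfolding \<nu>2_def by (rule B.prob_space_distr) simp
  interpret \<theta>: prob_space \<theta> unfolding \<theta>_def by (rule B.prob_space_distr) simp
  interpret \<mu>: pair_prob_space \<mu>1 \<mu>2 ..
  interpret \<nu>: pair_prob_space \<nu>1 \<nu>2 ..
  have sets_eq[simp, measurable_cong]: "sets \<mu>1 = sets S" "sets \<mu>2 = sets S'" "sets \<nu>1 = sets S" "sets \<nu>2 = sets S'"
    "sets \<theta> = sets (S \<Otimes>\<^sub>M S')"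
    unfolding \<mu>1_def \<mu>2_def \<nu>1_def \<nu>2_def \<theta>_def by simp_all
  have sets_pair[simp]: "sets (\<mu>1 \<Otimes>\<^sub>M \<mu>2) = sets (S \<Otimes>\<^sub>M S')" "sets (\<nu>1 \<Otimes>\<^sub>M \<nu>2) = sets (S \<Otimes>\<^sub>M S')"
    by (intro sets_pair_measure_cong; simp)+
  have bm_pair[simp]: "borel_measurable (\<nu>1 \<Otimes>\<^sub>M \<nu>2) = borel_measurable (S \<Otimes>\<^sub>M S')"
    "borel_measurable (\<mu>1 \<Otimes>\<^sub>M \<mu>2) = borel_measurable (S \<Otimes>\<^sub>M S')"
    "borel_measurable \<nu>2 = borel_measurable S'"
    by (auto intro!: measurable_cong_sets)

  let ?Q = "density R (\<lambda>w. ennreal (k w))"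
  \<comment> \<open>The collapse acts on the second coordinate only, so a product stays a product;
    its factors are \<nu>1 and \<nu>2 because all competitors share the collapsed marginals of the
    bridge.\<close>
  have Q_Z: "distr ?Q (S \<Otimes>\<^sub>M S') Z = \<nu>1 \<Otimes>\<^sub>M \<nu>2"
  proof -
    interpret \<rho>0: prob_space \<rho>0 by fact
    interpret \<rho>2: prob_space \<rho>2 by fact
    note [measurable_cong] = \<rho>(3,4)
    let ?c = "\<lambda>(x, y). (x, collapse y)"
    have c_meas: "?c \<in> S \<Otimes>\<^sub>M S' \<rightarrow>\<^sub>M S \<Otimes>\<^sub>M S'" by measurable
    have "distr ?Q (S \<Otimes>\<^sub>M S') Z = distr (distr ?Q (S \<Otimes>\<^sub>M S') (\<lambda>w. (X w, Y w))) (S \<Otimes>\<^sub>M S') ?c"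
      by (subst distr_distr) (auto simp: comp_def Z_def[abs_def] c_meas)
    also have "\<dots> = distr \<rho>0 S (\<lambda>x. x) \<Otimes>\<^sub>M distr \<rho>2 S' collapse"
    proof -
      interpret c2: prob_space "distr \<rho>2 S' collapse" by (rule \<rho>2.prob_space_distr) simp
      show ?thesis unfolding k_prod
        by (subst pair_measure_distr) (auto intro!: c2.sigma_finite_measure_axioms)
    qed
    finally have eq: "distr ?Q (S \<Otimes>\<^sub>M S') Z = distr \<rho>0 S (\<lambda>x. x) \<Otimes>\<^sub>M distr \<rho>2 S' collapse" .
    interpret c1: prob_space "distr \<rho>0 S (\<lambda>x. x)" by (rule \<rho>0.prob_space_distr) simp
    interpret c2: prob_space "distr \<rho>2 S' collapse" by (rule \<rho>2.prob_space_distr) simp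
    note pm = distr_pair_marginals[OF c1.prob_space_axioms c2.prob_space_axioms, folded eq]
    have "distr \<rho>0 S (\<lambda>x. x) = distr (distr ?Q (S \<Otimes>\<^sub>M S') Z) S fst"
      using pm(1) by (simp cong: distr_cong)
    also have "\<dots> = distr ?Q S X" by (subst distr_distr) (auto simp: comp_def Z_def)
    finally have 1: "distr \<rho>0 S (\<lambda>x. x) = \<nu>1" using competitor_marginals(1)[OF k] by (simp add: \<nu>1_def)
    have "distr \<rho>2 S' collapse = distr (distr ?Q (S \<Otimes>\<^sub>M S') Z) S' snd"
      using pm(2) by (simp cong: distr_cong)
    also have "\<dots> = distr ?Q S' Yc" by (subst distr_distr) (auto simp: comp_def Z_eq)
    finally have 2: "distr \<rho>2 S' collapse = \<nu>2"
      using competitor_marginals(2)[OF k] by (simp add: \<nu>2_def Yc_def[abs_def])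
    show ?thesis unfolding eq 1 2 ..
  qed

  \<comment> \<open>Comparison of null sets\<close>
  have AE_\<theta>: "(AE p in \<theta>. Pr p) \<longleftrightarrow> (AE w in R. h w \<noteq> 0 \<longrightarrow> Pr (Z w))"
    if "{p \<in> space (S \<Otimes>\<^sub>M S'). Pr p} \<in> sets (S \<Otimes>\<^sub>M S')" for Pr
  proof -
    have "(AE p in \<theta>. Pr p) \<longleftrightarrow> (AE w in bridge. Pr (Z w))"
      unfolding \<theta>_def using that by (intro AE_distr_iff) auto
    also have "\<dots> \<longleftrightarrow> (AE w in R. 0 < ennreal (h w) \<longrightarrow> Pr (Z w))" by (rule AE_density) simp
    also have "\<dots> \<longleftrightarrow> (AE w in R. h w \<noteq> 0 \<longrightarrow> Pr (Z w))"
      using h_nn by (intro AE_cong) (auto simp: less_le)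
    finally show ?thesis .
  qed
  \<comment> \<open>By \<open>competitor_abs_cont\<close> the competitor charges nothing where
    \<open>h\<close> vanishes, and its collapsed endpoint law is exactly this product.\<close>
  have \<nu>_le_\<theta>: "AE p in \<nu>1 \<Otimes>\<^sub>M \<nu>2. Pr p" if "AE p in \<theta>. Pr p" "{p \<in> space (S \<Otimes>\<^sub>M S'). Pr p} \<in> sets (S \<Otimes>\<^sub>M S')" for Pr
  proof -
    have "AE w in R. h w \<noteq> 0 \<longrightarrow> Pr (Z w)" using AE_\<theta>[OF that(2)] that(1) by simp
    with competitor_abs_cont[OF k] have "AE w in R. 0 < ennreal (k w) \<longrightarrow> Pr (Z w)"
      by eventually_elim auto
    then have "AE w in ?Q. Pr (Z w)" by (subst AE_density) auto
    then have "AE p in distr ?Q (S \<Otimes>\<^sub>M S') Z. Pr p" using that(2) by (subst AE_distr_iff) auto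
    then show ?thesis by (simp only: Q_Z)
  qed

  \<comment> \<open>The product of the endpoint marginals of \<open>R\<close> collapses to the
    product of \<mu>1 and \<mu>2, which carries \<open>ac\<close> over to the collapsed
    endpoints.\<close>
  have R_le_\<mu>: "AE w in R. Pr (Z w)" if "AE p in \<mu>1 \<Otimes>\<^sub>M \<mu>2. Pr p" for Pr
  proof -
    let ?c = "\<lambda>(x, y). (x, collapse y)"
    let ?m = "distr R S X \<Otimes>\<^sub>M distr R S' Y"
    interpret m2: prob_space "distr R S' Y" by (rule prob_space_distr) simp
    interpret m2c: prob_space "distr (distr R S' Y) S' collapse" by (rule m2.prob_space_distr) simp
    have c_meas: "?c \<in> S \<Otimes>\<^sub>M S' \<rightarrow>\<^sub>M S \<Otimes>\<^sub>M S'" by measurable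
    have "\<mu>1 = distr (distr R S X) S (\<lambda>x. x)" unfolding \<mu>1_def by (simp add: distr_distr comp_def)
    moreover have "\<mu>2 = distr (distr R S' Y) S' collapse" unfolding \<mu>2_def Yc_def[abs_def] by (simp add: distr_distr comp_def)
    ultimately have eq: "\<mu>1 \<Otimes>\<^sub>M \<mu>2 = distr ?m (S \<Otimes>\<^sub>M S') ?c"
      by (simp only:) (subst pair_measure_distr, auto intro!: m2c.sigma_finite_measure_axioms)
    from that have "AE p in distr ?m (S \<Otimes>\<^sub>M S') ?c. Pr p" unfolding eq .
    then have "AE p in ?m. Pr (?c p)" by (rule AE_distrD[rotated]) simp
    then have "AE p in distr R (S \<Otimes>\<^sub>M S') (\<lambda>w. (X w, Y w)). Pr (?c p)"
      using ac by (intro absolutely_continuous_AE[OF _ ac]) (auto intro!: sets_pair_measure_cong)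
    then have "AE w in R. Pr (?c (X w, Y w))" by (rule AE_distrD[rotated]) simp
    then show ?thesis by (simp add: Z_def)
  qed

  have sets_\<nu>: "sets \<nu>1 = sets \<mu>1" "sets \<nu>2 = sets \<mu>2" "sets \<theta> = sets (\<nu>1 \<Otimes>\<^sub>M \<nu>2)" by simp_all
  have ac_bridge: "absolutely_continuous R bridge" by (rule absolutely_continuousI_density) measurable
  have ac1: "absolutely_continuous \<mu>1 \<nu>1"
    unfolding \<mu>1_def \<nu>1_def by (rule absolutely_continuous_distr[OF ac_bridge sets_density X])
  have ac2: "absolutely_continuous \<mu>2 \<nu>2"
    unfolding \<mu>2_def \<nu>2_def by (rule absolutely_continuous_distr[OF ac_bridge sets_density Yc_meas])
  obtain f1 where f1: "f1 \<in> borel_measurable \<mu>1" "\<And>x. 0 \<le> f1 x" "\<nu>1 = density \<mu>1 (\<lambda>x. ennreal (f1 x))"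
    by (rule prob_density_real[OF \<nu>1.prob_space_axioms \<mu>1.sigma_finite_measure_axioms ac1 sets_\<nu>(1)]) (rule that)
  obtain f2 where f2: "f2 \<in> borel_measurable \<mu>2" "\<And>x. 0 \<le> f2 x" "\<nu>2 = density \<mu>2 (\<lambda>x. ennreal (f2 x))"
    by (rule prob_density_real[OF \<nu>2.prob_space_axioms \<mu>2.sigma_finite_measure_axioms ac2 sets_\<nu>(2)]) (rule that)
  have [measurable]: "f1 \<in> borel_measurable S" "f2 \<in> borel_measurable S'" using f1 f2 by simp_all
  \<comment> \<open>Where both marginal densities are positive, the products of the marginals of
    \<open>R\<close> and of the bridge have the same null sets; almost everywhere else
    \<open>h\<close> vanishes.\<close>
  define pos where "pos w \<longleftrightarrow> f1 (X w) > 0 \<and> f2 (Yc w) > 0" for w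
  have h_pos: "AE w in R. h w \<noteq> 0 \<longrightarrow> pos w"
  proof -
    have "AE x in \<nu>1. f1 x > 0" unfolding f1(3) using f1 by (subst AE_density) auto
    then have "AE w in bridge. f1 (X w) > 0" unfolding \<nu>1_def by (rule AE_distrD[rotated]) simp
    moreover have "AE x in \<nu>2. f2 x > 0" unfolding f2(3) using f2 by (subst AE_density) auto
    then have "AE w in bridge. f2 (Yc w) > 0" unfolding \<nu>2_def by (rule AE_distrD[rotated]) simp
    ultimately have "AE w in bridge. pos w" by eventually_elim (simp add: pos_def)
    then have "AE w in R. 0 < ennreal (h w) \<longrightarrow> pos w" by (subst (asm) AE_density) auto
    moreover have "0 < ennreal (h w) \<longleftrightarrow> h w \<noteq> 0" for w using h_nn[of w] by (auto simp: less_le)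
    ultimately show ?thesis by simp
  qed
  have R_le_\<nu>: "AE w in R. pos w \<longrightarrow> Pr (Z w)" if "AE p in \<nu>1 \<Otimes>\<^sub>M \<nu>2. Pr p" for Pr
  proof -
    have eq: "\<nu>1 \<Otimes>\<^sub>M \<nu>2 = density (\<mu>1 \<Otimes>\<^sub>M \<mu>2) (\<lambda>(x, y). ennreal (f1 x) * ennreal (f2 y))"
      by (subst f1(3), subst f2(3), rule pair_measure_density)
        (rule measurable_compose[OF f1(1) measurable_ennreal] measurable_compose[OF f2(1) measurable_ennreal]
          \<mu>2.sigma_finite_measure_axioms \<nu>2.sigma_finite_measure_axioms[unfolded f2(3)])+
    from that have "AE p in density (\<mu>1 \<Otimes>\<^sub>M \<mu>2) (\<lambda>(x, y). ennreal (f1 x) * ennreal (f2 y)). Pr p" unfolding eq .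
    then have "AE p in \<mu>1 \<Otimes>\<^sub>M \<mu>2. 0 < ennreal (f1 (fst p)) * ennreal (f2 (snd p)) \<longrightarrow> Pr p"
      by (subst (asm) AE_density) (auto simp: case_prod_beta)
    then have "AE w in R. 0 < ennreal (f1 (fst (Z w))) * ennreal (f2 (snd (Z w))) \<longrightarrow> Pr (Z w)" by (rule R_le_\<mu>)
    then show ?thesis by eventually_elim (auto simp: pos_def Z_eq ennreal_zero_less_mult_iff)
  qed
  have \<theta>_le_\<nu>: "AE p in \<theta>. Pr p" if "AE p in \<nu>1 \<Otimes>\<^sub>M \<nu>2. Pr p" "{p \<in> space (S \<Otimes>\<^sub>M S'). Pr p} \<in> sets (S \<Otimes>\<^sub>M S')" for Pr
    using R_le_\<nu>[OF that(1)] h_pos by (subst AE_\<theta>[OF that(2)], eventually_elim) auto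

  \<comment> \<open>Positive densities on the product of the bridge marginals\<close>
  obtain \<phi> where \<phi>[measurable]: "\<phi> \<in> borel_measurable (S \<Otimes>\<^sub>M S')" and \<phi>_nn: "\<And>p. 0 \<le> \<phi> p"
    and \<phi>_dens: "\<theta> = density (distr R (S \<Otimes>\<^sub>M S') Z) (\<lambda>p. ennreal (\<phi> p))"
    and \<phi>_h: "AE w in R. \<phi> (Z w) = h w"
    using collapsed_density unfolding \<theta>_def by blast
  have "AE p in \<theta>. \<phi> p > 0" unfolding \<phi>_dens using \<phi>_nn by (subst AE_density) auto
  then have \<phi>_pos: "AE p in \<nu>1 \<Otimes>\<^sub>M \<nu>2. \<phi> p > 0" by (rule \<nu>_le_\<theta>) measurable

  have ac_\<theta>: "absolutely_continuous (\<nu>1 \<Otimes>\<^sub>M \<nu>2) \<theta>"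
    unfolding absolutely_continuous_def
  proof
    fix A assume A: "A \<in> null_sets (\<nu>1 \<Otimes>\<^sub>M \<nu>2)"
    then have [measurable]: "A \<in> sets (S \<Otimes>\<^sub>M S')" by auto
    have "AE p in \<theta>. p \<notin> A" using AE_not_in[OF A] by (rule \<theta>_le_\<nu>) measurable
    then show "A \<in> null_sets \<theta>" by (subst AE_iff_null_sets) auto
  qed
  obtain n0 where n0: "n0 \<in> borel_measurable (\<nu>1 \<Otimes>\<^sub>M \<nu>2)" "\<And>p. 0 \<le> n0 p"
    "\<theta> = density (\<nu>1 \<Otimes>\<^sub>M \<nu>2) (\<lambda>p. ennreal (n0 p))"
    by (rule prob_density_real[OF \<theta>.prob_space_axioms \<nu>.sigma_finite_measure_axioms ac_\<theta> sets_\<nu>(3)]) (rule that)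
  have [measurable]: "n0 \<in> borel_measurable (S \<Otimes>\<^sub>M S')" using n0(1) by simp
  have "AE p in \<theta>. n0 p > 0" unfolding n0(3) using n0(1,2) by (subst AE_density) auto
  then have n0_pos: "AE p in \<nu>1 \<Otimes>\<^sub>M \<nu>2. n0 p > 0" by (rule \<nu>_le_\<theta>) measurable
  \<comment> \<open>The zeros of \<open>n0\<close> form a null set of the product; the value 1 there
    makes the weight positive at every point, as \<open>additive_decomposition\<close>
    demands.\<close>
  define n where "n p = (if n0 p > 0 then n0 p else 1)" for p
  have n_meas[measurable]: "n \<in> borel_measurable (S \<Otimes>\<^sub>M S')" unfolding n_def by measurable
  have n_meas'[measurable]: "n \<in> borel_measurable (\<nu>1 \<Otimes>\<^sub>M \<nu>2)" by simp
  have n_pos: "n p > 0" for p unfolding n_def by simp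
  have \<theta>_n: "\<theta> = density (\<nu>1 \<Otimes>\<^sub>M \<nu>2) (\<lambda>p. ennreal (n p))"
    unfolding n0(3) using n0_pos by (intro density_cong) (auto simp: n_def n0(1))

  have \<theta>_int: "integrable (\<nu>1 \<Otimes>\<^sub>M \<nu>2) (\<lambda>p. n p * v p) \<longleftrightarrow> integrable R (\<lambda>w. h w * v (Z w))"
    "(\<integral>p. n p * v p \<partial>(\<nu>1 \<Otimes>\<^sub>M \<nu>2)) = (\<integral>w. h w * v (Z w) \<partial>R)"
    if [measurable]: "v \<in> borel_measurable (S \<Otimes>\<^sub>M S')" for v :: "_ \<Rightarrow> real"
  proof -
    have v': "v \<in> borel_measurable (\<nu>1 \<Otimes>\<^sub>M \<nu>2)" by simp
    have "integrable (\<nu>1 \<Otimes>\<^sub>M \<nu>2) (\<lambda>p. n p * v p) \<longleftrightarrow> integrable \<theta> v"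
      unfolding \<theta>_n using n_pos v' by (subst integrable_density) (auto simp: less_imp_le)
    also have "\<dots> \<longleftrightarrow> integrable bridge (\<lambda>w. v (Z w))" unfolding \<theta>_def by (subst integrable_distr_eq) auto
    also have "\<dots> \<longleftrightarrow> integrable R (\<lambda>w. h w * v (Z w))"
      using h_nn by (subst integrable_density) auto
    finally show "integrable (\<nu>1 \<Otimes>\<^sub>M \<nu>2) (\<lambda>p. n p * v p) \<longleftrightarrow> integrable R (\<lambda>w. h w * v (Z w))" .
    have "(\<integral>p. n p * v p \<partial>(\<nu>1 \<Otimes>\<^sub>M \<nu>2)) = (\<integral>p. v p \<partial>\<theta>)"
      unfolding \<theta>_n using n_pos v' by (subst integral_density) (auto simp: less_imp_le)
    also have "\<dots> = (\<integral>w. v (Z w) \<partial>bridge)" unfolding \<theta>_def by (subst integral_distr) auto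
    also have "\<dots> = (\<integral>w. h w * v (Z w) \<partial>R)" using h_nn by (subst integral_density) auto
    finally show "(\<integral>p. n p * v p \<partial>(\<nu>1 \<Otimes>\<^sub>M \<nu>2)) = (\<integral>w. h w * v (Z w) \<partial>R)" .
  qed
  have n_int: "integrable (\<nu>1 \<Otimes>\<^sub>M \<nu>2) n" using \<theta>_int(1)[of "\<lambda>_. 1"] h_int by simp
  have \<theta>_marg: "distr (density (\<nu>1 \<Otimes>\<^sub>M \<nu>2) (\<lambda>p. ennreal (n p))) \<nu>1 fst = \<nu>1"
    "distr (density (\<nu>1 \<Otimes>\<^sub>M \<nu>2) (\<lambda>p. ennreal (n p))) \<nu>2 snd = \<nu>2"
  proof -
    have "distr \<theta> \<nu>1 fst = distr bridge S X" "distr \<theta> \<nu>2 snd = distr bridge S' Yc"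
      unfolding \<theta>_def by (subst distr_distr; auto simp: comp_def Z_eq intro!: distr_cong)+
    then show "distr (density (\<nu>1 \<Otimes>\<^sub>M \<nu>2) (\<lambda>p. ennreal (n p))) \<nu>1 fst = \<nu>1"
      "distr (density (\<nu>1 \<Otimes>\<^sub>M \<nu>2) (\<lambda>p. ennreal (n p))) \<nu>2 snd = \<nu>2"
      unfolding \<theta>_n[symmetric] \<nu>1_def[symmetric] \<nu>2_def[symmetric] by simp_all
  qed
  note marg = density_product_marginals[OF \<nu>1.prob_space_axioms \<nu>2.prob_space_axioms _ \<theta>_marg]
  have marg1: "AE x in \<nu>1. (\<integral>z. n (x, z) \<partial>\<nu>2) = 1"
    using marg(1)[OF measurable_compose[OF n_meas' measurable_ennreal]] AE_space
  proof eventually_elim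
    case (elim x)
    note [measurable] = elim(2)
    show ?case using elim n_pos by (subst integral_eq_nn_integral) (auto simp: less_imp_le)
  qed
  have marg2: "AE z in \<nu>2. (\<integral>x. n (x, z) \<partial>\<nu>1) = 1"
    using marg(2)[OF measurable_compose[OF n_meas' measurable_ennreal]] AE_space
  proof eventually_elim
    case (elim x)
    note [measurable] = elim(2)
    show ?case using elim n_pos by (subst integral_eq_nn_integral) (auto simp: less_imp_le)
  qed

  \<comment> \<open>Additivity of the log-density\<close>
  have e_star: "emeasure \<nu>2 {star} > 0"
    using emeasure_bridge_alive alive unfolding \<nu>2_def Yc_def[abs_def] by simp
  then have star_pos: "measure \<nu>2 {star} > 0"
    by (simp add: measure_def enn2real_positive_iff \<nu>2.emeasure_finite less_top[symmetric])
  define H where "H p = ln (\<phi> p)" for p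
  have H_meas[measurable]: "H \<in> borel_measurable (S \<Otimes>\<^sub>M S')" unfolding H_def by measurable
  have hH: "AE w in R. h w * v (Z w) * H (Z w) = v (Z w) * (h w * ln (h w))" for v :: "_ \<Rightarrow> real"
    using \<phi>_h by eventually_elim (simp add: H_def)
  have nH_int: "integrable (\<nu>1 \<Otimes>\<^sub>M \<nu>2) (\<lambda>p. n p * H p)"
  proof -
    have "integrable R (\<lambda>w. h w * H (Z w)) \<longleftrightarrow> integrable R (\<lambda>w. h w * ln (h w))"
      using hH[of "\<lambda>_. 1"] by (intro integrable_cong_AE) auto
    then show ?thesis using \<theta>_int(1)[OF H_meas] h_ent by simp
  qed
  \<comment> \<open>The perturbation acts on \<open>h\<close> through \<open>Z\<close>. Vanishing
    fibre integrals make it invisible to events of the start and of the collapsed endpoint, and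
    inside \<open>D\<close> the latter are events of the true endpoint.\<close>
  have foc: "(\<integral>p. u p * (n p * H p) \<partial>(\<nu>1 \<Otimes>\<^sub>M \<nu>2)) = 0"
    if u_meas: "u \<in> borel_measurable (\<nu>1 \<Otimes>\<^sub>M \<nu>2)" and u_bd: "\<And>p. \<bar>u p\<bar> \<le> C"
      and u1: "AE x in \<nu>1. (\<integral>z. u (x, z) * n (x, z) \<partial>\<nu>2) = 0"
      and u2: "AE z in \<nu>2. (\<integral>x. u (x, z) * n (x, z) \<partial>\<nu>1) = 0" for u C
  proof -
    have [measurable]: "u \<in> borel_measurable (S \<Otimes>\<^sub>M S')" using u_meas by simp
    have un_int: "integrable (\<nu>1 \<Otimes>\<^sub>M \<nu>2) (\<lambda>p. u p * n p)"
      by (rule integrable_mult_AE_bounded[OF n_int u_meas, where C=C]) (intro AE_I2 u_bd)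
    have "(\<integral>w. u (Z w) * (h w * ln (h w)) \<partial>R) = 0"
    proof (rule first_order_condition[where C=C])
      fix A assume A[measurable]: "A \<in> sets S"
      have i: "integrable (\<nu>1 \<Otimes>\<^sub>M \<nu>2) (\<lambda>p. indicator A (fst p) * (u p * n p))"
        by (rule integrable_mult_AE_bounded[OF un_int, where C=1]) (auto simp: indicator_def)
      have "(\<integral>w. indicator A (X w) * (u (Z w) * h w) \<partial>R) = (\<integral>w. h w * (indicator A (fst (Z w)) * u (Z w)) \<partial>R)"
        by (intro Bochner_Integration.integral_cong) (auto simp: Z_eq)
      also have "\<dots> = (\<integral>p. n p * (indicator A (fst p) * u p) \<partial>(\<nu>1 \<Otimes>\<^sub>M \<nu>2))"
        by (rule \<theta>_int(2)[symmetric, of "\<lambda>p. indicator A (fst p) * u p"]) measurable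
      also have "\<dots> = (\<integral>p. indicator A (fst p) * (u p * n p) \<partial>(\<nu>1 \<Otimes>\<^sub>M \<nu>2))"
        by (intro Bochner_Integration.integral_cong) auto
      also have "\<dots> = (\<integral>x. (\<integral>z. indicator A x * (u (x, z) * n (x, z)) \<partial>\<nu>2) \<partial>\<nu>1)"
        using \<nu>.integral_fst'[OF i] by simp
      also have "\<dots> = 0" using u1 by (intro integral_eq_zero_AE) (auto elim!: eventually_mono)
      finally show "(\<integral>w. indicator A (X w) * (u (Z w) * h w) \<partial>R) = 0" .
    next
      fix A assume A[measurable]: "A \<in> sets S'" and "A \<subseteq> D"
      then have ind: "indicator A (Yc w) = (indicator A (Y w) :: real)" for w
        using star_D by (auto simp: Yc_def collapse_def indicator_def)
      have i: "integrable (\<nu>1 \<Otimes>\<^sub>M \<nu>2) (\<lambda>p. indicator A (snd p) * (u p * n p))"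
        by (rule integrable_mult_AE_bounded[OF un_int, where C=1]) (auto simp: indicator_def)
      have "(\<integral>w. indicator A (Y w) * (u (Z w) * h w) \<partial>R) = (\<integral>w. h w * (indicator A (snd (Z w)) * u (Z w)) \<partial>R)"
        by (intro Bochner_Integration.integral_cong) (auto simp: Z_eq ind)
      also have "\<dots> = (\<integral>p. n p * (indicator A (snd p) * u p) \<partial>(\<nu>1 \<Otimes>\<^sub>M \<nu>2))"
        by (rule \<theta>_int(2)[symmetric, of "\<lambda>p. indicator A (snd p) * u p"]) measurable
      also have "\<dots> = (\<integral>p. indicator A (snd p) * (u p * n p) \<partial>(\<nu>1 \<Otimes>\<^sub>M \<nu>2))"
        by (intro Bochner_Integration.integral_cong) auto
      also have "\<dots> = (\<integral>z. (\<integral>x. indicator A z * (u (x, z) * n (x, z)) \<partial>\<nu>1) \<partial>\<nu>2)"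
        using \<nu>.integral_snd[of "\<lambda>x z. indicator A z * (u (x, z) * n (x, z))"] i
        unfolding case_prod_beta prod.collapse by simp
      also have "\<dots> = 0" using u2 by (intro integral_eq_zero_AE) (auto elim!: eventually_mono)
      finally show "(\<integral>w. indicator A (Y w) * (u (Z w) * h w) \<partial>R) = 0" .
    qed (use u_bd in auto)
    moreover have "(\<integral>p. u p * (n p * H p) \<partial>(\<nu>1 \<Otimes>\<^sub>M \<nu>2)) = (\<integral>p. n p * (u p * H p) \<partial>(\<nu>1 \<Otimes>\<^sub>M \<nu>2))"
      by (intro Bochner_Integration.integral_cong) auto
    moreover have "\<dots> = (\<integral>w. h w * (u (Z w) * H (Z w)) \<partial>R)" by (rule \<theta>_int(2)) measurable
    moreover have "\<dots> = (\<integral>w. u (Z w) * (h w * ln (h w)) \<partial>R)"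
      using hH[of u] by (intro integral_cong_AE) (auto simp: mult.assoc)
    ultimately show ?thesis by simp
  qed
  have "\<exists>c\<in>borel_measurable \<nu>2. AE p in \<nu>1 \<Otimes>\<^sub>M \<nu>2. H p - H (fst p, star) = c (snd p)"
  proof (rule additive_decomposition[OF \<nu>1.prob_space_axioms \<nu>2.prob_space_axioms _ star_pos n_meas' n_pos n_int marg1 marg2 _ nH_int])
    show "{star} \<in> sets \<nu>2" "H \<in> borel_measurable (\<nu>1 \<Otimes>\<^sub>M \<nu>2)" by simp_all
  qed (rule foc)
  then obtain c where c: "c \<in> borel_measurable S'"
    and c_eq: "AE p in \<nu>1 \<Otimes>\<^sub>M \<nu>2. H p - H (fst p, star) = c (snd p)" by auto
  note [measurable] = c
  \<comment> \<open>On the section at \<open>star\<close> the left-hand side is identically 0, and a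
    relation holding almost everywhere holds at an atom. This normalises the second factor to 1 on
    survivors.\<close>
  have c_star: "c star = 0"
  proof -
    have "AE x in \<nu>1. AE z in \<nu>2. H (x, z) - H (x, star) = c z" using \<nu>.AE_pair[OF c_eq] by simp
    then have "AE x in \<nu>1. c star = 0"
      by eventually_elim (use AE_atom[where a=star and M=\<nu>2] e_star star in fastforce)
    then show ?thesis by simp
  qed
  \<comment> \<open>For a survivor \<open>g\<close> is 1, so a zero of \<open>h\<close> has to come
    from \<open>f\<close>: as \<open>f2 star\<close> is positive, \<open>pos\<close> can fail there
    only through \<open>f1\<close>.\<close>
  have f2_star: "f2 star > 0"
  proof (rule ccontr)
    assume "\<not> f2 star > 0"
    then have "f2 star = 0" using f2(2)[of star] by simp
    then have "emeasure \<nu>2 {star} = 0"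
      unfolding f2(3) using f2(1) by (subst emeasure_density) (auto simp: nn_integral_0_iff_AE indicator_def)
    then show False using e_star by simp
  qed
  \<comment> \<open>The cut-offs at zeros of \<open>f1\<close> and \<open>f2\<close> make the
    product 0 off \<open>pos\<close>, where \<open>h\<close> vanishes; on \<open>pos\<close> the
    additive form of \<open>H\<close> is exponentiated.\<close>
  define f where "f x = (if f1 x > 0 then exp (H (x, star)) else 0)" for x
  define g where "g y = (if y \<in> D then if f2 y > 0 then exp (c y) else 0 else 1)" for y
  have "f \<in> borel_measurable S" unfolding f_def by measurable
  moreover have "g \<in> borel_measurable S'" unfolding g_def by measurable
  moreover have "AE w in R. h w = f (X w) * g (Y w)"
    using R_le_\<nu>[OF c_eq] R_le_\<nu>[OF \<phi>_pos] \<phi>_h h_pos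
  proof eventually_elim
    case (elim w)
    show ?case
    proof (cases "pos w")
      case True
      then have "H (Z w) = H (X w, star) + c (Yc w)" "\<phi> (Z w) > 0" using elim by (auto simp: Z_eq)
      moreover have "h w = exp (H (Z w))" using elim calculation(2) by (simp add: H_def)
      ultimately have "h w = exp (H (X w, star)) * exp (c (Yc w))" by (simp add: exp_add)
      then show ?thesis using True c_star by (auto simp: f_def g_def pos_def Yc_def collapse_def split: if_splits)
    next
      case False
      then have "h w = 0" using elim by auto
      then show ?thesis using False f2_star by (auto simp: f_def g_def pos_def Yc_def collapse_def split: if_splits)
    qed
  qed
  ultimately show ?thesis by (intro bexI[of _ f] bexI[of _ g]) (auto simp: f_def g_def)
qed

end

section \<open>Path space and the Markov property at time zero\<close>

lemma space_state_space: "space (state_space :: ('n::finite) state measure) = UNIV"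
  by (simp add: state_space_def space_pair_measure)

lemma state_measurable[measurable]:
  "fst \<in> (state_space :: ('n::finite) state measure) \<rightarrow>\<^sub>M borel"
  "snd \<in> (state_space :: ('n::finite) state measure) \<rightarrow>\<^sub>M count_space UNIV"
  unfolding state_space_def by measurable

lemma ktime_measurable[measurable]: "(\<lambda>z. ktime z) \<in> borel_measurable (state_space :: ('n::finite) state measure)"
proof -
  have "snd \<in> borel_measurable (borel :: ((real^'n) \<times> real) measure)"
    by (intro borel_measurable_continuous_onI continuous_intros)
  from measurable_compose[OF state_measurable(1) this] show ?thesis .
qed

lemma alive_measurable[measurable]: "alive \<in> borel \<rightarrow>\<^sub>M (state_space :: ('n::finite) state measure)"
proof -
  have "(\<lambda>x::real^'n. (x, 0::real)) \<in> borel_measurable borel"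
    by (intro borel_measurable_continuous_onI continuous_intros)
  then show ?thesis unfolding alive_def[abs_def] state_space_def by measurable
qed

lemma regime_set[measurable]: "{z. regime z = i} \<in> sets (state_space :: ('n::finite) state measure)"
proof -
  have "{z \<in> space state_space. regime z = i} \<in> sets (state_space :: 'n state measure)" by measurable
  then show ?thesis by (simp add: space_state_space)
qed

lemma alive_image[measurable]:
  assumes "A \<in> sets borel" shows "alive ` A \<in> sets (state_space :: ('n::finite) state measure)"
proof -
  have "alive ` A = (A \<times> {0}) \<times> {Active}" by (auto simp: alive_def image_iff)
  moreover have "A \<times> {0::real} \<in> sets borel" using assms by (intro borel_Times) auto
  ultimately show ?thesis unfolding state_space_def by (auto intro!: pair_measureI)
qed

lemma space_path_space: "space (path_space T :: (real \<Rightarrow> ('n::finite) state) measure) = paths T"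
  by (auto simp: path_space_def space_restrict_space space_PiM PiE_def space_state_space paths_def)

lemma path_eval_measurable:
  assumes "t \<in> {0..T}"
  shows "(\<lambda>\<omega>. \<omega> t) \<in> (path_space T :: (real \<Rightarrow> ('n::finite) state) measure) \<rightarrow>\<^sub>M state_space"
  unfolding path_space_def using assms
  by (intro measurable_restrict_space1 measurable_component_singleton)

lemma path_measureD:
  assumes "path_measure T (P :: (real \<Rightarrow> ('n::finite) state) measure)"
  shows "prob_space P" "sets P = sets (path_space T)" "space P = paths T"
    "t \<in> {0..T} \<Longrightarrow> (\<lambda>\<omega>. \<omega> t) \<in> P \<rightarrow>\<^sub>M state_space"
proof -
  show 1: "prob_space P" "sets P = sets (path_space T)" using assms by (auto simp: path_measure_def)
  show "space P = paths T" using sets_eq_imp_space_eq[OF 1(2)] by (simp add: space_path_space)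
  show "t \<in> {0..T} \<Longrightarrow> (\<lambda>\<omega>. \<omega> t) \<in> P \<rightarrow>\<^sub>M state_space"
    using path_eval_measurable[of t T] measurable_cong_sets[OF 1(2) refl] by blast
qed

lemma path_filtration:
  shows "space (path_filtration T t :: (real \<Rightarrow> ('n::finite) state) measure) = paths T"
    and "sets (path_filtration T t :: (real \<Rightarrow> 'n state) measure) = sigma_sets (paths T)
      {(\<lambda>\<omega>. \<omega> s) -` A \<inter> paths T | s A. s \<in> {0..T} \<and> s \<le> t \<and> A \<in> sets (state_space :: 'n state measure)}"
    and "filtration (paths T) (path_filtration T :: real \<Rightarrow> (real \<Rightarrow> 'n state) measure)"
proof -
  have sub: "{(\<lambda>\<omega>. \<omega> s) -` A \<inter> paths T | s A. s \<in> {0..T} \<and> s \<le> t \<and> A \<in> sets (state_space :: 'n state measure)} \<subseteq> Pow (paths T)" for t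
    by auto
  show sp: "space (path_filtration T t :: (real \<Rightarrow> 'n state) measure) = paths T" for t
    unfolding path_filtration_def using sub by (rule space_measure_of)
  show se: "sets (path_filtration T t :: (real \<Rightarrow> 'n state) measure) = sigma_sets (paths T)
      {(\<lambda>\<omega>. \<omega> s) -` A \<inter> paths T | s A. s \<in> {0..T} \<and> s \<le> t \<and> A \<in> sets (state_space :: 'n state measure)}" for t
    unfolding path_filtration_def using sub by (rule sets_measure_of)
  show "filtration (paths T) (path_filtration T :: real \<Rightarrow> (real \<Rightarrow> 'n state) measure)"
  proof
    show "space (path_filtration T i) = (paths T :: (real \<Rightarrow> 'n state) set)" for i by (rule sp)
    show "sets (path_filtration T i) \<le> sets (path_filtration T j :: (real \<Rightarrow> 'n state) measure)" if "i \<le> j" for i j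
      unfolding se using that by (intro sigma_sets_mono') (auto, blast intro: order_trans)
  qed
qed

lemma transition_functionD:
  fixes \<kappa> :: "real \<Rightarrow> real \<Rightarrow> ('n::finite) state \<Rightarrow> 'n state measure"
  assumes \<kappa>: "transition_function T \<kappa>"
  shows "0 \<le> s \<Longrightarrow> s \<le> t \<Longrightarrow> t \<le> T \<Longrightarrow> \<kappa> s t \<in> state_space \<rightarrow>\<^sub>M prob_algebra state_space"
    and "0 \<le> s \<Longrightarrow> s \<le> t \<Longrightarrow> t \<le> u \<Longrightarrow> u \<le> T \<Longrightarrow> \<kappa> s u z = \<kappa> s t z \<bind> \<kappa> t u"
proof -
  assume st: "0 \<le> s" "s \<le> t" "t \<le> T"
  let ?I = "restrict_space borel {(s, t). 0 \<le> s \<and> s \<le> t \<and> t \<le> T} :: (real \<times> real) measure"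
  have "(s, t) \<in> space ?I" using st by (simp add: space_restrict_space)
  then have "(\<lambda>z. ((s, t), z)) \<in> state_space \<rightarrow>\<^sub>M ?I \<Otimes>\<^sub>M state_space" by (rule measurable_Pair1')
  moreover have "(\<lambda>((s, t), z). \<kappa> s t z) \<in> ?I \<Otimes>\<^sub>M state_space \<rightarrow>\<^sub>M prob_algebra state_space"
    using \<kappa> unfolding transition_function_def by blast
  ultimately have "(\<lambda>z. (\<lambda>((s, t), z). \<kappa> s t z) ((s, t), z)) \<in> state_space \<rightarrow>\<^sub>M prob_algebra state_space"
    by (rule measurable_compose)
  then show "\<kappa> s t \<in> state_space \<rightarrow>\<^sub>M prob_algebra state_space" by simp
next
  show "0 \<le> s \<Longrightarrow> s \<le> t \<Longrightarrow> t \<le> u \<Longrightarrow> u \<le> T \<Longrightarrow> \<kappa> s u z = \<kappa> s t z \<bind> \<kappa> t u"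
    using \<kappa> unfolding transition_function_def by blast
qed

text \<open>The strong Markov property at the constant stopping time 0, integrated over the event
  that the path starts in \<open>A\<close>. This event belongs to the past of time 0, so the
  conditional expectation may be replaced by the indicator itself.\<close>

lemma strong_markov_at_zero:
  fixes R :: "(real \<Rightarrow> ('n::finite) state) measure"
  assumes T: "0 \<le> r" "r \<le> T" and R: "path_measure T R" and sm: "strong_markov T \<kappa> R"
    and \<kappa>: "transition_function T \<kappa>"
    and A[measurable]: "A \<in> sets state_space" and B[measurable]: "B \<in> sets state_space"
  shows "emeasure R {\<omega> \<in> space R. \<omega> 0 \<in> A \<and> \<omega> r \<in> B} =
    (\<integral>\<^sup>+z. indicator A z * emeasure (\<kappa> 0 r z) B \<partial>law_at 0 R)"
proof -
  interpret R: prob_space R using R by (rule path_measureD)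
  have T0: "0 \<le> T" using T by simp
  note sp = path_measureD(3)[OF R]
  have ev[measurable]: "(\<lambda>\<omega>. \<omega> 0) \<in> R \<rightarrow>\<^sub>M state_space" "(\<lambda>\<omega>. \<omega> r) \<in> R \<rightarrow>\<^sub>M state_space"
    using path_measureD(4)[OF R] T by auto
  have \<kappa>_meas[measurable]: "\<kappa> 0 r \<in> state_space \<rightarrow>\<^sub>M prob_algebra state_space"
    using transition_functionD(1)[OF \<kappa>] T by simp
  interpret F: filtration "paths T" "path_filtration T :: real \<Rightarrow> (real \<Rightarrow> 'n state) measure"
    by (rule path_filtration(3))
  define \<theta> :: "(real \<Rightarrow> 'n state) \<Rightarrow> real" where "\<theta> = (\<lambda>_. 0)"
  have st: "stopping_time (path_filtration T :: real \<Rightarrow> (real \<Rightarrow> 'n state) measure) \<theta>"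
    unfolding \<theta>_def by (rule stopping_time_const)
  define G where "G = F.pre_sigma \<theta>"
  have F0: "sets (path_filtration T 0 :: (real \<Rightarrow> 'n state) measure) \<subseteq> sets R"
  proof -
    have "(\<lambda>\<omega>. \<omega> s) -` A \<inter> paths T \<in> sets R" if "s \<in> {0..T}" "A \<in> sets state_space" for s and A :: "'n state set"
      using measurable_sets[OF path_measureD(4)[OF R that(1)] that(2)] sp by simp
    then show ?thesis
      unfolding path_filtration(2) using sets.sigma_sets_subset'[of _ R "paths T"] sets.top[of R] sp
      by (intro sets.sigma_sets_subset') auto
  qed
  have "subalgebra R G"
    unfolding subalgebra_def
  proof
    show "space G = space R" unfolding G_def using F.space_pre_sigma sp by simp
    show "sets G \<subseteq> sets R"
    proof
      fix E assume "E \<in> sets G"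
      from F.sets_pre_sigmaD[OF st this[unfolded G_def], of 0]
      have "E \<in> sets (path_filtration T 0)" by (simp add: \<theta>_def)
      then show "E \<in> sets R" using F0 by blast
    qed
  qed
  then interpret G: finite_measure_subalgebra R G by unfold_locales
  define E where "E = {\<omega> \<in> space R. \<omega> 0 \<in> A}"
  have E_G: "E \<in> sets G"
    unfolding G_def
  proof (rule F.sets_pre_sigmaI[OF st])
    fix t
    show "{\<omega> \<in> E. \<theta> \<omega> \<le> t} \<in> sets (path_filtration T t)"
    proof (cases "0 \<le> t")
      case True
      then have "{\<omega> \<in> E. \<theta> \<omega> \<le> t} = (\<lambda>\<omega>. \<omega> 0) -` A \<inter> paths T" by (auto simp: E_def \<theta>_def sp)
      also have "\<dots> \<in> sets (path_filtration T t)"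
        unfolding path_filtration(2) using T0 True A by (intro sigma_sets.Basic CollectI exI[of _ 0] exI[of _ A]) auto
      finally show ?thesis .
    qed (simp add: \<theta>_def)
  qed
  have E[measurable]: "E \<in> sets R" unfolding E_def by measurable
  let ?f = "\<lambda>\<omega>. indicator B (\<omega> r) :: real"
  have f_int: "integrable R ?f"
    by (rule R.integrable_const_bound[of _ 1]) (auto simp: indicator_def)
  have "AE \<omega> in R. real_cond_exp R (filtration.pre_sigma (paths T) (path_filtration T) \<theta>)
             (\<lambda>\<omega>. indicator B (\<omega> (min (\<theta> \<omega> + r) T))) \<omega>
           = measure (\<kappa> (\<theta> \<omega>) (min (\<theta> \<omega> + r) T) (\<omega> (\<theta> \<omega>))) B"
    by (rule sm[unfolded strong_markov_def, rule_format]) (use st T T0 B in \<open>auto simp: \<theta>_def\<close>)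
  then have ce: "AE \<omega> in R. real_cond_exp R G ?f \<omega> = measure (\<kappa> 0 r (\<omega> 0)) B"
    using T by (simp add: \<theta>_def G_def min_absorb1)
  have m_meas[measurable]: "(\<lambda>z. measure (\<kappa> 0 r z) B) \<in> borel_measurable state_space"
    by (rule measurable_compose[OF \<kappa>_meas]) measurable
  have [measurable]: "(\<lambda>z. emeasure (\<kappa> 0 r z) B) \<in> borel_measurable state_space"
    by (rule measurable_compose[OF measurable_prob_algebraD[OF \<kappa>_meas]]) measurable
  have \<kappa>_prob: "prob_space (\<kappa> 0 r z)" for z
    using measurable_space[OF \<kappa>_meas, of z] by (simp add: space_state_space space_prob_algebra)
  have "(\<integral>\<omega>\<in>E. ?f \<omega> \<partial>R) = (\<integral>\<omega>\<in>E. real_cond_exp R G ?f \<omega> \<partial>R)"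
    by (rule G.real_cond_exp_intA[OF f_int E_G])
  also have "\<dots> = (\<integral>\<omega>\<in>E. measure (\<kappa> 0 r (\<omega> 0)) B \<partial>R)"
    unfolding set_lebesgue_integral_def using ce by (intro integral_cong_AE) (auto elim: eventually_mono)
  finally have eq: "(\<integral>\<omega>\<in>E. ?f \<omega> \<partial>R) = (\<integral>\<omega>\<in>E. measure (\<kappa> 0 r (\<omega> 0)) B \<partial>R)" .
  have "(\<integral>\<omega>\<in>E. ?f \<omega> \<partial>R) = (\<integral>\<omega>. indicator {\<omega> \<in> space R. \<omega> 0 \<in> A \<and> \<omega> r \<in> B} \<omega> \<partial>R)"
    unfolding set_lebesgue_integral_def
    by (intro Bochner_Integration.integral_cong) (auto simp: E_def indicator_def)
  also have "\<dots> = measure R {\<omega> \<in> space R. \<omega> 0 \<in> A \<and> \<omega> r \<in> B}" by simp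
  finally have "emeasure R {\<omega> \<in> space R. \<omega> 0 \<in> A \<and> \<omega> r \<in> B} = ennreal (\<integral>\<omega>. indicator A (\<omega> 0) * measure (\<kappa> 0 r (\<omega> 0)) B \<partial>R)"
    using eq unfolding R.emeasure_eq_measure set_lebesgue_integral_def
    by (auto simp: E_def indicator_def intro!: arg_cong[where f=ennreal] Bochner_Integration.integral_cong)
  also have "\<dots> = (\<integral>\<^sup>+\<omega>. ennreal (indicator A (\<omega> 0) * measure (\<kappa> 0 r (\<omega> 0)) B) \<partial>R)"
    using prob_space.prob_le_1[OF \<kappa>_prob]
    by (intro nn_integral_eq_integral[symmetric] R.integrable_const_bound[of _ 1]) (auto simp: indicator_def)
  also have "\<dots> = (\<integral>\<^sup>+\<omega>. indicator A (\<omega> 0) * emeasure (\<kappa> 0 r (\<omega> 0)) B \<partial>R)"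
    using prob_space.finite_measure[OF \<kappa>_prob]
    by (intro nn_integral_cong) (auto simp: indicator_def finite_measure.emeasure_eq_measure)
  also have "\<dots> = (\<integral>\<^sup>+z. indicator A z * emeasure (\<kappa> 0 r z) B \<partial>law_at 0 R)"
    unfolding law_at_def by (subst nn_integral_distr) auto
  finally show ?thesis .
qed

section \<open>Absolute continuity of the endpoint law\<close>

lemma measure_eqI_pair:
  assumes "finite_measure M" and sets: "sets M = sets (A \<Otimes>\<^sub>M B)" "sets N = sets (A \<Otimes>\<^sub>M B)"
    and eq: "\<And>E F. E \<in> sets A \<Longrightarrow> F \<in> sets B \<Longrightarrow> emeasure M (E \<times> F) = emeasure N (E \<times> F)"
  shows "M = N"
proof (rule measure_eqI_generator_eq)
  interpret finite_measure M by fact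
  let ?E = "{a \<times> b | a b. a \<in> sets A \<and> b \<in> sets B}"
  show "Int_stable ?E" by (rule Int_stable_pair_measure_generator)
  show "?E \<subseteq> Pow (space A \<times> space B)" using sets.space_closed[of A] sets.space_closed[of B] by blast
  show "emeasure M X = emeasure N X" if "X \<in> ?E" for X using that eq by auto
  show "sets M = sigma_sets (space A \<times> space B) ?E" "sets N = sigma_sets (space A \<times> space B) ?E"
    using sets by (simp_all add: sets_pair_measure)
  show "range (\<lambda>_::nat. space A \<times> space B) \<subseteq> ?E" by auto
  show "(\<Union>i::nat. space A \<times> space B) = space A \<times> space B" by simp
  show "emeasure M (space A \<times> space B) \<noteq> \<infinity>" by simp
qed

text \<open>The Markov property gives the formula on rectangles. To reach all measurable sets the
  right-hand side is recognised as a measure, the initial law bound to the kernel \<open>J z\<close>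
  of pairs \<open>(z, y)\<close>; finite measures that agree on rectangles coincide.\<close>

lemma emeasure_endpoint_law:
  fixes R :: "(real \<Rightarrow> ('n::finite) state) measure"
  assumes T: "0 \<le> T" and R: "path_measure T R" and sm: "strong_markov T \<kappa> R"
    and \<kappa>: "transition_function T \<kappa>"
    and N[measurable]: "N \<in> sets (state_space \<Otimes>\<^sub>M state_space)"
  shows "emeasure (endpoint_law T R) N = (\<integral>\<^sup>+z. emeasure (\<kappa> 0 T z) (Pair z -` N) \<partial>law_at 0 R)"
proof -
  interpret R: prob_space R using R by (rule path_measureD)
  have ev[measurable]: "(\<lambda>\<omega>. \<omega> 0) \<in> R \<rightarrow>\<^sub>M state_space" "(\<lambda>\<omega>. \<omega> T) \<in> R \<rightarrow>\<^sub>M state_space"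
    using path_measureD(4)[OF R] T by auto
  let ?S = "state_space :: 'n state measure"
  have \<kappa>_meas: "\<kappa> 0 T \<in> ?S \<rightarrow>\<^sub>M prob_algebra ?S"
    using transition_functionD(1)[OF \<kappa>] T by simp
  have \<kappa>_sub: "\<kappa> 0 T \<in> ?S \<rightarrow>\<^sub>M subprob_algebra ?S" by (rule measurable_prob_algebraD[OF \<kappa>_meas])
  have \<kappa>_sets: "sets (\<kappa> 0 T z) = sets ?S" for z
    using measurable_space[OF \<kappa>_meas, of z] by (simp add: space_state_space space_prob_algebra)
  define J where "J z = distr (\<kappa> 0 T z) (?S \<Otimes>\<^sub>M ?S) (Pair z)" for z
  have J_meas: "J \<in> law_at 0 R \<rightarrow>\<^sub>M subprob_algebra (?S \<Otimes>\<^sub>M ?S)"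
  proof -
    have "J \<in> ?S \<rightarrow>\<^sub>M subprob_algebra (?S \<Otimes>\<^sub>M ?S)"
      unfolding J_def by (rule measurable_distr2[OF _ \<kappa>_sub]) simp
    then show ?thesis by (simp add: law_at_def)
  qed
  have J_em: "emeasure (J z) X = emeasure (\<kappa> 0 T z) (Pair z -` X)" if "X \<in> sets (?S \<Otimes>\<^sub>M ?S)" for z X
  proof -
    have "Pair z \<in> \<kappa> 0 T z \<rightarrow>\<^sub>M ?S \<Otimes>\<^sub>M ?S"
      unfolding measurable_cong_sets[OF \<kappa>_sets refl] by (rule measurable_Pair1') (simp add: space_state_space)
    then show ?thesis unfolding J_def using that sets_eq_imp_space_eq[OF \<kappa>_sets]
      by (subst emeasure_distr) (auto simp: space_state_space)
  qed
  have ne: "space (law_at 0 R) \<noteq> {}" by (simp add: law_at_def space_state_space)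
  have "endpoint_law T R = law_at 0 R \<bind> J"
  proof (rule measure_eqI_pair[where A="?S" and B="?S"])
    show "finite_measure (endpoint_law T R)"
      unfolding endpoint_law_def by (rule finite_measure.finite_measure_distr) (auto intro: R.finite_measure_axioms)
    show "sets (endpoint_law T R) = sets (?S \<Otimes>\<^sub>M ?S)" by (simp add: endpoint_law_def)
    show "sets (law_at 0 R \<bind> J) = sets (?S \<Otimes>\<^sub>M ?S)" by (rule sets_bind) (auto simp: J_def ne)
    fix E F assume EF[measurable]: "E \<in> sets ?S" "F \<in> sets ?S"
    have "emeasure (endpoint_law T R) (E \<times> F) = emeasure R {\<omega> \<in> space R. \<omega> 0 \<in> E \<and> \<omega> T \<in> F}"
      unfolding endpoint_law_def by (subst emeasure_distr) (auto intro!: arg_cong[where f="emeasure R"])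
    also have "\<dots> = (\<integral>\<^sup>+z. indicator E z * emeasure (\<kappa> 0 T z) F \<partial>law_at 0 R)"
      by (rule strong_markov_at_zero[OF T order_refl R sm \<kappa> EF])
    also have "\<dots> = (\<integral>\<^sup>+z. emeasure (J z) (E \<times> F) \<partial>law_at 0 R)"
    proof (rule nn_integral_cong)
      fix z
      have "Pair z -` (E \<times> F) = (if z \<in> E then F else {})" by auto
      moreover have "E \<times> F \<in> sets (?S \<Otimes>\<^sub>M ?S)" by measurable
      ultimately show "indicator E z * emeasure (\<kappa> 0 T z) F = emeasure (J z) (E \<times> F)"
        by (simp add: J_em)
    qed
    also have "\<dots> = emeasure (law_at 0 R \<bind> J) (E \<times> F)"
      by (rule emeasure_bind[OF ne J_meas, symmetric]) simp
    finally show "emeasure (endpoint_law T R) (E \<times> F) = emeasure (law_at 0 R \<bind> J) (E \<times> F)" .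
  qed
  then have "emeasure (endpoint_law T R) N = (\<integral>\<^sup>+z. emeasure (J z) N \<partial>law_at 0 R)"
    using emeasure_bind[OF ne J_meas N] by simp
  then show ?thesis using J_em[OF N] by simp
qed

text \<open>The trace at one time of the constraints on a path. The kernels live on all states and
  do not respect these constraints by definition, so they have to be carried over from
  \<open>R\<close>.\<close>

definition regular_state :: "real \<Rightarrow> ('n::finite) state set" where
  "regular_state t = {z. (regime z = Active \<and> ktime z = 0) \<or> (regime z = Dead \<and> ktime z \<le> t)}"

lemma regular_state_meas[measurable]: "regular_state t \<in> sets (state_space :: ('n::finite) state measure)"
proof -
  have "{z \<in> space state_space. (regime z = Active \<and> ktime z = 0) \<or> (regime z = Dead \<and> ktime z \<le> t)}
      \<in> sets (state_space :: 'n state measure)" by measurable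
  then show ?thesis by (simp add: space_state_space regular_state_def)
qed

lemma path_regular:
  assumes "\<omega> \<in> paths T" "t \<in> {0..T}"
  shows "\<omega> t \<in> regular_state t"
proof -
  consider "unkilled_path T \<omega>" | K where "K \<in> {0..T}" "killed_path T K \<omega>"
    using assms(1) unfolding paths_def by blast
  then show ?thesis
  proof cases
    case 1
    then show ?thesis using assms(2) unfolding unkilled_path_def regular_state_def by auto
  next
    case 2
    show ?thesis
    proof (cases "t < K")
      case True
      then show ?thesis using 2 assms(2) unfolding killed_path_def regular_state_def by auto
    next
      case False
      then obtain x where "\<omega> t = ((x, K), Dead)" using 2 assms(2) unfolding killed_path_def by auto
      then show ?thesis using False unfolding regular_state_def by auto
    qed
  qed
qed

lemma path_alive_start:
  assumes "\<omega> \<in> paths T" "regime (\<omega> 0) = Active" "t \<in> {0..T}" "regime (\<omega> t) = Dead"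
  shows "0 < ktime (\<omega> t)"
proof -
  have 0: "0 \<in> {0..T}" using assms by auto
  consider "unkilled_path T \<omega>" | K where "K \<in> {0..T}" "killed_path T K \<omega>"
    using assms(1) unfolding paths_def by blast
  then show ?thesis
  proof cases
    case 1
    then show ?thesis using assms(3,4) unfolding unkilled_path_def by auto
  next
    case 2
    then obtain x where x: "\<forall>t\<in>{K..T}. \<omega> t = ((x, K), Dead)" unfolding killed_path_def by blast
    have "0 < K"
    proof (rule ccontr)
      assume "\<not> 0 < K"
      then have "K = 0" using 2 by auto
      then show False using x 0 assms(2) by auto
    qed
    moreover have "\<not> t < K" using 2 assms(3,4) unfolding killed_path_def by auto
    ultimately show ?thesis using x assms(3) by auto
  qed
qed

text \<open>Started from an active state, a path cannot be killed at time \<open>0\<close>.\<close>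

definition reachable_state :: "real \<Rightarrow> ('n::finite) state set" where
  "reachable_state t = regular_state t \<inter> {z. regime z = Dead \<longrightarrow> 0 < ktime z}"

lemma reachable_state_meas[measurable]: "reachable_state t \<in> sets (state_space :: ('n::finite) state measure)"
proof -
  have "{z \<in> space state_space. regime z = Dead \<longrightarrow> 0 < ktime z}
      \<in> sets (state_space :: 'n state measure)" by measurable
  then show ?thesis by (simp add: space_state_space reachable_state_def)
qed

text \<open>\<open>\<kappa>\<close> is tied to path space only through the law of \<open>R\<close>,
  so the support property is obtained for almost every start, with an exceptional set that may
  depend on \<open>t\<close>; it is later used at countably many times.\<close>

lemma AE_reachable:
  fixes R :: "(real \<Rightarrow> ('n::finite) state) measure"
  assumes t: "0 \<le> t" "t \<le> T" and R: "path_measure T R" and sm: "strong_markov T \<kappa> R"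
    and \<kappa>: "transition_function T \<kappa>" and start: "AE z in law_at 0 R. z \<in> range alive"
  shows "AE z in law_at 0 R. emeasure (\<kappa> 0 t z) (- reachable_state t) = 0"
proof -
  let ?S = "state_space :: 'n state measure"
  have ev[measurable]: "(\<lambda>\<omega>. \<omega> 0) \<in> R \<rightarrow>\<^sub>M ?S" "(\<lambda>\<omega>. \<omega> t) \<in> R \<rightarrow>\<^sub>M ?S"
    using path_measureD(4)[OF R] t by auto
  have C[measurable]: "- reachable_state t \<in> sets ?S"
    using sets.compl_sets[OF reachable_state_meas[of t]] by (simp add: space_state_space Compl_eq_Diff_UNIV)
  have "AE \<omega> in R. \<omega> 0 \<in> range alive"
    using start unfolding law_at_def by (rule AE_distrD[rotated]) (rule ev)
  then have "AE \<omega> in R. \<omega> t \<in> reachable_state t"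
    using AE_space
  proof eventually_elim
    case (elim \<omega>)
    then have p: "\<omega> \<in> paths T" "regime (\<omega> 0) = Active" using path_measureD(3)[OF R] by (auto simp: alive_def)
    show ?case using path_regular[OF p(1), of t] path_alive_start[OF p, of t] t
      by (auto simp: reachable_state_def)
  qed
  then have "AE \<omega> in R. \<not> (\<omega> 0 \<in> UNIV \<and> \<omega> t \<in> - reachable_state t)" by simp
  then have "emeasure R {\<omega> \<in> space R. \<omega> 0 \<in> UNIV \<and> \<omega> t \<in> - reachable_state t} = 0"
    by (subst (asm) AE_iff_measurable[OF _ refl]) (auto simp del: Compl_iff, measurable)
  moreover have "UNIV \<in> sets ?S" using sets.top[of ?S] by (simp add: space_state_space)
  ultimately have "(\<integral>\<^sup>+z. indicator UNIV z * emeasure (\<kappa> 0 t z) (- reachable_state t) \<partial>law_at 0 R) = 0"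
    using strong_markov_at_zero[OF t R sm \<kappa> _ C, of UNIV] by simp
  moreover have "(\<lambda>z. emeasure (\<kappa> 0 t z) (- reachable_state t)) \<in> borel_measurable (law_at 0 R)"
    using measurable_compose[OF measurable_prob_algebraD[OF transition_functionD(1)[OF \<kappa> order_refl t]]
      measurable_emeasure_subprob_algebra[OF C]] by (simp add: law_at_def)
  ultimately show ?thesis by (simp add: nn_integral_0_iff_AE)
qed

text \<open>Up to time \<open>\<epsilon>\<close> a killed path has recorded a killing time at most \<open>\<epsilon>\<close>, so a terminal state
  killed after \<open>\<epsilon>\<close> is reached through an active state at time \<open>\<epsilon>\<close>, whose law has a positive
  density whatever the starting point.\<close>

lemma transition_null_transfer:
  fixes \<kappa> :: "real \<Rightarrow> real \<Rightarrow> ('n::finite) state \<Rightarrow> 'n state measure"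
  assumes T: "0 < T" and \<kappa>: "transition_function T \<kappa>" and dead: "dead_absorbing T \<kappa>"
    and dens: "positive_active_density T \<kappa>"
    and z: "\<And>i::nat. emeasure (\<kappa> 0 (T / real (Suc i)) (alive x)) (- reachable_state (T / real (Suc i))) = 0"
    and B[measurable]: "B \<in> sets state_space" and null: "emeasure (\<kappa> 0 T (alive x')) B = 0"
  shows "emeasure (\<kappa> 0 T (alive x)) B = 0"
proof -
  let ?S = "state_space :: 'n state measure"
  have C[measurable]: "- reachable_state t \<in> sets ?S" for t
    using sets.compl_sets[OF reachable_state_meas[of t]] by (simp add: space_state_space Compl_eq_Diff_UNIV)
  have \<kappa>_sets: "sets (\<kappa> s t w) = sets ?S" if "0 \<le> s" "s \<le> t" "t \<le> T" for s t w
    using measurable_space[OF transition_functionD(1)[OF \<kappa> that], of w] by (simp add: space_state_space space_prob_algebra)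
  obtain p where p: "\<And>s t x. 0 \<le> s \<and> s < t \<and> t \<le> T \<Longrightarrow>
          p s x t \<in> borel_measurable borel \<and> (\<forall>y. p s x t y > 0) \<and>
          (\<forall>A\<in>sets borel. emeasure (\<kappa> s t (alive x)) (alive ` A) =
             (\<integral>\<^sup>+y\<in>A. ennreal (p s x t y) \<partial>lborel))"
    using dens unfolding positive_active_density_def by blast
  \<comment> \<open>A set that is null for one positive density is Lebesgue null, hence null for the
    other.\<close>
  have transfer: "emeasure (\<kappa> 0 t (alive x)) (alive ` A) = 0"
    if t: "0 < t" "t \<le> T" and A[measurable]: "A \<in> sets borel" and 0: "emeasure (\<kappa> 0 t (alive x')) (alive ` A) = 0" for t A
  proof -
    have p': "p 0 x t \<in> borel_measurable borel" "p 0 x' t \<in> borel_measurable borel" "\<And>y. p 0 x' t y > 0"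
      "emeasure (\<kappa> 0 t (alive x)) (alive ` A) = (\<integral>\<^sup>+y\<in>A. ennreal (p 0 x t y) \<partial>lborel)"
      "emeasure (\<kappa> 0 t (alive x')) (alive ` A) = (\<integral>\<^sup>+y\<in>A. ennreal (p 0 x' t y) \<partial>lborel)"
      using p[of 0 t] t A by auto
    note [measurable] = p'(1,2)
    have "AE y in lborel. ennreal (p 0 x' t y) * indicator A y = 0"
      using 0 unfolding p'(5) by (subst (asm) nn_integral_0_iff_AE) auto
    then have "AE y in lborel. y \<notin> A"
    proof eventually_elim
      case (elim y)
      then show ?case using p'(3)[of y] by (auto simp: ennreal_eq_0_iff)
    qed
    then have "AE y in lborel. ennreal (p 0 x t y) * indicator A y = 0" by eventually_elim auto
    then show ?thesis unfolding p'(4) by (subst nn_integral_0_iff_AE) auto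
  qed
  \<comment> \<open>States of \<open>B\<close> killed after the intermediate time
    \<open>T / real (Suc i)\<close>. A reachable dead state has a positive killing time, so these
    countably many sets exhaust the reachable dead part of \<open>B\<close>.\<close>
  define late where "late i = B \<inter> {w. regime w = Dead \<and> T / real (Suc i) < ktime w}" for i
  have late_meas[measurable]: "late i \<in> sets ?S" for i
  proof -
    have "{w \<in> space ?S. regime w = Dead \<and> T / real (Suc i) < ktime w} \<in> sets ?S" by measurable
    then show ?thesis by (simp add: late_def space_state_space)
  qed
  have late0: "emeasure (\<kappa> 0 T (alive x)) (late i) = 0" for i
  proof -
    define \<epsilon> where "\<epsilon> = T / real (Suc i)"
    have late_eq: "late i = B \<inter> {w. regime w = Dead \<and> \<epsilon> < ktime w}" unfolding late_def \<epsilon>_def ..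
    have \<epsilon>: "0 < \<epsilon>" "\<epsilon> \<le> T" unfolding \<epsilon>_def using T by (auto simp: field_simps)
    have m\<epsilon>: "\<kappa> 0 \<epsilon> \<in> ?S \<rightarrow>\<^sub>M prob_algebra ?S" "\<kappa> \<epsilon> T \<in> ?S \<rightarrow>\<^sub>M prob_algebra ?S"
      using transition_functionD(1)[OF \<kappa>] \<epsilon> by auto
    have sets\<epsilon>[measurable_cong]: "sets (\<kappa> 0 \<epsilon> w) = sets ?S" for w using \<kappa>_sets[of 0 \<epsilon>] \<epsilon> by simp
    have e_meas[measurable]: "(\<lambda>w. emeasure (\<kappa> \<epsilon> T w) (late i)) \<in> borel_measurable ?S"
      by (rule measurable_compose[OF measurable_prob_algebraD[OF m\<epsilon>(2)]]) measurable
    have CK: "emeasure (\<kappa> 0 T w) (late i) = (\<integral>\<^sup>+v. emeasure (\<kappa> \<epsilon> T v) (late i) \<partial>\<kappa> 0 \<epsilon> w)" for w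
    proof -
      have "\<kappa> 0 T w = \<kappa> 0 \<epsilon> w \<bind> \<kappa> \<epsilon> T" using transition_functionD(2)[OF \<kappa>, of 0 \<epsilon> T w] \<epsilon> by simp
      moreover have "\<kappa> 0 \<epsilon> w \<in> space (prob_algebra ?S)" using measurable_space[OF m\<epsilon>(1), of w] by (simp add: space_state_space)
      ultimately show ?thesis using emeasure_bind_prob_algebra[OF _ m\<epsilon>(2) late_meas] by simp
    qed
    \<comment> \<open>Active positions at time \<epsilon> that lead to \<open>late i\<close> with
      positive probability. By Chapman-Kolmogorov they are negligible from \<open>x'\<close>, hence
      from \<open>x\<close>.\<close>
    define A where "A = {y. emeasure (\<kappa> \<epsilon> T (alive y)) (late i) \<noteq> 0}"
    have "{y \<in> space borel. emeasure (\<kappa> \<epsilon> T (alive y)) (late i) \<noteq> 0} \<in> sets borel" by measurable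
    then have A[measurable]: "A \<in> sets borel" by (simp add: A_def)
    have "late i \<subseteq> B" by (auto simp: late_def)
    then have "emeasure (\<kappa> 0 T (alive x')) (late i) = 0"
      using null emeasure_mono[of "late i" B "\<kappa> 0 T (alive x')"] \<kappa>_sets[of 0 T] T by simp
    then have "AE v in \<kappa> 0 \<epsilon> (alive x'). emeasure (\<kappa> \<epsilon> T v) (late i) = 0"
      unfolding CK by (subst (asm) nn_integral_0_iff_AE) auto
    then have "AE v in \<kappa> 0 \<epsilon> (alive x'). v \<notin> alive ` A" by eventually_elim (auto simp: A_def)
    then have "emeasure (\<kappa> 0 \<epsilon> (alive x')) (alive ` A) = 0"
      using alive_image[OF A] by (subst (asm) AE_iff_null_sets[symmetric]) auto
    then have "alive ` A \<in> null_sets (\<kappa> 0 \<epsilon> (alive x))"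
      using transfer[OF \<epsilon> A] alive_image[OF A] by auto
    moreover have "- reachable_state \<epsilon> \<in> null_sets (\<kappa> 0 \<epsilon> (alive x))"
      using z[of i] C[of \<epsilon>] by (intro null_setsI) (simp_all only: \<epsilon>_def[symmetric] sets\<epsilon>)
    ultimately have "AE v in \<kappa> 0 \<epsilon> (alive x). v \<notin> alive ` A \<and> v \<in> reachable_state \<epsilon>"
      using AE_not_in[of "alive ` A"] AE_not_in[of "- reachable_state \<epsilon>"] by (simp add: AE_conj_iff)
    then have "AE v in \<kappa> 0 \<epsilon> (alive x). emeasure (\<kappa> \<epsilon> T v) (late i) = 0"
    proof eventually_elim
      case (elim v)
      show ?case
      proof (cases "regime v")
        case Active
        then have "v = alive (pos v)" using elim by (auto simp: reachable_state_def regular_state_def alive_def prod_eq_iff)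
        then show ?thesis using elim by (auto simp: A_def)
      next
        case Dead
        then have "\<kappa> \<epsilon> T v = return ?S v" using dead \<epsilon> unfolding dead_absorbing_def by (meson less_imp_le order_refl)
        moreover have "v \<notin> late i" using Dead elim by (auto simp: reachable_state_def regular_state_def late_eq)
        ultimately show ?thesis by simp
      qed
    qed
    then show ?thesis unfolding CK by (subst nn_integral_0_iff_AE) auto
  qed
  define A where "A = {y. alive y \<in> B}"
  have A[measurable]: "A \<in> sets borel"
    using measurable_sets[OF alive_measurable B] by (simp add: A_def vimage_def)
  have "emeasure (\<kappa> 0 T (alive x')) (alive ` A) = 0"
    using null emeasure_mono[of "alive ` A" B "\<kappa> 0 T (alive x')"] \<kappa>_sets[of 0 T] T B by (auto simp: A_def)
  then have "emeasure (\<kappa> 0 T (alive x)) (alive ` A) = 0" using transfer[OF T order_refl A] by simp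
  note sT = \<kappa>_sets[of 0 T "alive x", OF order_refl less_imp_le[OF T] order_refl]
  from \<open>emeasure (\<kappa> 0 T (alive x)) (alive ` A) = 0\<close>
  have n1: "alive ` A \<in> null_sets (\<kappa> 0 T (alive x))"
    by (rule null_setsI) (simp only: sT alive_image[OF A])
  have n2: "(\<Union>i. late i) \<in> null_sets (\<kappa> 0 T (alive x))"
    by (intro null_sets_UN null_setsI late0) (simp only: sT late_meas)
  have "emeasure (\<kappa> 0 T (alive x)) (- reachable_state T) = 0" using z[of 0] by simp
  then have n3: "- reachable_state T \<in> null_sets (\<kappa> 0 T (alive x))"
    by (rule null_setsI) (simp only: sT C)
  have sub: "B \<subseteq> alive ` A \<union> (\<Union>i. late i) \<union> - reachable_state T"
  proof
    fix w assume w: "w \<in> B"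
    show "w \<in> alive ` A \<union> (\<Union>i. late i) \<union> - reachable_state T"
    proof (cases "w \<in> reachable_state T")
      case True
      show ?thesis
      proof (cases "regime w")
        case Active
        then have "w = alive (pos w)" using True by (auto simp: reachable_state_def regular_state_def alive_def prod_eq_iff)
        then have "w \<in> alive ` A" using w unfolding A_def by (metis image_eqI mem_Collect_eq)
        then show ?thesis by simp
      next
        case Dead
        then have pos: "0 < ktime w" using True by (auto simp: reachable_state_def)
        obtain i where "T / ktime w < real i" using reals_Archimedean2 by blast
        then have "T < real i * ktime w" using pos by (simp add: field_simps)
        then have "T < real (Suc i) * ktime w" using pos by (simp add: distrib_right)
        then have "T / real (Suc i) < ktime w" by (simp add: field_simps)
        then have "w \<in> late i" using w Dead by (simp add: late_def)
        then show ?thesis by blast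
      qed
    qed simp
  qed
  have "B \<in> null_sets (\<kappa> 0 T (alive x))"
    by (rule null_sets_subset[OF _ _ sub]) (intro null_sets.Un n1 n2 n3, simp only: sT B)
  then show ?thesis by auto
qed

text \<open>By Fubini almost every section of a null set is null for the terminal law, which is a
  mixture of kernels, hence null for the kernel from almost every start. It remains to return to the
  start that defines the section, and \<open>transition_null_transfer\<close> does this among good
  starts.\<close>

lemma endpoint_law_absolutely_continuous:
  fixes R :: "(real \<Rightarrow> ('n::finite) state) measure"
  assumes T: "0 < T" and R: "path_measure T R" and start: "law_at 0 R = alive_law \<mu>0" "sets \<mu>0 = sets borel"
    and \<kappa>: "transition_function T \<kappa>" and sm: "strong_markov T \<kappa> R" and dead: "dead_absorbing T \<kappa>"
    and dens: "positive_active_density T \<kappa>"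
  shows "absolutely_continuous (law_at 0 R \<Otimes>\<^sub>M law_at T R) (endpoint_law T R)"
  unfolding absolutely_continuous_def
proof
  let ?S = "state_space :: 'n state measure"
  interpret R: prob_space R using R by (rule path_measureD)
  have T0: "0 \<le> T" using T by simp
  have ev[measurable]: "(\<lambda>\<omega>. \<omega> 0) \<in> R \<rightarrow>\<^sub>M ?S" "(\<lambda>\<omega>. \<omega> T) \<in> R \<rightarrow>\<^sub>M ?S"
    using path_measureD(4)[OF R] T by auto
  interpret l0: prob_space "law_at 0 R" unfolding law_at_def by (rule R.prob_space_distr) simp
  interpret lT: prob_space "law_at T R" unfolding law_at_def by (rule R.prob_space_distr) simp
  interpret l: pair_prob_space "law_at 0 R" "law_at T R" ..
  have sl: "sets (law_at t R) = sets ?S" for t by (simp add: law_at_def)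
  have spl: "sets (law_at 0 R \<Otimes>\<^sub>M law_at T R) = sets (?S \<Otimes>\<^sub>M ?S)" by (intro sets_pair_measure_cong sl)
  fix N assume N: "N \<in> null_sets (law_at 0 R \<Otimes>\<^sub>M law_at T R)"
  then have Nm[measurable]: "N \<in> sets (?S \<Otimes>\<^sub>M ?S)" using spl by auto
  have sect[measurable]: "Pair z -` N \<in> sets ?S" for z by (rule sets_Pair1[OF Nm])
  have start': "AE z in law_at 0 R. z \<in> range alive"
  proof -
    have "alive \<in> \<mu>0 \<rightarrow>\<^sub>M ?S" using alive_measurable measurable_cong_sets[OF start(2) refl] by blast
    moreover have "{z \<in> space ?S. z \<in> range alive} \<in> sets ?S" using alive_image[of UNIV] by (simp add: space_state_space)
    ultimately show ?thesis unfolding start(1) alive_law_def by (subst AE_distr_iff) auto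
  qed
  \<comment> \<open>Reachability is demanded at the intermediate times used for late killings; being
    countably many, they leave a set of full measure.\<close>
  define good where "good z \<longleftrightarrow> z \<in> range alive \<and>
    (\<forall>i. emeasure (\<kappa> 0 (T / real (Suc i)) z) (- reachable_state (T / real (Suc i))) = 0)" for z
  have good: "AE z in law_at 0 R. good z"
    unfolding good_def AE_conj_iff AE_all_countable
  proof (intro conjI allI start')
    fix i :: nat
    have "0 \<le> T / real (Suc i)" "T / real (Suc i) \<le> T" using T by (auto simp: field_simps)
    then show "AE z in law_at 0 R. emeasure (\<kappa> 0 (T / real (Suc i)) z) (- reachable_state (T / real (Suc i))) = 0"
      by (rule AE_reachable[OF _ _ R sm \<kappa> start'])
  qed
  have k_meas: "(\<lambda>z. emeasure (\<kappa> 0 T z) B) \<in> borel_measurable (law_at 0 R)" if "B \<in> sets ?S" for B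
    using measurable_compose[OF measurable_prob_algebraD[OF transition_functionD(1)[OF \<kappa> order_refl T0 order_refl]]
      measurable_emeasure_subprob_algebra[OF that]] by (simp add: law_at_def)
  have "AE z in law_at 0 R. AE w in law_at T R. (z, w) \<notin> N"
    using l.AE_pair[OF AE_not_in[OF N]] .
  then have "AE z in law_at 0 R. emeasure (\<kappa> 0 T z) (Pair z -` N) = 0"
    using good
  proof eventually_elim
    case (elim z)
    have "emeasure (law_at T R) (Pair z -` N) = 0"
      using elim(1) sect[of z] sl[of T] by (subst (asm) AE_iff_measurable[OF _ refl]) (auto simp: vimage_def space_state_space law_at_def)
    moreover have "emeasure (law_at T R) (Pair z -` N) = (\<integral>\<^sup>+z'. emeasure (\<kappa> 0 T z') (Pair z -` N) \<partial>law_at 0 R)"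
    proof -
      have "emeasure (law_at T R) (Pair z -` N) = emeasure R {\<omega> \<in> space R. \<omega> 0 \<in> UNIV \<and> \<omega> T \<in> Pair z -` N}"
        unfolding law_at_def by (subst emeasure_distr) (auto intro!: arg_cong[where f="emeasure R"])
      also have "\<dots> = (\<integral>\<^sup>+z'. indicator UNIV z' * emeasure (\<kappa> 0 T z') (Pair z -` N) \<partial>law_at 0 R)"
        using sets.top[of ?S] by (intro strong_markov_at_zero[OF T0 order_refl R sm \<kappa> _ sect]) (simp add: space_state_space)
      finally show ?thesis by simp
    qed
    ultimately have "AE z' in law_at 0 R. emeasure (\<kappa> 0 T z') (Pair z -` N) = 0"
      using k_meas[OF sect] by (simp add: nn_integral_0_iff_AE)
    \<comment> \<open>A single start \<open>z'\<close> suffices, since null sets pass from it to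
      \<open>z\<close>.\<close>
    with good have "AE z' in law_at 0 R. \<exists>z'. good z' \<and> emeasure (\<kappa> 0 T z') (Pair z -` N) = 0"
      by eventually_elim blast
    then obtain z' where z': "good z'" "emeasure (\<kappa> 0 T z') (Pair z -` N) = 0" by auto
    obtain x where x: "z = alive x" using elim(2) unfolding good_def by blast
    obtain x' where x': "z' = alive x'" using z'(1) unfolding good_def by blast
    have "emeasure (\<kappa> 0 T (alive x)) (Pair z -` N) = 0"
    proof (rule transition_null_transfer[OF T \<kappa> dead dens _ sect])
      show "emeasure (\<kappa> 0 T (alive x')) (Pair z -` N) = 0" using z'(2) unfolding x' .
      show "emeasure (\<kappa> 0 (T / real (Suc i)) (alive x)) (- reachable_state (T / real (Suc i))) = 0" for i
        using elim(2) unfolding good_def x by blast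
    qed
    then show ?case unfolding x .
  qed
  then have "(\<integral>\<^sup>+z. emeasure (\<kappa> 0 T z) (Pair z -` N) \<partial>law_at 0 R) = (\<integral>\<^sup>+z. 0 \<partial>law_at 0 R)"
    by (rule nn_integral_cong_AE)
  then have "emeasure (endpoint_law T R) N = 0"
    unfolding emeasure_endpoint_law[OF T0 R sm \<kappa> Nm] by simp
  then show "N \<in> null_sets (endpoint_law T R)" by (auto simp: endpoint_law_def)
qed

section \<open>The bridge\<close>

text \<open>Under the density every integral carries the factor \<open>k\<close>, which removes the
  values of the log-density at zeros of \<open>k\<close>. Finiteness of the divergence thus becomes
  integrability of \<open>k ln k\<close>.\<close>

lemma KL_density_entropy:
  assumes "prob_space M" and k[measurable]: "k \<in> borel_measurable M" and k_nn: "\<And>x. 0 \<le> k x"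
  shows "KL (density M (\<lambda>x. ennreal (k x))) M =
    (if integrable M (\<lambda>x. k x * ln (k x)) then ereal (\<integral>x. k x * ln (k x) \<partial>M) else \<infinity>)"
proof -
  interpret prob_space M by fact
  let ?Q = "density M (\<lambda>x. ennreal (k x))"
  have ac: "absolutely_continuous M ?Q" by (rule absolutely_continuousI_density) simp
  have log_ln: "log (exp 1) x = ln x" for x :: real by (simp add: log_def)
  have "AE x in M. ennreal (k x) = RN_deriv M ?Q x" by (rule RN_deriv_unique) auto
  then have ed: "AE x in M. k x * entropy_density (exp 1) M ?Q x = k x * ln (k x)"
  proof eventually_elim
    case (elim x)
    then show ?case using k_nn[of x] unfolding entropy_density_def by (simp add: log_ln elim[symmetric])
  qed
  have "integrable ?Q (entropy_density (exp 1) M ?Q) \<longleftrightarrow> integrable M (\<lambda>x. k x * entropy_density (exp 1) M ?Q x)"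
    using k_nn measurable_entropy_density[of "exp 1" M ?Q] by (subst integrable_density) auto
  also have "\<dots> \<longleftrightarrow> integrable M (\<lambda>x. k x * ln (k x))"
    using ed measurable_entropy_density[of "exp 1" M ?Q] by (intro integrable_cong_AE) auto
  finally have "integrable ?Q (entropy_density (exp 1) M ?Q) \<longleftrightarrow> integrable M (\<lambda>x. k x * ln (k x))" .
  moreover have "KL_divergence (exp 1) M ?Q = (\<integral>x. k x * ln (k x) \<partial>M)"
    using KL_density[where f=k and b="exp 1"] k_nn by (simp add: log_ln)
  ultimately show ?thesis using ac unfolding KL_def by simp
qed

lemma finite_KL_density:
  assumes "prob_space P" "prob_space M" "sets P = sets M" "KL P M < \<infinity>"
  obtains k :: "'a \<Rightarrow> real" where "k \<in> borel_measurable M" "\<And>x. 0 \<le> k x" "P = density M (\<lambda>x. ennreal (k x))"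
    "integrable M k" "(\<integral>x. k x \<partial>M) = 1" "integrable M (\<lambda>x. k x * ln (k x))"
proof -
  interpret M: prob_space M by fact
  have ac: "absolutely_continuous M P" using assms(4) unfolding KL_def by (auto split: if_splits)
  obtain k where k: "k \<in> borel_measurable M" "\<And>x. 0 \<le> k x" "P = density M (\<lambda>x. ennreal (k x))"
    "integrable M k" "(\<integral>x. k x \<partial>M) = 1"
    by (rule prob_density_real[OF assms(1) M.sigma_finite_measure_axioms ac assms(3)]) (rule that)
  have "integrable M (\<lambda>x. k x * ln (k x))"
    using assms(4) unfolding k(3) KL_density_entropy[OF assms(2) k(1,2)] by (simp split: if_splits)
  with k show ?thesis by (intro that)
qed

lemma emeasure_regime_part:
  assumes M: "sets M = sets (state_space :: ('n::finite) state measure)" and A: "A \<in> sets borel"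
  shows "emeasure (regime_part i M) A = emeasure M {z. fst z \<in> A \<and> regime z = i}"
proof -
  have sp: "space M = UNIV" using sets_eq_imp_space_eq[OF M] by (simp add: space_state_space)
  have "fst \<in> M \<rightarrow>\<^sub>M borel" using state_measurable(1) measurable_cong_sets[OF M refl] by blast
  then have "fst \<in> restrict_space M {z. regime z = i} \<rightarrow>\<^sub>M borel" by (rule measurable_restrict_space1)
  then have "emeasure (regime_part i M) A = emeasure (restrict_space M {z. regime z = i}) (fst -` A \<inter> {z. regime z = i})"
    unfolding regime_part_def using A by (subst emeasure_distr) (auto simp: space_restrict_space sp)
  also have "\<dots> = emeasure M (fst -` A \<inter> {z. regime z = i})"
    by (rule emeasure_restrict_space) (auto simp: sp M)
  finally show ?thesis by (simp add: vimage_def Int_def)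
qed

text \<open>Within one regime \<open>fst\<close> is injective and loses no event, so the prescribed
  dead law becomes a condition on events inside the regime, the form used in
  \<open>competitor\<close>.\<close>

lemma regime_part_eq_iff:
  assumes M: "sets M = sets (state_space :: ('n::finite) state measure)" and N: "sets N = sets (state_space :: 'n state measure)"
  shows "regime_part i M = regime_part i N \<longleftrightarrow>
    (\<forall>B\<in>sets state_space. B \<subseteq> {z. regime z = i} \<longrightarrow> emeasure M B = emeasure N B)"
proof (intro iffI ballI impI)
  fix B :: "'n state set"
  assume eq: "regime_part i M = regime_part i N" and B: "B \<in> sets state_space" "B \<subseteq> {z. regime z = i}"
  have "(\<lambda>x. (x, i)) \<in> borel \<rightarrow>\<^sub>M (state_space :: 'n state measure)" unfolding state_space_def by measurable
  from measurable_sets[OF this B(1)] have A: "(\<lambda>x. (x, i)) -` B \<in> sets borel" by simp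
  have "{z. fst z \<in> (\<lambda>x. (x, i)) -` B \<and> regime z = i} = B" using B(2) by auto
  then show "emeasure M B = emeasure N B"
    using emeasure_regime_part[OF M A, of i] emeasure_regime_part[OF N A, of i] eq by simp
next
  assume eq: "\<forall>B\<in>sets state_space. B \<subseteq> {z. regime z = i} \<longrightarrow> emeasure M B = emeasure N B"
  show "regime_part i M = regime_part i N"
  proof (rule measure_eqI)
    show "sets (regime_part i M) = sets (regime_part i N)" by (simp add: regime_part_def)
    fix A assume "A \<in> sets (regime_part i M)"
    then have A[measurable]: "A \<in> sets borel" by (simp add: regime_part_def)
    have "{z \<in> space state_space. fst z \<in> A \<and> regime z = i} \<in> sets (state_space :: 'n state measure)" by measurable
    then have "{z. fst z \<in> A \<and> regime z = i} \<in> sets (state_space :: 'n state measure)" by (simp add: space_state_space)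
    then show "emeasure (regime_part i M) A = emeasure (regime_part i N) A"
      using emeasure_regime_part[OF M A, of i] emeasure_regime_part[OF N A, of i] eq by auto
  qed
qed

lemma endpoint_law_marginals:
  assumes P: "path_measure T (P :: (real \<Rightarrow> ('n::finite) state) measure)" and T: "0 \<le> T"
  shows "law_at 0 P = distr (endpoint_law T P) state_space fst" "law_at T P = distr (endpoint_law T P) state_space snd"
proof -
  have [measurable]: "(\<lambda>\<omega>. \<omega> 0) \<in> P \<rightarrow>\<^sub>M state_space" "(\<lambda>\<omega>. \<omega> T) \<in> P \<rightarrow>\<^sub>M state_space"
    using path_measureD(4)[OF P] T by auto
  show "law_at 0 P = distr (endpoint_law T P) state_space fst" "law_at T P = distr (endpoint_law T P) state_space snd"
    unfolding law_at_def endpoint_law_def by (subst distr_distr; simp add: comp_def)+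
qed

theorem theorem5p1p3:
  fixes T :: real
    and b :: "real \<Rightarrow> real^'n \<Rightarrow> real^('n::finite)"
    and \<sigma> :: "real \<Rightarrow> real^'n \<Rightarrow> real^'n^'n"
    and V :: "real \<Rightarrow> real^'n \<Rightarrow> real"
    and \<mu>0 \<rho>0 :: "(real^'n) measure"
    and W :: "'w measure"
    and G :: "real \<Rightarrow> 'w measure"
    and B :: "real \<Rightarrow> 'w \<Rightarrow> real^'n"
    and Z :: "'w \<Rightarrow> real \<Rightarrow> 'n state"
    and R Pstar :: "(real \<Rightarrow> 'n state) measure"
    and \<rho>T :: "'n state measure"
  assumes "0 < T"
    and "coefficient_assumption T b \<sigma> V"
    and "prob_space \<mu>0" and "sets \<mu>0 = sets borel"
    and "reference_measure T b \<sigma> V \<mu>0 W G B Z R"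
    and "prob_space \<rho>0" and "sets \<rho>0 = sets borel"
    and "terminal_target T \<rho>T"
    and "KL (alive_law \<rho>0 \<Otimes>\<^sub>M \<rho>T) (endpoint_law T R) < \<infinity>"
    and "star_bridge T R \<rho>0 (regime_part Dead \<rho>T) Pstar"
  shows "\<exists>f g :: 'n state \<Rightarrow> real.
           f \<in> borel_measurable state_space \<and> g \<in> borel_measurable state_space \<and>
           (\<forall>z. 0 \<le> f z) \<and> (\<forall>z. 0 \<le> g z) \<and>
           Pstar = density R (\<lambda>\<omega>. ennreal (f (\<omega> 0) * g (\<omega> T))) \<and>
           (\<forall>x \<tau>. g ((x, \<tau>), Active) = 1)"
proof -
  let ?S = "state_space :: 'n state measure"
  let ?D = "{z :: 'n state. regime z = Dead}"
  let ?X = "\<lambda>\<omega> :: real \<Rightarrow> 'n state. \<omega> 0" and ?Y = "\<lambda>\<omega> :: real \<Rightarrow> 'n state. \<omega> T"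
  have T0: "0 \<le> T" using assms(1) by simp
  obtain \<kappa> where R: "path_measure T R" "law_at 0 R = alive_law \<mu>0"
    and \<kappa>: "transition_function T \<kappa>" "strong_markov T \<kappa> R" "dead_absorbing T \<kappa>" "positive_active_density T \<kappa>"
    using assms(5) unfolding reference_measure_def by blast
  interpret R: prob_space R using R(1) by (rule path_measureD)
  have ev[measurable]: "?X \<in> R \<rightarrow>\<^sub>M ?S" "?Y \<in> R \<rightarrow>\<^sub>M ?S"
    using path_measureD(4)[OF R(1)] T0 by auto
  interpret E: prob_space "endpoint_law T R" unfolding endpoint_law_def by (rule R.prob_space_distr) simp
  have \<rho>T: "prob_space \<rho>T" "sets \<rho>T = sets ?S" "emeasure (regime_part Dead \<rho>T) UNIV < 1"
    using assms(8) unfolding terminal_target_def by auto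
  interpret \<rho>T: prob_space \<rho>T by fact
  interpret \<rho>0: prob_space \<rho>0 by fact
  have "alive \<in> \<rho>0 \<rightarrow>\<^sub>M ?S" using alive_measurable measurable_cong_sets[OF assms(7) refl] by blast
  then interpret \<alpha>: prob_space "alive_law \<rho>0" unfolding alive_law_def by (rule \<rho>0.prob_space_distr)
  have s\<alpha>: "sets (alive_law \<rho>0) = sets ?S" by (simp add: alive_law_def)
  interpret J: pair_prob_space "alive_law \<rho>0" \<rho>T ..
  have sJ: "sets (alive_law \<rho>0 \<Otimes>\<^sub>M \<rho>T) = sets (endpoint_law T R)"
    unfolding endpoint_law_def using s\<alpha> \<rho>T(2) by (simp cong: sets_pair_measure_cong)

  have adm: "star_admissible T \<rho>0 (regime_part Dead \<rho>T) Pstar"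
    and min: "\<And>Q. star_admissible T \<rho>0 (regime_part Dead \<rho>T) Q \<Longrightarrow> KL Pstar R \<le> KL Q R"
    and uniq: "\<And>Q. star_admissible T \<rho>0 (regime_part Dead \<rho>T) Q \<Longrightarrow> KL Q R \<le> KL Pstar R \<Longrightarrow> Q = Pstar"
  proof -
    have 1: "is_arg_min (\<lambda>Q. KL Q R) (star_admissible T \<rho>0 (regime_part Dead \<rho>T)) Pstar"
      and 2: "\<And>Q. is_arg_min (\<lambda>Q. KL Q R) (star_admissible T \<rho>0 (regime_part Dead \<rho>T)) Q \<Longrightarrow> Q = Pstar"
      using assms(10) unfolding star_bridge_def by auto
    show "star_admissible T \<rho>0 (regime_part Dead \<rho>T) Pstar" using 1 unfolding is_arg_min_def by blast
    show min: "KL Pstar R \<le> KL Q R" if "star_admissible T \<rho>0 (regime_part Dead \<rho>T) Q" for Q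
      using 1 that unfolding is_arg_min_def by (meson not_le)
    \<comment> \<open>An admissible measure that does at least as well as the minimiser is a
      minimiser too, so uniqueness applies.\<close>
    show "Q = Pstar" if "star_admissible T \<rho>0 (regime_part Dead \<rho>T) Q" "KL Q R \<le> KL Pstar R" for Q
      using that min by (intro 2) (auto simp: is_arg_min_def not_less intro: order_trans)
  qed
  have P: "path_measure T Pstar" "law_at 0 Pstar = alive_law \<rho>0"
    "regime_part Dead (law_at T Pstar) = regime_part Dead \<rho>T"
    using adm unfolding star_admissible_def by auto

  obtain k0 where k0: "k0 \<in> borel_measurable (endpoint_law T R)" "\<And>p. 0 \<le> k0 p"
    "alive_law \<rho>0 \<Otimes>\<^sub>M \<rho>T = density (endpoint_law T R) (\<lambda>p. ennreal (k0 p))"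
    "integrable (endpoint_law T R) k0" "(\<integral>p. k0 p \<partial>endpoint_law T R) = 1"
    "integrable (endpoint_law T R) (\<lambda>p. k0 p * ln (k0 p))"
    by (rule finite_KL_density[OF J.prob_space_axioms E.prob_space_axioms sJ assms(9)]) (rule that)
  have k0_meas[measurable]: "k0 \<in> borel_measurable (?S \<Otimes>\<^sub>M ?S)" using k0(1) by (simp add: endpoint_law_def)
  \<comment> \<open>Reweighting \<open>R\<close> by a function of the two endpoints realises the
    product target as an endpoint law with unchanged entropy. It bounds the minimum and is later the
    competitor with product endpoint law.\<close>
  define k1 where "k1 \<omega> = k0 (\<omega> 0, \<omega> T)" for \<omega>
  have k1_meas[measurable]: "k1 \<in> borel_measurable R" unfolding k1_def by measurable
  have k1_nn: "0 \<le> k1 \<omega>" for \<omega> unfolding k1_def by (rule k0)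
  have k1_int: "integrable R k1" "integrable R (\<lambda>\<omega>. k1 \<omega> * ln (k1 \<omega>))"
    using k0(4,6) unfolding endpoint_law_def k1_def by (subst (asm) (1 2) integrable_distr_eq; simp)+
  define Q1 where "Q1 = density R (\<lambda>\<omega>. ennreal (k1 \<omega>))"
  have Q1_end: "distr Q1 (?S \<Otimes>\<^sub>M ?S) (\<lambda>\<omega>. (\<omega> 0, \<omega> T)) = alive_law \<rho>0 \<Otimes>\<^sub>M \<rho>T"
    unfolding k0(3) endpoint_law_def Q1_def k1_def by (rule density_distr[symmetric]) measurable
  have k1_total: "(\<integral>\<omega>. k1 \<omega> \<partial>R) = 1"
    using k0(5) unfolding endpoint_law_def k1_def by (subst (asm) integral_distr) auto
  have path_density: "path_measure T (density R (\<lambda>\<omega>. ennreal (k \<omega>)))"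
    if "k \<in> borel_measurable R" "\<And>\<omega>. 0 \<le> k \<omega>" "integrable R k" "(\<integral>\<omega>. k \<omega> \<partial>R) = 1" for k
  proof -
    have "emeasure (density R (\<lambda>\<omega>. ennreal (k \<omega>))) (space R) = 1"
      using that by (simp add: emeasure_density nn_integral_eq_integral cong: nn_integral_cong)
    then have "prob_space (density R (\<lambda>\<omega>. ennreal (k \<omega>)))" by (intro prob_spaceI) simp
    then show ?thesis using path_measureD(2)[OF R(1)] by (simp add: path_measure_def)
  qed
  have Q1_path: "path_measure T Q1"
    unfolding Q1_def by (rule path_density[OF k1_meas k1_nn k1_int(1) k1_total])
  have Q1_laws: "law_at 0 Q1 = alive_law \<rho>0" "law_at T Q1 = \<rho>T"
  proof -
    have "endpoint_law T Q1 = alive_law \<rho>0 \<Otimes>\<^sub>M \<rho>T" using Q1_end by (simp add: endpoint_law_def)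
    then show "law_at 0 Q1 = alive_law \<rho>0" "law_at T Q1 = \<rho>T"
      unfolding endpoint_law_marginals[OF Q1_path T0]
      using distr_pair_marginals[OF \<alpha>.prob_space_axioms \<rho>T(1)]
        distr_cong[OF refl s\<alpha>, of _ fst fst] distr_cong[OF refl \<rho>T(2), of _ snd snd] by metis+
  qed
  have Q1_adm: "star_admissible T \<rho>0 (regime_part Dead \<rho>T) Q1"
    using Q1_path Q1_laws by (simp add: star_admissible_def)
  have KL_k: "KL (density R (\<lambda>\<omega>. ennreal (k \<omega>))) R = ereal (\<integral>\<omega>. k \<omega> * ln (k \<omega>) \<partial>R)"
    if "k \<in> borel_measurable R" "\<And>\<omega>. 0 \<le> k \<omega>" "integrable R (\<lambda>\<omega>. k \<omega> * ln (k \<omega>))" for k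
    using KL_density_entropy[OF R.prob_space_axioms that(1,2)] that(3) by simp
  have "KL Pstar R < \<infinity>"
    using min[OF Q1_adm] KL_k[OF k1_meas k1_nn k1_int(2)] unfolding Q1_def by auto
  then obtain h where h: "h \<in> borel_measurable R" "\<And>\<omega>. 0 \<le> h \<omega>" "Pstar = density R (\<lambda>\<omega>. ennreal (h \<omega>))"
    "integrable R h" "(\<integral>\<omega>. h \<omega> \<partial>R) = 1" "integrable R (\<lambda>\<omega>. h \<omega> * ln (h \<omega>))"
    using path_measureD(2)[OF R(1)] path_measureD(2)[OF P(1)]
    by (elim finite_KL_density[OF path_measureD(1)[OF P(1)] R.prob_space_axioms, rotated]) auto
  interpret H: partial_bridge R ?S ?S ?X ?Y ?D h
    by unfold_locales (use h ev in auto)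
  have em0: "emeasure (law_at 0 (density R (\<lambda>\<omega>. ennreal (k \<omega>)))) A = ennreal (\<integral>\<omega>. indicator A (\<omega> 0) * k \<omega> \<partial>R)"
    and emT: "emeasure (law_at T (density R (\<lambda>\<omega>. ennreal (k \<omega>)))) A = ennreal (\<integral>\<omega>. indicator A (\<omega> T) * k \<omega> \<partial>R)"
    if "k \<in> borel_measurable R" "\<And>\<omega>. 0 \<le> k \<omega>" "integrable R k" "A \<in> sets ?S" for k A
    unfolding law_at_def
    using H.emeasure_distr_density[OF that(1) ev(1) that(4) that(2,3)]
      H.emeasure_distr_density[OF that(1) ev(2) that(4) that(2,3)] by simp_all
  have int_nn: "0 \<le> (\<integral>\<omega>. indicator A (\<omega> t) * j \<omega> \<partial>R)" if "\<And>\<omega>. 0 \<le> j \<omega>"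
    for A :: "'n state set" and t and j :: "(real \<Rightarrow> 'n state) \<Rightarrow> real"
    using that by (intro integral_nonneg_AE) auto
  have sl: "sets (law_at t Q) = sets ?S" for t and Q :: "(real \<Rightarrow> 'n state) measure" by (simp add: law_at_def)
  \<comment> \<open>\<open>Pstar\<close> meets the targets, so they can be replaced by its own
    marginals; admissibility of a density is then the linear condition of
    \<open>competitor\<close>.\<close>
  have adm_iff: "star_admissible T \<rho>0 (regime_part Dead \<rho>T) (density R (\<lambda>\<omega>. ennreal (k \<omega>))) \<longleftrightarrow> H.competitor k"
    if k: "k \<in> borel_measurable R" "\<And>\<omega>. 0 \<le> k \<omega>" "integrable R k" "(\<integral>\<omega>. k \<omega> \<partial>R) = 1"
      "integrable R (\<lambda>\<omega>. k \<omega> * ln (k \<omega>))" for k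
  proof -
    let ?Q = "density R (\<lambda>\<omega>. ennreal (k \<omega>))"
    have "law_at 0 ?Q = alive_law \<rho>0 \<longleftrightarrow> (\<forall>A\<in>sets ?S. emeasure (law_at 0 ?Q) A = emeasure (law_at 0 Pstar) A)"
      unfolding P(2)[symmetric] by (auto intro!: measure_eqI simp: sl)
    also have "\<dots> \<longleftrightarrow> (\<forall>A\<in>sets ?S. (\<integral>\<omega>. indicator A (\<omega> 0) * k \<omega> \<partial>R) = (\<integral>\<omega>. indicator A (\<omega> 0) * h \<omega> \<partial>R))"
      unfolding h(3) using int_nn[OF k(2), of _ 0] int_nn[OF h(2), of _ 0] k h
      by (intro ball_cong refl) (simp add: em0 ennreal_inj)
    finally have 1: "law_at 0 ?Q = alive_law \<rho>0 \<longleftrightarrow> (\<forall>A\<in>sets ?S. (\<integral>\<omega>. indicator A (\<omega> 0) * k \<omega> \<partial>R) = (\<integral>\<omega>. indicator A (\<omega> 0) * h \<omega> \<partial>R))" .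
    have "regime_part Dead (law_at T ?Q) = regime_part Dead \<rho>T \<longleftrightarrow>
      (\<forall>A\<in>sets ?S. A \<subseteq> ?D \<longrightarrow> emeasure (law_at T ?Q) A = emeasure (law_at T Pstar) A)"
      unfolding P(3)[symmetric] by (rule regime_part_eq_iff[OF sl sl])
    also have "\<dots> \<longleftrightarrow> (\<forall>A\<in>sets ?S. A \<subseteq> ?D \<longrightarrow> (\<integral>\<omega>. indicator A (\<omega> T) * k \<omega> \<partial>R) = (\<integral>\<omega>. indicator A (\<omega> T) * h \<omega> \<partial>R))"
      unfolding h(3) using int_nn[OF k(2), of _ T] int_nn[OF h(2), of _ T] k h
      by (intro ball_cong refl) (simp add: emT ennreal_inj)
    finally show ?thesis
      using 1 path_density[OF k(1,2,3,4)] k unfolding star_admissible_def H.competitor_def by simp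
  qed
  interpret H: minimal_partial_bridge R ?S ?S ?X ?Y ?D h
  proof
    fix k assume c: "H.competitor k"
    note k = H.competitorD(1-4)[OF c] H.competitor_total[OF c]
    have a: "star_admissible T \<rho>0 (regime_part Dead \<rho>T) (density R (\<lambda>\<omega>. ennreal (k \<omega>)))"
      using adm_iff[OF k(1,2,3,5,4)] c by simp
    show "(\<integral>\<omega>. h \<omega> * ln (h \<omega>) \<partial>R) \<le> (\<integral>\<omega>. k \<omega> * ln (k \<omega>) \<partial>R)"
      using min[OF a] unfolding h(3) KL_k[OF h(1,2,6)] KL_k[OF k(1,2,4)] by simp
    assume "(\<integral>\<omega>. k \<omega> * ln (k \<omega>) \<partial>R) \<le> (\<integral>\<omega>. h \<omega> * ln (h \<omega>) \<partial>R)"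
    then have "density R (\<lambda>\<omega>. ennreal (k \<omega>)) = density R (\<lambda>\<omega>. ennreal (h \<omega>))"
      using uniq[OF a] unfolding h(3) KL_k[OF h(1,2,6)] KL_k[OF k(1,2,4)] by simp
    then have "AE \<omega> in R. ennreal (k \<omega>) = ennreal (h \<omega>)"
      using k(1) h(1) by (subst (asm) R.density_unique_iff) auto
    then show "AE \<omega> in R. k \<omega> = h \<omega>" by eventually_elim (simp add: ennreal_inj k(2) h(2))
  qed
  \<comment> \<open>An arbitrary active state serves as the common image of all surviving
    endpoints.\<close>
  interpret H: collapsed_bridge R ?S ?S ?X ?Y ?D h "alive 0"
    by unfold_locales (use alive_image[of "{0 :: real^'n}"] in \<open>auto simp: alive_def\<close>)
  have k1: "H.competitor k1"
    using adm_iff[OF k1_meas k1_nn k1_int(1) k1_total k1_int(2)] Q1_adm unfolding Q1_def by simp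
  have "ennreal (\<integral>\<omega>. indicator ?D (\<omega> T) * h \<omega> \<partial>R) < 1"
  proof -
    have "ennreal (\<integral>\<omega>. indicator ?D (\<omega> T) * h \<omega> \<partial>R) = emeasure (law_at T Pstar) ?D"
      unfolding h(3) using emT[OF h(1,2,4) regime_set] by simp
    also have "\<dots> = emeasure (regime_part Dead (law_at T Pstar)) UNIV"
      by (subst emeasure_regime_part[OF sl]) auto
    finally show ?thesis using \<rho>T(3) unfolding P(3) by simp
  qed
  then have alive: "(\<integral>\<omega>. indicator ?D (\<omega> T) * h \<omega> \<partial>R) < 1"
    by (simp add: ennreal_less_one_iff)
  have ac: "absolutely_continuous (distr R ?S ?X \<Otimes>\<^sub>M distr R ?S ?Y) (distr R (?S \<Otimes>\<^sub>M ?S) (\<lambda>\<omega>. (\<omega> 0, \<omega> T)))"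
    using endpoint_law_absolutely_continuous[OF assms(1) R(1,2) assms(4) \<kappa>] unfolding law_at_def endpoint_law_def .
  note factors = H.factorization[OF ac k1 \<alpha>.prob_space_axioms \<rho>T(1) s\<alpha> \<rho>T(2) Q1_end[unfolded Q1_def] alive]
  from factors obtain f where "f \<in> borel_measurable ?S" "\<exists>g\<in>borel_measurable ?S. (\<forall>x. 0 \<le> f x) \<and> (\<forall>y. 0 \<le> g y) \<and>
    (\<forall>y. y \<notin> ?D \<longrightarrow> g y = 1) \<and> (AE w in R. h w = f (w 0) * g (w T))" by (rule bexE)
  moreover from this(2) obtain g where "g \<in> borel_measurable ?S" "(\<forall>x. 0 \<le> f x) \<and> (\<forall>y. 0 \<le> g y) \<and>
    (\<forall>y. y \<notin> ?D \<longrightarrow> g y = 1) \<and> (AE w in R. h w = f (w 0) * g (w T))" by (rule bexE)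
  ultimately have fg: "f \<in> borel_measurable ?S" "g \<in> borel_measurable ?S" "\<forall>z. 0 \<le> f z" "\<forall>z. 0 \<le> g z"
    "\<forall>z. z \<notin> ?D \<longrightarrow> g z = 1" "AE \<omega> in R. h \<omega> = f (\<omega> 0) * g (\<omega> T)" by simp_all
  note [measurable] = fg(1,2) h(1)
  have "Pstar = density R (\<lambda>\<omega>. ennreal (f (\<omega> 0) * g (\<omega> T)))"
    unfolding h(3) using fg(6) by (intro density_cong) (auto elim: eventually_mono)
  with fg show ?thesis by (intro exI[of _ f] exI[of _ g]) auto
qed

end
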